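(* Let $r\in\{0,1,2,\dots\}$ be fixed and consider $n\to\infty$. Then the expectation and variance of the size $X_{n,r}$ of the $r$-fold path-cut random plane tree can be expressed as $$\mathbb{E}X_{n,r}=\frac{n}{2^{r+1}-1}-\frac{(2^r-1)(2^{r+1}-3)}{3(2^{r+1}-1)}+O(n^{-1}),\qquad \mathbb{V}X_{n,r}=\frac{2^{r+1}(2^r-1)}{3(2^{r+1}-1)^2}\,n+O(1).$$ The factorial moments ($d\ge 1$) are asymptotically given by $$\mathbb{E}X_{n,r}^{\underline d}=\frac{n^d}{(2^{r+1}-1)^d}+\frac{d}{12(2^{r+1}-1)^d}\bigl(4^{r+1}d-2^{r+4}d-3\cdot4^{r+1}+9\cdot2^{r+2}+6d-18\bigr)n^{d-1}+O(n^{d-3/2}).$$ Furthermore, $X_{n,r}$ is asymptotically normally distributed, i.e., for $x\in\mathbb{R}$ we have $$\mathbb{P}\Bigl(\frac{X_{n,r}-\mu n}{\sqrt{\sigma^2n}}\le x\Bigr)=\frac1{\sqrt{2\pi}}\int_{-\infty}^xe^{-t^2/2}\,dt+O(n^{-1/2})$$ for $\mu=\frac1{2^{r+1}-1}$ and $\sigma^2=\frac{2^{r+1}(2^r-1)}{3(2^{r+1}-1)^2}$. All $O$-constants depend implicitly on $r$.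
   Context: A plane tree is a finite rooted tree in which the children of every node are linearly ordered; its size is its number of nodes. A path is a plane tree in which every node has at most one child (including the single-node tree). For a plane tree $\tau$ that is not a path, $\rho(\tau)$ is the plane tree obtained by simultaneously deleting every node $v$ such that the subtree of $\tau$ consisting of $v$ and all its descendants is a path (i.e. all maximal paths ending in leaves are cut away); $\rho$ is not defined on paths. $X_{n,r}$ is the size of $\rho^r(\tau)$, where $\tau$ is chosen uniformly at random among all plane trees of size $n$; if $\rho^r(\tau)$ is not defined, then $X_{n,r}=0$. Falling factorial: $x^{\underline d}=x(x-1)\cdots(x-d+1)$.
   Formalization: The asymptotic normality is stated for r ≥ 1 only: for r = 0 one has σ² = 0 and X_{n,0} = n, so the normalised variable (X_{n,0} − μn)/√(σ²n) is 0/0 and undefined. *)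

theory Defs
  imports "HOL-Probability.Probability" "HOL-Library.Landau_Symbols"
begin

datatype plane_tree = Node (children: "plane_tree list")

text \<open>
  The automatically generated \<open>size\<close> function also counts the cells of the
  lists of children, so the number of nodes is defined separately.
\<close>

fun num_nodes :: "plane_tree \<Rightarrow> nat" where
  "num_nodes (Node ts) = 1 + sum_list (map num_nodes ts)"

fun is_path :: "plane_tree \<Rightarrow> bool" where
  "is_path (Node ts) \<longleftrightarrow> length ts \<le> 1 \<and> (\<forall>t \<in> set ts. is_path t)"

text \<open>
  Below a node that is kept, exactly the children whose subtrees are paths are deleted;
  such a child disappears together with all its descendants, whose subtrees are paths as
  well. A node whose subtree is not a path has only ancestors with the same property, so
  the root of a tree that is not a path is always kept. The value of \<open>delete_paths\<close>
  on a path is irrelevant.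
\<close>

fun delete_paths :: "plane_tree \<Rightarrow> plane_tree" where
  "delete_paths (Node ts) = Node (map delete_paths (filter (\<lambda>t. \<not> is_path t) ts))"

definition path_cut :: "plane_tree \<Rightarrow> plane_tree option" where
  "path_cut t = (if is_path t then None else Some (delete_paths t))"

fun path_cut_iter :: "nat \<Rightarrow> plane_tree \<Rightarrow> plane_tree option" where
  "path_cut_iter 0 t = Some t"
| "path_cut_iter (Suc r) t = Option.bind (path_cut_iter r t) path_cut"

definition path_cut_size :: "nat \<Rightarrow> plane_tree \<Rightarrow> nat" where
  "path_cut_size r t = (case path_cut_iter r t of None \<Rightarrow> 0 | Some t' \<Rightarrow> num_nodes t')"

definition plane_trees :: "nat \<Rightarrow> plane_tree set" where
  "plane_trees n = {t. num_nodes t = n}"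

definition random_plane_tree :: "nat \<Rightarrow> plane_tree pmf" where
  "random_plane_tree n = pmf_of_set (plane_trees n)"

definition falling_factorial :: "real \<Rightarrow> nat \<Rightarrow> real" where
  "falling_factorial x d = (\<Prod>i<d. x - real i)"

text \<open>
  \<^const>\<open>pmf_of_set\<close> is the uniform distribution only on finite nonempty sets.
\<close>

lemma num_nodes_pos: "num_nodes t \<ge> 1"
  by (cases t) simp

lemma finite_plane_trees: "finite (plane_trees n)"
proof -
  have "finite {t. num_nodes t \<le> n}"
  proof (induction n)
    case 0
    have "\<not> num_nodes t \<le> 0" for t
      using num_nodes_pos[of t] by linarith
    then have "{t. num_nodes t \<le> 0} = {}" by blast
    then show ?case by (metis finite.emptyI)
  next
    case (Suc n)
    have len: "length ts \<le> sum_list (map num_nodes ts)" for ts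
    proof (induction ts)
      case (Cons t ts)
      then show ?case using num_nodes_pos[of t] by simp
    qed simp
    have "{t. num_nodes t \<le> Suc n} \<subseteq>
            Node ` {ts. set ts \<subseteq> {t. num_nodes t \<le> n} \<and> length ts \<le> n}"
    proof
      fix t assume t: "t \<in> {t. num_nodes t \<le> Suc n}"
      obtain ts where ts: "t = Node ts" by (cases t)
      have s: "sum_list (map num_nodes ts) \<le> n" using t ts by simp
      have "num_nodes u \<le> n" if "u \<in> set ts" for u
        using member_le_sum_list[of "num_nodes u" "map num_nodes ts"] that s by auto
      then show "t \<in> Node ` {ts. set ts \<subseteq> {t. num_nodes t \<le> n} \<and> length ts \<le> n}"
        using ts s len[of ts] by auto
    qed
    then show ?case
      using finite_lists_length_le[OF Suc.IH] finite_subset by blast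
  qed
  then show ?thesis
    by (rule rev_finite_subset) (auto simp: plane_trees_def)
qed

lemma plane_trees_nonempty: "n \<ge> 1 \<Longrightarrow> plane_trees n \<noteq> {}"
proof -
  assume "n \<ge> 1"
  have "num_nodes (Node (replicate (n - 1) (Node []))) = n"
    using \<open>n \<ge> 1\<close> by (simp add: map_replicate_const sum_list_replicate)
  then show ?thesis unfolding plane_trees_def by blast
qed

end

theory Submission
  imports Defs "HOL-Complex_Analysis.Complex_Analysis" "HOL-Real_Asymp.Real_Asymp"
begin

text \<open>
  Cutting is recursive in the children, so the trees on which the \<open>r\<close>-th cut is undefined and the size
  of the \<open>r\<close>-fold cut tree are described by generating functions built up algebraically from those of
  the children. Marking the size by \<open>v = e\<^sup>s\<close> turns the functional equation into a quadratic one: the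
  generating function is a square root plus a series that converges beyond the singularity \<open>1/4\<close> of
  the plain Catalan series. For \<open>s\<close> near \<open>0\<close> the radicand keeps a single simple zero, which moves
  analytically with \<open>s\<close>. Extracting coefficients gives a quasi-power
  \<open>E e\<^sup>s\<^sup>X = e\<^sup>n\<^sup>\<Lambda>\<^sup>(\<^sup>s\<^sup>) \<Psi>\<^sub>n(s)\<close> with \<open>\<Psi>\<^sub>n\<close> bounded on a disc independent of \<open>n\<close>.

  Cauchy's estimates for \<open>\<Psi>\<^sub>n\<close> yield the variance and all moments of \<open>X - \<mu> n\<close> up to the required
  order, and Esseen's smoothing inequality yields the normal limit with its rate. Only the constant term
  of the mean is finer than what a bounded \<open>\<Psi>\<^sub>n\<close> gives; it is read off from the expansion at \<open>1/4\<close> of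
  the derivative with respect to \<open>v\<close>.
\<close>

text \<open>The difficulty is uniformity: one bound has to hold for all \<open>n\<close> and for all
  \<open>s\<close> in a fixed disc although the singularity moves with \<open>s\<close>. Instead of
  transferring singular expansions along contours, the radicand is factored as (1 - z / \<zeta>)
  k(z)^2 with k analytic and bounded on a fixed disc beyond 1/4, and the coefficients of sqrt (1 - z
  / \<zeta>) k(z) are compared with the n-th coefficient of sqrt (1 - x) by an elementary
  convolution estimate. The same coefficient gives the number of trees exactly, so it cancels.

  The zero \<zeta> does not come from an implicit function theorem: for fixed z its equation is
  quadratic in v, so v is an explicit function of z, which is inverted near 1/4.

  The constants come from the value and the derivative at 1/4 of the generating function of the
  trees without an r-th cut. In terms of m = 2^(r+1) - 1 the recursion in r is m -> 2 m + 1, and the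
  factor v - 1 in front of this series keeps its higher derivatives out of mean and variance. The
  error n^(d - 3/2) of the factorial moments is n^(d - 3) times the order n^(3/2) of the third
  absolute moment of X - \<mu> n.\<close>

section \<open>Iterated cutting in terms of the children of the root\<close>

text \<open>After \<open>r\<close> cuts a surviving root carries exactly the surviving children,
  each cut \<open>r\<close> times. Such a tree is a path iff at most one child is left and this
  child is a path, that is, disappears at the next cut. Hence the condition mixes \<open>r'\<close>
  (who is still present) with \<open>r\<close> (who disappears now).\<close>

lemma path_cut_iter_Node:
  "path_cut_iter r (Node ts) =
    (if (case r of 0 \<Rightarrow> False | Suc r' \<Rightarrow>
           length (filter (\<lambda>t. path_cut_iter r' t \<noteq> None) ts) \<le> 1 \<and>
           (\<forall>t\<in>set ts. path_cut_iter r t = None))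
     then None
     else Some (Node (map (\<lambda>t. the (path_cut_iter r t)) (filter (\<lambda>t. path_cut_iter r t \<noteq> None) ts))))"
proof (induction r)
  case 0
  then show ?case by simp
next
  case (Suc r)
  let ?b = "\<lambda>r t. path_cut_iter r t \<noteq> None"
  show ?case
  proof (cases "path_cut_iter r (Node ts)")
    case None
    then obtain r' where "r = Suc r'" and sm: "\<forall>t\<in>set ts. path_cut_iter r t = None"
      using Suc by (auto split: if_splits nat.splits)
    then have "filter (?b r) ts = []" by (auto simp: filter_empty_conv)
    moreover have "\<forall>t\<in>set ts. path_cut_iter (Suc r) t = None" using sm by simp
    ultimately show ?thesis using None by simp
  next
    case (Some t')
    have t': "t' = Node (map (\<lambda>t. the (path_cut_iter r t)) (filter (?b r) ts))"
      using Some by (subst (asm) Suc.IH) (simp del: path_cut_iter.simps split: if_splits)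
    have step: "path_cut_iter (Suc r) t = (if is_path (the (path_cut_iter r t)) then None
        else Some (delete_paths (the (path_cut_iter r t))))" if "?b r t" for t
      using that by (auto simp: path_cut_def)
    have None_iff: "path_cut_iter (Suc r) t = None \<longleftrightarrow> \<not> ?b r t \<or> is_path (the (path_cut_iter r t))" for t
      by (cases "path_cut_iter r t") (auto simp: path_cut_def)
    have 1: "is_path t' \<longleftrightarrow> length (filter (?b r) ts) \<le> 1 \<and>
           (\<forall>t\<in>set ts. path_cut_iter (Suc r) t = None)"
      unfolding t' by (auto simp only: None_iff is_path.simps length_map set_map set_filter ball_simps)
    have 2: "delete_paths t' = Node (map (\<lambda>t. the (path_cut_iter (Suc r) t)) (filter (?b (Suc r)) ts))"
    proof -
      have "filter (?b (Suc r)) ts = filter (\<lambda>t. \<not> is_path (the (path_cut_iter r t))) (filter (?b r) ts)"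
        unfolding filter_filter by (intro filter_cong) (simp_all only: None_iff de_Morgan_disj not_not conj_commute)
      then show ?thesis
        unfolding t' delete_paths.simps filter_map map_map o_def
        by (simp del: path_cut_iter.simps add: step)
    qed
    have "path_cut_iter (Suc r) (Node ts) = path_cut t'" using Some by simp
    also have "\<dots> = (if is_path t' then None else Some (delete_paths t'))"
      by (simp add: path_cut_def)
    finally show ?thesis unfolding 1 2 by simp
  qed
qed

definition cut_away :: "nat \<Rightarrow> plane_tree \<Rightarrow> bool" where
  "cut_away r t \<longleftrightarrow> path_cut_iter r t = None"

lemma cut_away_0 [simp]: "\<not> cut_away 0 t"
  by (simp add: cut_away_def)

lemma cut_away_Suc: "cut_away r t \<Longrightarrow> cut_away (Suc r) t"
  by (simp add: cut_away_def)

lemma cut_away_Suc_Node: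
  "cut_away (Suc r) (Node ts) \<longleftrightarrow>
     length (filter (\<lambda>t. \<not> cut_away r t) ts) \<le> 1 \<and> (\<forall>t\<in>set ts. cut_away (Suc r) t)"
  unfolding cut_away_def by (subst path_cut_iter_Node) (simp del: path_cut_iter.simps)

text \<open>Makes all children of a cut-away node have size 0; the functional equations below rest
  on this.\<close>

lemma cut_away_child: "cut_away r (Node ts) \<Longrightarrow> t \<in> set ts \<Longrightarrow> cut_away r t"
  by (cases r) (auto simp: cut_away_Suc_Node)

lemma path_cut_size_cut_away: "cut_away r t \<Longrightarrow> path_cut_size r t = 0"
  by (simp add: cut_away_def path_cut_size_def)

text \<open>The sum may run over all children because an undefined cut has size 0.\<close>

lemma path_cut_size_Node:
  "path_cut_size r (Node ts) =
     (if cut_away r (Node ts) then 0 else 1 + (\<Sum>t\<leftarrow>ts. path_cut_size r t))"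
proof (cases "cut_away r (Node ts)")
  case False
  then have "path_cut_iter r (Node ts) =
     Some (Node (map (\<lambda>t. the (path_cut_iter r t)) (filter (\<lambda>t. path_cut_iter r t \<noteq> None) ts)))"
    unfolding cut_away_def by (subst (asm) path_cut_iter_Node, subst path_cut_iter_Node) (auto split: if_splits)
  then have "path_cut_size r (Node ts) =
      1 + (\<Sum>t\<leftarrow>filter (\<lambda>t. path_cut_iter r t \<noteq> None) ts. num_nodes (the (path_cut_iter r t)))"
    by (simp add: path_cut_size_def o_def)
  also have "(\<Sum>t\<leftarrow>filter (\<lambda>t. path_cut_iter r t \<noteq> None) ts. num_nodes (the (path_cut_iter r t)))
     = (\<Sum>t\<leftarrow>ts. path_cut_size r t)"
    by (induction ts) (auto simp: path_cut_size_def)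
  finally show ?thesis using False by simp
qed (simp add: path_cut_size_cut_away)

subsection \<open>Generating functions of weighted trees and forests\<close>

definition forests :: "nat \<Rightarrow> plane_tree list set" where
  "forests n = {ts. sum_list (map num_nodes ts) = n}"

lemma plane_trees_0: "plane_trees 0 = {}"
proof -
  have "num_nodes t \<noteq> 0" for t using num_nodes_pos[of t] by linarith
  then show ?thesis by (simp add: plane_trees_def)
qed

lemma plane_trees_Suc: "plane_trees (Suc n) = Node ` forests n"
proof -
  have "t \<in> Node ` forests n" if "num_nodes t = Suc n" for t
    using that by (cases t) (auto simp: forests_def)
  then show ?thesis by (auto simp: plane_trees_def forests_def)
qed

lemma finite_forests: "finite (forests n)"
  using finite_plane_trees[of "Suc n"] unfolding plane_trees_Suc
  by (rule finite_imageD) (simp add: inj_on_def)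

text \<open>A nonempty forest is a first tree of size i followed by a forest of size n - i. The term
  i = 0 is empty because every tree has a node.\<close>

lemma sum_forests:
  fixes \<phi> :: "plane_tree list \<Rightarrow> 'a::comm_monoid_add"
  shows "sum \<phi> (forests n) = (if n = 0 then \<phi> [] else 0) +
    (\<Sum>i=0..n. \<Sum>t\<in>plane_trees i. \<Sum>ts\<in>forests (n - i). \<phi> (t # ts))"
proof -
  let ?S = "SIGMA i:{0..n}. plane_trees i \<times> forests (n - i)"
  let ?N = "if n = 0 then {[]} else {} :: plane_tree list set"
  have eq: "forests n = ?N \<union> (\<lambda>(i, t, ts). t # ts) ` ?S"
  proof (intro equalityI subsetI)
    fix us assume us: "us \<in> forests n"
    show "us \<in> ?N \<union> (\<lambda>(i, t, ts). t # ts) ` ?S"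
    proof (cases us)
      case (Cons t ts)
      have "(num_nodes t, t, ts) \<in> ?S"
        using us Cons by (auto simp: forests_def plane_trees_def)
      then have "t # ts \<in> (\<lambda>(i, t, ts). t # ts) ` ?S" by (rule rev_image_eqI) simp
      then show ?thesis using Cons by blast
    qed (use us in \<open>auto simp: forests_def\<close>)
  qed (auto simp: forests_def plane_trees_def split: if_splits)
  have fin: "finite ?S"
    using finite_plane_trees finite_forests by (intro finite_SigmaI) auto
  have inj: "inj_on (\<lambda>(i, t, ts). t # ts) ?S"
    by (auto simp: inj_on_def plane_trees_def)
  have "sum \<phi> (forests n) = sum \<phi> ?N + sum \<phi> ((\<lambda>(i, t, ts). t # ts) ` ?S)"
    unfolding eq using fin by (intro sum.union_disjoint) auto
  also have "sum \<phi> ((\<lambda>(i, t, ts). t # ts) ` ?S) = (\<Sum>(i, t, ts)\<in>?S. \<phi> (t # ts))"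
    by (subst sum.reindex[OF inj]) (simp add: case_prod_unfold)
  also have "\<dots> = (\<Sum>i=0..n. \<Sum>(t, ts)\<in>plane_trees i \<times> forests (n - i). \<phi> (t # ts))"
    using finite_plane_trees finite_forests by (subst sum.Sigma) auto
  also have "\<dots> = (\<Sum>i=0..n. \<Sum>t\<in>plane_trees i. \<Sum>ts\<in>forests (n - i). \<phi> (t # ts))"
    by (simp add: sum.cartesian_product)
  finally show ?thesis by simp
qed

definition tree_gf :: "(plane_tree \<Rightarrow> 'a::comm_ring_1) \<Rightarrow> 'a fps" where
  "tree_gf f = Abs_fps (\<lambda>n. sum f (plane_trees n))"

definition forest_gf :: "(plane_tree list \<Rightarrow> 'a::comm_ring_1) \<Rightarrow> 'a fps" where
  "forest_gf f = Abs_fps (\<lambda>n. sum f (forests n))"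

lemma tree_gf_nth_0 [simp]: "fps_nth (tree_gf f) 0 = 0"
  by (simp add: tree_gf_def plane_trees_0)

lemma tree_gf_Node: "tree_gf f = fps_X * forest_gf (\<lambda>ts. f (Node ts))"
proof (rule fps_ext)
  fix n
  show "fps_nth (tree_gf f) n = fps_nth (fps_X * forest_gf (\<lambda>ts. f (Node ts))) n"
  proof (cases n)
    case (Suc k)
    have "sum f (plane_trees (Suc k)) = (\<Sum>ts\<in>forests k. f (Node ts))"
      unfolding plane_trees_Suc by (subst sum.reindex) (auto simp: inj_on_def)
    then show ?thesis using Suc by (simp add: tree_gf_def forest_gf_def)
  qed simp
qed

lemma tree_gf_diff: "tree_gf (\<lambda>t. f t - g t) = tree_gf f - tree_gf g"
  by (rule fps_ext) (simp add: tree_gf_def sum_subtractf)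

lemma tree_gf_cmult: "tree_gf (\<lambda>t. c * f t) = fps_const c * tree_gf f"
  by (rule fps_ext) (simp add: tree_gf_def sum_distrib_left)

lemma forest_gf_add: "forest_gf (\<lambda>t. f t + g t) = forest_gf f + forest_gf g"
  by (rule fps_ext) (simp add: forest_gf_def sum.distrib)

text \<open>One linear recursion that serves both kinds of weights below: multiplicative ones
  (\<open>g = 0\<close>) and those that distinguish a single tree of the forest.\<close>

lemma forest_gf_Cons:
  assumes "\<And>t ts. \<phi> (t # ts) = g t * \<psi> ts + f t * \<phi> ts"
  shows "forest_gf \<phi> = fps_const (\<phi> []) + tree_gf g * forest_gf \<psi> + tree_gf f * forest_gf \<phi>"
proof (rule fps_ext)
  fix n
  have "sum \<phi> (forests n) = (if n = 0 then \<phi> [] else 0) +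
    ((\<Sum>i=0..n. sum g (plane_trees i) * sum \<psi> (forests (n - i))) +
     (\<Sum>i=0..n. sum f (plane_trees i) * sum \<phi> (forests (n - i))))"
    by (subst sum_forests) (simp add: assms sum.distrib sum_product)
  then show "fps_nth (forest_gf \<phi>) n =
      fps_nth (fps_const (\<phi> []) + tree_gf g * forest_gf \<psi> + tree_gf f * forest_gf \<phi>) n"
    by (simp add: forest_gf_def tree_gf_def fps_mult_nth add.assoc)
qed

text \<open>The geometric series 1 / (1 - T) of sequences of trees, stated without division so that
  it makes sense over any commutative ring.\<close>

lemma forest_gf_prod: "(1 - tree_gf f) * forest_gf (\<lambda>ts. prod_list (map f ts)) = 1"
proof -
  have "forest_gf (\<lambda>ts. prod_list (map f ts)) = fps_const 1 +
     tree_gf (\<lambda>_. 0) * forest_gf (\<lambda>_. 0) + tree_gf f * forest_gf (\<lambda>ts. prod_list (map f ts))"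
    by (subst forest_gf_Cons[where g = "\<lambda>_. 0" and \<psi> = "\<lambda>_. 0" and f = f]) auto
  moreover have "tree_gf (\<lambda>_. 0 :: 'a) = 0" by (rule fps_ext) (simp add: tree_gf_def)
  ultimately show ?thesis by (simp add: algebra_simps)
qed

text \<open>The sum over all choices of one distinguished tree, weighted by \<open>g\<close>, while
  the others are weighted by \<open>f\<close>: the derivative of the product of the
  \<open>f\<close>-weights in direction \<open>g\<close>. With an indicator for \<open>g\<close> it
  says that exactly one child is exceptional; with \<open>f = 1\<close> it is an additive
  parameter.\<close>

fun single_weight :: "(plane_tree \<Rightarrow> 'a::comm_ring_1) \<Rightarrow> (plane_tree \<Rightarrow> 'a) \<Rightarrow> plane_tree list \<Rightarrow> 'a" where
  "single_weight f g [] = 0"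
| "single_weight f g (t # ts) = g t * prod_list (map f ts) + f t * single_weight f g ts"

lemma forest_gf_single_weight: "(1 - tree_gf f)\<^sup>2 * forest_gf (single_weight f g) = tree_gf g"
proof -
  let ?P = "forest_gf (\<lambda>ts. prod_list (map f ts))"
  have "forest_gf (single_weight f g) = fps_const (single_weight f g []) +
     tree_gf g * ?P + tree_gf f * forest_gf (single_weight f g)"
    by (rule forest_gf_Cons) simp
  then have "(1 - tree_gf f) * forest_gf (single_weight f g) = tree_gf g * ?P"
    by (simp add: algebra_simps)
  then show ?thesis
    using forest_gf_prod[of f] by (metis (no_types, lifting) mult.assoc mult.commute mult.right_neutral power2_eq_square)
qed

subsection \<open>The generating functions of path cutting\<close>

definition cut_away_gf :: "nat \<Rightarrow> 'a::comm_ring_1 fps" where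
  "cut_away_gf r = tree_gf (\<lambda>t. of_bool (cut_away r t))"

definition path_cut_gf :: "nat \<Rightarrow> 'a::comm_ring_1 \<Rightarrow> 'a fps" where
  "path_cut_gf r v = tree_gf (\<lambda>t. v ^ path_cut_size r t)"

definition size_gf :: "nat \<Rightarrow> 'a::comm_ring_1 fps" where
  "size_gf r = tree_gf (\<lambda>t. of_nat (path_cut_size r t))"

lemma cut_away_gf_0: "cut_away_gf 0 = 0"
  by (rule fps_ext) (simp add: cut_away_gf_def tree_gf_def)

lemma cut_away_gf_nth_0 [simp]: "fps_nth (cut_away_gf r) 0 = 0"
  by (simp add: cut_away_gf_def)

lemma path_cut_gf_nth_0 [simp]: "fps_nth (path_cut_gf r v) 0 = 0"
  by (simp add: path_cut_gf_def)

lemma prod_list_of_bool: "prod_list (map (\<lambda>x. of_bool (P x)) xs) = (of_bool (\<forall>x\<in>set xs. P x) :: 'a::comm_semiring_1)"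
  by (induction xs) auto

text \<open>Either no child survives \<open>r\<close> cuts, or exactly one does and it disappears at
  the next cut. The latter child is selected by \<open>s' - s\<close>, which is an indicator because
  \<open>cut_away r\<close> implies \<open>cut_away (Suc r)\<close>.\<close>

lemma cut_away_Suc_weight:
  fixes s s' :: "plane_tree \<Rightarrow> 'a::comm_ring_1" and r :: nat
  defines "s \<equiv> \<lambda>t. of_bool (cut_away r t)" and "s' \<equiv> \<lambda>t. of_bool (cut_away (Suc r) t)"
  shows "s' (Node ts) = prod_list (map s ts) + single_weight s (\<lambda>t. s' t - s t) ts"
proof -
  let ?L = "\<lambda>ts. length (filter (\<lambda>t. \<not> cut_away r t) ts) \<le> 1 \<and> (\<forall>t\<in>set ts. cut_away (Suc r) t)"
  have "of_bool (?L ts) = prod_list (map s ts) + single_weight s (\<lambda>t. s' t - s t) ts"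
  proof (induction ts)
    case (Cons t ts)
    have p: "prod_list (map s ts) = of_bool (\<forall>t\<in>set ts. cut_away r t)" for ts
      by (simp add: s_def prod_list_of_bool)
    have e: "single_weight s (\<lambda>t. s' t - s t) ts = of_bool (?L ts) - of_bool (\<forall>t\<in>set ts. cut_away r t)"
      using Cons p[of ts] by (simp add: algebra_simps)
    have len: "length (filter (\<lambda>t. \<not> cut_away r t) ts) = 0 \<longleftrightarrow> (\<forall>t\<in>set ts. cut_away r t)"
      by (simp add: filter_empty_conv)
    have mono: "\<forall>t\<in>set ts. cut_away (Suc r) t" if "\<forall>t\<in>set ts. cut_away r t"
      using that cut_away_Suc by blast
    show ?case
    proof (cases "cut_away r t")
      case True
      then show ?thesis using cut_away_Suc[OF True]
        unfolding single_weight.simps e list.map(2) prod_list.Cons p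
        by (auto simp: s_def s'_def)
    next
      case False
      then show ?thesis using len mono
        unfolding single_weight.simps e list.map(2) prod_list.Cons p
        by (auto simp: s_def s'_def)
    qed
  qed simp
  then show ?thesis by (simp add: s'_def cut_away_Suc_Node)
qed

text \<open>The decomposition reads A' = X (1 / (1 - A) + (A' - A) / (1 - A)^2). It is linear in A',
  so clearing denominators determines A' from A.\<close>

lemma cut_away_gf_Suc:
  fixes A A' :: "'a::comm_ring_1 fps" and r :: nat
  defines "A \<equiv> cut_away_gf r" and "A' \<equiv> cut_away_gf (Suc r)"
  shows "A' * ((1 - A)\<^sup>2 - fps_X) = fps_X * (1 - 2 * A)"
proof -
  let ?s = "\<lambda>t. of_bool (cut_away r t) :: 'a" and ?s' = "\<lambda>t. of_bool (cut_away (Suc r) t) :: 'a"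
  let ?P = "forest_gf (\<lambda>ts. prod_list (map ?s ts))"
  let ?E = "forest_gf (single_weight ?s (\<lambda>t. ?s' t - ?s t))"
  have 1: "A' = fps_X * (?P + ?E)"
    unfolding A'_def cut_away_gf_def by (subst tree_gf_Node) (simp only: cut_away_Suc_weight forest_gf_add)
  have 2: "(1 - A) * ?P = 1"
    unfolding A_def cut_away_gf_def by (rule forest_gf_prod)
  have 3: "(1 - A)\<^sup>2 * ?E = A' - A"
    unfolding A_def A'_def cut_away_gf_def by (simp add: forest_gf_single_weight tree_gf_diff)
  have "(1 - A)\<^sup>2 * A' = fps_X * ((1 - A) * ((1 - A) * ?P) + (1 - A)\<^sup>2 * ?E)"
    unfolding 1 by (simp only: power2_eq_square distrib_left ac_simps)
  then have 4: "(1 - A)\<^sup>2 * A' = fps_X * ((1 - A) + (A' - A))"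
    unfolding 2 3 by simp
  have "A' * ((1 - A)\<^sup>2 - fps_X) = (1 - A)\<^sup>2 * A' - fps_X * A'"
    by (simp only: right_diff_distrib mult.commute)
  also have "\<dots> = fps_X * ((1 - A) + (A' - A) - A')"
    unfolding 4 by (simp only: right_diff_distrib)
  also have "(1 - A) + (A' - A) - A' = 1 - 2 * A"
    by (simp only: mult_2) simp
  finally show ?thesis .
qed

text \<open>In fractions, W = v X / (1 - W) + (1 - v) A: every root is marked by \<open>v\<close>,
  and the second term takes the mark back from the roots that are cut away.\<close>

lemma path_cut_gf_eq:
  fixes A W :: "'a::comm_ring_1 fps" and r :: nat and v :: 'a
  defines "A \<equiv> cut_away_gf r" and "W \<equiv> path_cut_gf r v"
  shows "(W - fps_const (1 - v) * A) * (1 - W) = fps_const v * fps_X"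
proof -
  let ?w = "\<lambda>t. v ^ path_cut_size r t"
  let ?P = "forest_gf (\<lambda>ts. prod_list (map ?w ts))"
  have prod: "prod_list (map ?w ts) = v ^ (\<Sum>t\<leftarrow>ts. path_cut_size r t)" for ts
    by (induction ts) (auto simp: power_add)
  \<comment> \<open>Below a cut-away node all sizes are 0, so the product of the weights is 1 and
    the correction turns \<open>v\<close> into 1.\<close>
  have Node: "?w (Node ts) = v * prod_list (map ?w ts) + (1 - v) * of_bool (cut_away r (Node ts))" for ts
  proof (cases "cut_away r (Node ts)")
    case True
    then have sum0: "(\<Sum>t\<leftarrow>ts. path_cut_size r t) = 0"
      by (auto simp: path_cut_size_cut_away dest: cut_away_child)
    show ?thesis unfolding prod path_cut_size_cut_away[OF True] sum0 using True by simp
  qed (simp add: prod path_cut_size_Node)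
  have "W = fps_X * forest_gf (\<lambda>ts. v * prod_list (map ?w ts)) + fps_X * forest_gf (\<lambda>ts. (1 - v) * of_bool (cut_away r (Node ts)))"
    unfolding W_def path_cut_gf_def by (subst tree_gf_Node) (simp only: Node forest_gf_add distrib_left)
  also have "fps_X * forest_gf (\<lambda>ts. (1 - v) * of_bool (cut_away r (Node ts))) = fps_const (1 - v) * A"
    unfolding A_def cut_away_gf_def by (subst tree_gf_Node[symmetric]) (rule tree_gf_cmult)
  also have "forest_gf (\<lambda>ts. v * prod_list (map ?w ts)) = fps_const v * ?P"
    by (rule fps_ext) (simp add: forest_gf_def sum_distrib_left)
  finally have 1: "W - fps_const (1 - v) * A = fps_X * (fps_const v * ?P)" by simp
  have 2: "(1 - W) * ?P = 1"
    unfolding W_def path_cut_gf_def by (rule forest_gf_prod)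
  have "(W - fps_const (1 - v) * A) * (1 - W) = fps_const v * fps_X * ((1 - W) * ?P)"
    unfolding 1 by (simp only: ac_simps)
  then show ?thesis unfolding 2 by simp
qed

text \<open>This encodes the derivative of the previous equation with respect to v at v = 1, where W
  becomes T. It is derived from the additivity of the size instead of differentiating a series in
  its parameter.\<close>

lemma size_gf_eq:
  fixes A T M :: "'a::comm_ring_1 fps" and r :: nat
  defines "A \<equiv> cut_away_gf r" and "T \<equiv> tree_gf (\<lambda>_. 1)" and "M \<equiv> size_gf r"
  shows "M * ((1 - T)\<^sup>2 - fps_X) = (T - A) * (1 - T)\<^sup>2"
proof -
  let ?x = "\<lambda>t. of_nat (path_cut_size r t) :: 'a"
  let ?E = "forest_gf (single_weight (\<lambda>_. 1) ?x)"
  have one: "prod_list (map (\<lambda>_. 1 :: 'a) ts) = 1" for ts :: "plane_tree list"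
    by (induction ts) auto
  have sw: "single_weight (\<lambda>_. 1) ?x ts = of_nat (\<Sum>t\<leftarrow>ts. path_cut_size r t)" for ts
    by (induction ts) (auto simp: one)
  have Node: "?x (Node ts) = single_weight (\<lambda>_. 1) ?x ts + (1 - of_bool (cut_away r (Node ts)))" for ts
  proof (cases "cut_away r (Node ts)")
    case True
    then have sum0: "(\<Sum>t\<leftarrow>ts. path_cut_size r t) = 0"
      by (auto simp: path_cut_size_cut_away dest: cut_away_child)
    show ?thesis unfolding sw path_cut_size_cut_away[OF True] sum0 using True by simp
  qed (simp add: sw path_cut_size_Node)
  have "M = fps_X * ?E + fps_X * forest_gf (\<lambda>ts. 1 - of_bool (cut_away r (Node ts)))"
    unfolding M_def size_gf_def by (subst tree_gf_Node) (simp only: Node forest_gf_add distrib_left)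
  also have "fps_X * forest_gf (\<lambda>ts. 1 - of_bool (cut_away r (Node ts))) = T - A"
    unfolding A_def T_def cut_away_gf_def tree_gf_diff[symmetric] by (subst tree_gf_Node) simp
  finally have 1: "M = fps_X * ?E + (T - A)" .
  have 2: "(1 - T)\<^sup>2 * ?E = M"
    unfolding T_def M_def size_gf_def by (rule forest_gf_single_weight)
  have "(1 - T)\<^sup>2 * (fps_X * ?E + (T - A)) = fps_X * ((1 - T)\<^sup>2 * ?E) + (T - A) * (1 - T)\<^sup>2"
    by (simp only: distrib_left ac_simps)
  then have 3: "(1 - T)\<^sup>2 * M = fps_X * M + (T - A) * (1 - T)\<^sup>2"
    unfolding 1[symmetric] 2 .
  have "M * ((1 - T)\<^sup>2 - fps_X) = (1 - T)\<^sup>2 * M - fps_X * M"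
    by (simp only: right_diff_distrib mult.commute)
  then show ?thesis unfolding 3 by simp
qed

subsection \<open>Analytic continuation of the cut-away series\<close>

lemma fps_eq_divideI:
  fixes f g h :: "'a::field fps"
  assumes "f * g = h" "fps_nth g 0 \<noteq> 0"
  shows "f = h / g"
  using assms by auto

text \<open>Nonnegative coefficients make the value at a positive point a majorant on the whole
  disc; this is how the denominator of the recursion is kept away from 0.\<close>

lemma norm_eval_fps_le:
  fixes F :: "complex fps"
  assumes pos: "\<And>n. fps_nth F n = of_real (a n)" "\<And>n. a n \<ge> (0::real)"
    and y: "norm z \<le> y" "ereal y < fps_conv_radius F"
  shows "norm (eval_fps F z) \<le> Re (eval_fps F (of_real y))"
proof -
  have y0: "y \<ge> 0" using y(1) norm_ge_zero order_trans by blast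
  have z: "ereal (norm z) < fps_conv_radius F" using y by (metis ereal_less_eq(3) order_le_less_trans)
  have "norm (eval_fps F z) \<le> (\<Sum>n. norm (fps_nth F n * z ^ n))"
    unfolding eval_fps_def using norm_summable_fps[OF z] by (rule summable_norm)
  also have "\<dots> \<le> (\<Sum>n. norm (fps_nth F n * of_real y ^ n))"
    using y y0 by (intro suminf_le norm_summable_fps z)
      (auto simp: norm_mult norm_power intro!: mult_left_mono power_mono)
  also have "(\<lambda>n. norm (fps_nth F n * of_real y ^ n)) = (\<lambda>n. Re (fps_nth F n * of_real y ^ n))"
    using pos y0 by (auto simp: norm_mult norm_power simp flip: of_real_power of_real_mult)
  also have "(\<Sum>n. Re (fps_nth F n * of_real y ^ n)) = Re (eval_fps F (of_real y))"
    using y y0 by (intro sums_unique[symmetric] sums_Re sums_eval_fps) simp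
  finally show ?thesis .
qed

lemma cut_away_gf_nth:
  "fps_nth (cut_away_gf r :: 'a::comm_ring_1 fps) n = of_nat (card {t \<in> plane_trees n. cut_away r t})"
  by (simp add: cut_away_gf_def tree_gf_def sum_of_bool_eq finite_plane_trees Int_def conj_commute)

text \<open>Induction on r, in which the recursion turns m into 2 m + 1, starting from m = 1 for the
  zero series. The value (m - 1) / (2 m) stays below 1/2, so the denominator (1 - A)^2 - X is
  positive at 1/4 and the quotient is again analytic beyond 1/4.\<close>

lemma cut_away_gf_singular_data:
  fixes r :: nat
  defines "m \<equiv> 2 ^ (r + 1) - 1 :: complex" and "F \<equiv> cut_away_gf r"
  shows "fps_conv_radius F > ereal (1 / 4)"
    and "eval_fps F (1 / 4) = (m - 1) / (2 * m)"
    and "eval_fps (fps_deriv F) (1 / 4) = 2 / 3 * (m\<^sup>2 - 1) / m"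
proof -
  have "fps_conv_radius (cut_away_gf r :: complex fps) > ereal (1 / 4) \<and>
    eval_fps (cut_away_gf r) (1 / 4) = (2 ^ (r + 1) - 2 :: complex) / (2 * (2 ^ (r + 1) - 1)) \<and>
    eval_fps (fps_deriv (cut_away_gf r)) (1 / 4) = 2 / 3 * ((2 ^ (r + 1) - 1)\<^sup>2 - 1 :: complex) / (2 ^ (r + 1) - 1)"
  proof (induction r)
    case 0
    then show ?case by (simp add: cut_away_gf_0)
  next
    case (Suc r)
    define m where "m = 2 ^ (r + 1) - (1 :: real)"
    have m: "m \<ge> 1" using self_le_power[of "2 :: real" "r + 1"] by (simp add: m_def)
    have m_c: "2 ^ (r + 1) = complex_of_real m + 1" by (simp add: m_def)
    define F :: "complex fps" where "F = cut_away_gf r"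
    define A1 where "A1 = 2 / 3 * (m\<^sup>2 - 1) / m"
    have rad: "fps_conv_radius F > ereal (1 / 4)" and F0: "eval_fps F (1 / 4) = of_real ((m - 1) / (2 * m))"
      and F1: "eval_fps (fps_deriv F) (1 / 4) = of_real A1"
      using Suc unfolding F_def m_c A1_def by auto
    let ?a = "\<lambda>x::real. Re (eval_fps F (of_real x))"
    have a: "Re (eval_fps F (1 / 4)) = (m - 1) / (2 * m)" using F0 by simp
    \<comment> \<open>At 1/4 the denominator is ((m + 1) / (2 m))^2 - 1/4 > 0, so by continuity the
      strict inequalities persist for some y slightly beyond 1/4.\<close>
    obtain y where y: "y > 1 / 4" "ereal y < fps_conv_radius F" "?a y < 1" "(1 - ?a y)\<^sup>2 > y"
    proof -
      have cont: "isCont ?a (1 / 4)"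
      proof -
        have "isCont (eval_fps F) (of_real (1 / 4))"
          using rad by (intro DERIV_isCont[OF has_field_derivative_eval_fps]) auto
        moreover have "isCont (\<lambda>x. complex_of_real x) (1 / 4)" by (intro continuous_intros)
        ultimately have "isCont (\<lambda>x. eval_fps F (of_real x)) (1 / 4)" by (rule isCont_o2[rotated])
        then show ?thesis by (rule continuous_Re)
      qed
      have ev1: "eventually (\<lambda>x. ?a x < 1) (at (1 / 4))"
        using cont m unfolding isCont_def by (intro order_tendstoD) (auto simp: a field_simps)
      have "isCont (\<lambda>x. (1 - ?a x)\<^sup>2 - x) (1 / 4)" using cont by (intro continuous_intros)
      moreover have "(1 - ?a (1 / 4))\<^sup>2 - 1 / 4 > 0"
      proof -
        have "1 - ?a (1 / 4) = (m + 1) / (2 * m)" using m by (simp add: a field_simps)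
        moreover have "(m + 1) / (2 * m) > 1 / 2" using m by (simp add: field_simps)
        then have "((m + 1) / (2 * m))\<^sup>2 > (1 / 2)\<^sup>2" by (intro power_strict_mono) auto
        ultimately show ?thesis by (simp add: power2_eq_square)
      qed
      ultimately have ev2: "eventually (\<lambda>x. (1 - ?a x)\<^sup>2 - x > 0) (at (1 / 4))"
        unfolding isCont_def by (intro order_tendstoD) auto
      obtain d where d: "d > 1 / 4" "ereal d < fps_conv_radius F"
        using ereal_dense2[OF rad] by auto
      have ev3: "eventually (\<lambda>x. x < d) (at (1 / 4))"
        using d by (intro order_tendstoD) auto
      have "eventually (\<lambda>x. ?a x < 1 \<and> (1 - ?a x)\<^sup>2 - x > 0 \<and> x < d \<and> x > 1 / 4) (at_right (1 / 4))"
        using ev1 ev2 ev3 eventually_at_right_less[of "1 / 4 :: real"] unfolding eventually_at_split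
        by (elim conjE, intro eventually_conj)
      then obtain x where "?a x < 1" "(1 - ?a x)\<^sup>2 - x > 0" "x < d" "x > 1 / 4"
        using eventually_happens'[OF trivial_limit_at_right_real] by blast
      moreover have "ereal x < fps_conv_radius F"
        using less_trans[of "ereal x" "ereal d"] d \<open>x < d\<close> by simp
      ultimately show ?thesis by (intro that[of x]) auto
    qed
    define G where "G = (1 - F)\<^sup>2 - fps_X"
    define H where "H = fps_X * (1 - 2 * F)"
    have F': "cut_away_gf (Suc r) = H / G"
    proof (rule fps_eq_divideI)
      show "cut_away_gf (Suc r) * G = H"
        using cut_away_gf_Suc[of r, where 'a = complex] by (simp add: F_def G_def H_def)
      show "fps_nth G 0 \<noteq> 0" by (simp add: G_def F_def power2_eq_square)
    qed
    have rad1: "fps_conv_radius (1 - F) \<ge> fps_conv_radius F" "fps_conv_radius (1 - 2 * F) \<ge> fps_conv_radius F"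
    proof -
      show "fps_conv_radius (1 - F) \<ge> fps_conv_radius F"
        using fps_conv_radius_diff[of 1 F] by simp
      have "fps_conv_radius F \<le> fps_conv_radius (2 * F)" using fps_conv_radius_mult[of 2 F] by simp
      also have "\<dots> \<le> fps_conv_radius (1 - 2 * F)" using fps_conv_radius_diff[of 1 "2 * F"] by simp
      finally show "fps_conv_radius (1 - 2 * F) \<ge> fps_conv_radius F" .
    qed
    have rad2: "fps_conv_radius ((1 - F)\<^sup>2) \<ge> fps_conv_radius F"
      using rad1(1) fps_conv_radius_power order_trans by blast
    have radG: "fps_conv_radius G \<ge> fps_conv_radius F"
      using rad2 fps_conv_radius_diff[of "(1 - F)\<^sup>2" fps_X] by (simp add: G_def)
    have radH: "fps_conv_radius H \<ge> fps_conv_radius F"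
      using rad1(2) fps_conv_radius_mult[of fps_X "1 - 2 * F"] by (simp add: H_def)
    have ev1: "eval_fps (1 - F) z = 1 - eval_fps F z" "eval_fps (1 - 2 * F) z = 1 - 2 * eval_fps F z"
      if "ereal (norm z) < fps_conv_radius F" for z
    proof -
      have "ereal (norm z) < fps_conv_radius (2 * F)"
        using less_le_trans[OF that, of "fps_conv_radius (2 * F)"] fps_conv_radius_mult[of 2 F] by simp
      then show "eval_fps (1 - F) z = 1 - eval_fps F z" "eval_fps (1 - 2 * F) z = 1 - 2 * eval_fps F z"
        using that by (simp_all add: eval_fps_diff eval_fps_mult)
    qed
    have evG: "eval_fps G z = (1 - eval_fps F z)\<^sup>2 - z" if "ereal (norm z) < fps_conv_radius F" for z
      using that rad1(1) rad2 by (simp add: G_def eval_fps_diff eval_fps_power ev1 less_le_trans)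
    have evH: "eval_fps H z = z * (1 - 2 * eval_fps F z)" if "ereal (norm z) < fps_conv_radius F" for z
      using that rad1(2) by (simp add: H_def eval_fps_mult ev1 less_le_trans)
    \<comment> \<open>A zero would give |z| = |1 - A(z)|^2, but |A(z)| <= A(y) forces |1 - A(z)|^2
      >= (1 - A(y))^2 > y > |z|.\<close>
    have nz: "eval_fps G z \<noteq> 0" if z: "z \<in> eball 0 (ereal y)" for z
    proof
      have "norm z < y" using z by simp
      then have z': "ereal (norm z) < fps_conv_radius F" using less_trans[of "ereal (norm z)" "ereal y"] y(2) by simp
      assume "eval_fps G z = 0"
      then have "norm z = (norm (1 - eval_fps F z))\<^sup>2"
        unfolding evG[OF z'] by (metis eq_iff_diff_eq_0 norm_power)
      moreover have "norm (eval_fps F z) \<le> ?a y"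
        by (rule norm_eval_fps_le[where a = "\<lambda>n. real (card {t \<in> plane_trees n. cut_away r t})"])
           (use \<open>norm z < y\<close> y(2) in \<open>auto simp: F_def cut_away_gf_nth\<close>)
      then have "norm (1 - eval_fps F z) \<ge> 1 - ?a y"
        using norm_triangle_ineq2[of 1 "eval_fps F z"] by simp
      then have "(norm (1 - eval_fps F z))\<^sup>2 \<ge> (1 - ?a y)\<^sup>2"
        using y(3) by (intro power_mono) auto
      ultimately show False using y(4) \<open>norm z < y\<close> by linarith
    qed
    have y_le: "ereal y \<le> Min {ereal y, fps_conv_radius H, fps_conv_radius G}"
      using y(2) radG radH by auto
    have pos: "fps_conv_radius H > 0" "fps_conv_radius G > 0" "ereal y > 0"
    proof -
      have "fps_conv_radius F > 0" using less_trans[OF _ rad, of 0] by simp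
      then show "fps_conv_radius H > 0" "fps_conv_radius G > 0" using radG radH by (metis less_le_trans)+
      show "ereal y > 0" using y(1) by simp
    qed
    have rad': "fps_conv_radius (H / G) \<ge> ereal y"
      using fps_conv_radius_divide'[OF pos nz] y_le by (meson order_trans)
    have ev': "eval_fps (H / G) z = z * (1 - 2 * eval_fps F z) / ((1 - eval_fps F z)\<^sup>2 - z)" if "norm z < y" for z
    proof -
      have "ereal (norm z) < Min {ereal y, fps_conv_radius H, fps_conv_radius G}"
        using less_le_trans[OF _ y_le, of "ereal (norm z)"] that by simp
      moreover have "ereal (norm z) < fps_conv_radius F" using less_trans[of "ereal (norm z)" "ereal y"] that y(2) by simp
      ultimately show ?thesis
        using eval_fps_divide'[OF pos nz] by (simp add: evG evH)
    qed
    have "ereal (1 / 4) < ereal y" using y(1) by simp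
    then have r14: "ereal (1 / 4) < fps_conv_radius (H / G)" using rad' by (rule less_le_trans)
    have val: "eval_fps (H / G) (1 / 4) = of_real (m / (2 * m + 1))"
    proof -
      have "eval_fps (H / G) (1 / 4) = of_real (1 / 4 * (1 - 2 * ((m - 1) / (2 * m))) / ((1 - (m - 1) / (2 * m))\<^sup>2 - 1 / 4))"
        using y(1) by (subst ev') (auto simp: F0)
      also have "1 / 4 * (1 - 2 * ((m - 1) / (2 * m))) / ((1 - (m - 1) / (2 * m))\<^sup>2 - 1 / 4) = m / (2 * m + 1)"
      proof -
        have "(1 - (m - 1) / (2 * m))\<^sup>2 - 1 / 4 = (2 * m + 1) / (4 * m\<^sup>2)"
          using m by (simp add: field_simps power2_eq_square)
        then show ?thesis using m by (simp add: field_simps power2_eq_square)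
      qed
      finally show ?thesis .
    qed
    have der: "eval_fps (fps_deriv (H / G)) (1 / 4) = of_real (2 / 3 * ((2 * m + 1)\<^sup>2 - 1) / (2 * m + 1))"
    proof -
      let ?f = "\<lambda>z. z * (1 - 2 * eval_fps F z) / ((1 - eval_fps F z)\<^sup>2 - z)"
      have n14: "ereal (norm (1 / 4 :: complex)) < fps_conv_radius F" using rad by simp
      define \<alpha> where "\<alpha> = (m - 1) / (2 * m)"
      have F0': "eval_fps F (1 / 4) = of_real \<alpha>" by (simp add: F0 \<alpha>_def)
      define f f' g g' where "f = 1 / 4 * (1 - 2 * \<alpha>)" and "f' = (1 - 2 * \<alpha>) - A1 / 2"
        and "g = (1 - \<alpha>)\<^sup>2 - 1 / 4" and "g' = - 2 * (1 - \<alpha>) * A1 - 1"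
      have g: "g = (2 * m + 1) / (4 * m\<^sup>2)"
        using m by (simp add: g_def \<alpha>_def field_simps power2_eq_square)
      have g0: "g \<noteq> 0" unfolding g using m by simp
      have g0': "(1 - eval_fps F (1 / 4))\<^sup>2 - 1 / 4 \<noteq> (0 :: complex)"
      proof -
        have "(1 - eval_fps F (1 / 4))\<^sup>2 - 1 / 4 = complex_of_real g" by (simp add: F0 g_def \<alpha>_def)
        then show ?thesis using g0 by simp
      qed
      have dF: "(eval_fps F has_field_derivative of_real A1) (at (1 / 4))"
        using has_field_derivative_eval_fps[OF n14] unfolding F1 .
      have d1: "(?f has_field_derivative of_real ((f' * g - f * g') / g\<^sup>2)) (at (1 / 4))"
        by (rule dF refl derivative_eq_intros g0')+
           (simp add: F0' F1 f_def f'_def g_def g'_def power2_eq_square, simp add: algebra_simps)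
      have val': "(f' * g - f * g') / g\<^sup>2 = 2 / 3 * ((2 * m + 1)\<^sup>2 - 1) / (2 * m + 1)"
      proof -
        have 1: "f = 1 / (4 * m)" "f' = (4 - m\<^sup>2) / (3 * m)" "g' = - (2 * (m + 1) * (m\<^sup>2 - 1) + 3 * m\<^sup>2) / (3 * m\<^sup>2)"
          using m unfolding f_def f'_def g'_def \<alpha>_def A1_def
          by (simp_all add: field_simps power2_eq_square)
        have 2: "f' * g - f * g' = (2 * m + 1) * (m + 1) / (6 * m ^ 3)"
          using m unfolding 1 g by (simp add: field_simps power2_eq_square power3_eq_cube)
        define q where "q = 2 * m + 1"
        have q: "q \<noteq> 0" "q\<^sup>2 - 1 = 4 * m * (m + 1)"
          using m by (auto simp: q_def power2_eq_square algebra_simps)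
        show ?thesis
          using m q(1) unfolding 2 unfolding g q_def[symmetric] q(2)
          by (simp add: field_simps power2_eq_square power3_eq_cube)
      qed
      have "((eval_fps (H / G)) has_field_derivative eval_fps (fps_deriv (H / G)) (1 / 4)) (at (1 / 4))"
        using r14 by (intro has_field_derivative_eval_fps) simp
      then have d2: "(?f has_field_derivative eval_fps (fps_deriv (H / G)) (1 / 4)) (at (1 / 4))"
        by (rule has_field_derivative_transform_within_open[where S = "ball 0 y"])
           (use y(1) ev' in auto)
      show ?thesis using DERIV_unique[OF d2 d1] unfolding val' .
    qed
    have m': "2 ^ (Suc r + 1) = complex_of_real (2 * m + 2)" by (simp add: m_def)
    have "(complex_of_real (2 * m + 2) - 2) / (2 * (of_real (2 * m + 2) - 1)) = of_real ((2 * m + 2 - 2) / (2 * (2 * m + 2 - 1)))"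
      by (simp only: of_real_diff of_real_divide of_real_mult of_real_numeral of_real_1)
    also have "(2 * m + 2 - 2) / (2 * (2 * m + 2 - 1)) = m / (2 * m + 1)"
      using m by (simp add: field_simps)
    finally have e1: "(complex_of_real (2 * m + 2) - 2) / (2 * (of_real (2 * m + 2) - 1)) = of_real (m / (2 * m + 1))" .
    have e2: "2 / 3 * ((complex_of_real (2 * m + 2) - 1)\<^sup>2 - 1) / (complex_of_real (2 * m + 2) - 1) =
        of_real (2 / 3 * ((2 * m + 1)\<^sup>2 - 1) / (2 * m + 1))"
      by (simp add: add.commute)
    show ?case
      unfolding F' val der m' e1 e2 using r14 by simp
  qed
  then show "fps_conv_radius F > ereal (1 / 4)"
    and "eval_fps F (1 / 4) = (m - 1) / (2 * m)"
    and "eval_fps (fps_deriv F) (1 / 4) = 2 / 3 * (m\<^sup>2 - 1) / m"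
    by (simp_all add: m_def F_def)
qed

subsection \<open>Esseen's smoothing inequality\<close>

text \<open>The Fourier transform of the triangle 1 - |t| / T on [-T, T]. At y = 0 division by zero
  yields 0 instead of the limit T, which changes the function on a null set only.\<close>

definition fejer :: "real \<Rightarrow> real \<Rightarrow> real" where
  "fejer T y = 2 * (1 - cos (T * y)) / (T * y\<^sup>2)"

lemma fejer_measurable [measurable]: "fejer T \<in> borel_measurable borel"
  unfolding fejer_def by measurable

lemma fejer_nonneg: "T > 0 \<Longrightarrow> fejer T y \<ge> 0"
  by (simp add: fejer_def)

lemma fejer_scale: "T > 0 \<Longrightarrow> fejer T y = T * fejer 1 (T * y)"
  by (cases "y = 0") (simp_all add: fejer_def power2_eq_square field_simps)

lemma fejer_minus: "fejer T (- y) = fejer T y"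
  by (simp add: fejer_def)

lemma set_integrable_triangle_iexp:
  "T > 0 \<Longrightarrow> set_integrable lborel {-T..T} (\<lambda>t. complex_of_real (1 - \<bar>t\<bar> / T) * iexp (t * y))"
  by (auto intro!: borel_integrable_atLeastAtMost' continuous_intros)

lemma fejer_fourier:
  assumes T: "T > 0" and y: "y \<noteq> 0"
  shows "(CLINT t:{-T..T}|lborel. complex_of_real (1 - \<bar>t\<bar> / T) * iexp (t * y)) = fejer T y"
proof -
  define c where "c = \<i> * complex_of_real y"
  have c: "c \<noteq> 0" "c\<^sup>2 = - complex_of_real (y\<^sup>2)" using y by (auto simp: c_def power_mult_distrib)
  let ?f = "\<lambda>t. complex_of_real (1 - \<bar>t\<bar> / T) * iexp (t * y)"
  have e: "iexp (t * y) = exp (of_real t * c)" for t by (simp add: c_def mult_ac)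
  \<comment> \<open>A primitive of (1 - s t / T) exp (t c); the values s = 1 and s = -1 serve the
    right and the left half of the triangle.\<close>
  let ?F = "\<lambda>s t. complex_of_real (1 - s * t / T) * (exp (of_real t * c) / c) + s * exp (of_real t * c) / (T * c\<^sup>2)"
  have F: "(?F s has_vector_derivative complex_of_real (1 - s * t / T) * exp (of_real t * c)) (at t within S)"
    for s t :: real and S
  proof -
    have "((\<lambda>z. (1 - of_real s * z / of_real T) * (exp (z * c) / c) + s * exp (z * c) / (T * c\<^sup>2))
        has_field_derivative (1 - of_real s * of_real t / of_real T) * exp (of_real t * c))
        (at (of_real t))"
      using c(1) T by (auto intro!: derivative_eq_intros simp: field_simps power2_eq_square)
    from has_vector_derivative_real_field[OF this] show ?thesis by simp
  qed
  have 1: "(?f has_integral ?F 1 T - ?F 1 0) {0..T}"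
    by (rule has_integral_eq[OF _ fundamental_theorem_of_calculus[OF _ F[of 1]]]) (use T in \<open>auto simp: c_def mult_ac\<close>)
  have 2: "(?f has_integral ?F (-1) 0 - ?F (-1) (-T)) {-T..0}"
    by (rule has_integral_eq[OF _ fundamental_theorem_of_calculus[OF _ F[of "-1"]]]) (use T in \<open>auto simp: c_def mult_ac\<close>)
  have "(?f has_integral (?F (-1) 0 - ?F (-1) (-T)) + (?F 1 T - ?F 1 0)) {-T..T}"
    using T by (intro has_integral_combine[OF _ _ 2 1]) auto
  also have "(?F (-1) 0 - ?F (-1) (-T)) + (?F 1 T - ?F 1 0) =
      (exp (of_real T * c) + exp (- (of_real T * c)) - 2) / (T * c\<^sup>2)"
    using T c(1) by (simp add: field_simps)
  also have "exp (of_real T * c) + exp (- (of_real T * c)) = of_real (2 * cos (T * y))"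
    by (simp add: c_def cos_of_real[symmetric] cos_exp_eq mult_ac)
  also have "(of_real (2 * cos (T * y)) - 2) / (T * c\<^sup>2) = complex_of_real (fejer T y)"
    using T y by (simp add: c(2) fejer_def field_simps)
  finally have "integral {-T..T} ?f = fejer T y" by (rule integral_unique)
  then show ?thesis
    by (subst set_borel_integral_eq_integral(2)[OF set_integrable_triangle_iexp[OF T]]) simp
qed

text \<open>From 1 - cos y <= y^2 / 2 and 1 - cos y <= 2 one gets (1 - cos y) (1 + y^2) <= 5/2 y^2,
  which is rounded up to 4 y^2.\<close>

lemma fejer_le: "fejer 1 y \<le> 8 * inverse (1 + y\<^sup>2)"
proof (cases "y = 0")
  case False
  have "cos y \<ge> -1" by simp
  moreover have "cos y \<ge> 1 - y\<^sup>2 / 2"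
  proof -
    have "(sin (y / 2))\<^sup>2 \<le> (y / 2)\<^sup>2"
      using abs_sin_x_le_abs_x[of "y / 2"] by (simp only: abs_le_square_iff)
    then show ?thesis using cos_double_sin[of "y / 2"] by (simp add: power_divide)
  qed
  moreover have "(1 - cos y) * y\<^sup>2 \<le> 2 * y\<^sup>2"
    using \<open>cos y \<ge> -1\<close> by (intro mult_right_mono) auto
  moreover have "(1 - cos y) * (1 + y\<^sup>2) = (1 - cos y) + (1 - cos y) * y\<^sup>2"
    by (simp add: algebra_simps)
  ultimately have "(1 - cos y) * (1 + y\<^sup>2) \<le> 4 * y\<^sup>2"
    using zero_le_power2[of y] by linarith
  then show ?thesis using False by (simp add: fejer_def divide_simps algebra_simps add_pos_nonneg)
qed (simp add: fejer_def)

lemma integrable_fejer: "integrable lborel (fejer 1)"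
proof (rule Bochner_Integration.integrable_bound)
  show "integrable lborel (\<lambda>x :: real. 8 * inverse (1 + x\<^sup>2))"
    using integrable_inverse_1_plus_square by (simp add: set_integrable_def einterval_def)
qed (use fejer_le in \<open>auto simp: fejer_nonneg add_nonneg_nonneg\<close>)

text \<open>On [1, 2] the kernel is at least (1 - cos 1) / 2, because there cos y <= cos 1 and y^2
  <= 4.\<close>

lemma integral_fejer_pos: "(LINT y|lborel. fejer 1 y) > 0"
proof -
  have "(LINT y|lborel. indicator {1..2::real} y * ((1 - cos 1) / 2)) \<le> (LINT y|lborel. fejer 1 y)"
  proof (rule integral_mono)
    show "integrable lborel (\<lambda>y. indicator {1..2::real} y * ((1 - cos 1 :: real) / 2))"
      by (intro integrable_mult_left) (auto intro!: integrable_real_indicator simp: emeasure_lborel_Icc_eq)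
    fix y :: real
    show "indicator {1..2} y * ((1 - cos 1) / 2) \<le> fejer 1 y"
    proof (cases "y \<in> {1..2}")
      case True
      have pi: "2 \<le> pi" by (rule pi_ge_two)
      have "cos y \<le> cos 1" using True pi by (intro cos_monotone_0_pi_le) auto
      moreover have "y\<^sup>2 \<le> 4" using True power_mono[of y 2 2] by simp
      moreover have "cos (1::real) \<le> 1" by simp
      ultimately have "(1 - cos 1) * y\<^sup>2 \<le> (1 - cos y) * 4"
        by (intro mult_mono) auto
      then show ?thesis using True by (simp add: fejer_def divide_simps)
    qed (simp add: fejer_nonneg)
  qed (rule integrable_fejer)
  moreover have "(LINT y|lborel. indicator {1..2::real} y * ((1 - cos 1 :: real) / 2)) = (1 - cos 1) / 2"
    by simp
  moreover have "cos (1::real) < cos 0" using pi_ge_two by (intro cos_monotone_0_pi) auto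
  ultimately show ?thesis by simp
qed

lemma CLINT_iexp_Ico:
  assumes "a \<le> b" "t \<noteq> 0"
  shows "(CLINT x|lborel. indicator {a..<b} x *\<^sub>R iexp (t * x)) = (iexp (t * b) - iexp (t * a)) / (\<i> * t)"
proof -
  have "(CLINT x|lborel. indicator {a..<b} x *\<^sub>R iexp (t * x)) = (CLINT x:{a..b}|lborel. iexp (t * x))"
    unfolding set_lebesgue_integral_def
    by (rule integral_cong_AE) (use AE_lborel_singleton[of b] in \<open>auto split: split_indicator\<close>)
  also have "\<dots> = integral {a..b} (\<lambda>x. iexp (t * x))"
    by (intro set_borel_integral_eq_integral borel_integrable_atLeastAtMost' continuous_intros)
  also have "((\<lambda>x. iexp (t * x)) has_integral iexp (t * b) / (\<i> * t) - iexp (t * a) / (\<i> * t)) {a..b}"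
  proof (intro fundamental_theorem_of_calculus assms)
    fix x
    have "((\<lambda>z. exp (\<i> * (t * z)) / (\<i> * t)) has_field_derivative iexp (t * x)) (at (of_real x))"
      using assms by (auto intro!: derivative_eq_intros simp: mult_ac)
    from has_vector_derivative_real_field[OF this]
    show "((\<lambda>x. iexp (t * x) / (\<i> * t)) has_vector_derivative iexp (t * x)) (at x within {a..b})" by simp
  qed
  then have "integral {a..b} (\<lambda>x. iexp (t * x)) = iexp (t * b) / (\<i> * t) - iexp (t * a) / (\<i> * t)"
    by (rule integral_unique)
  finally show ?thesis by (simp add: diff_divide_distrib)
qed

text \<open>A cdf is not integrable. Subtracting the Heaviside function, the cdf of the point mass
  at 0, writes it as an average over y of the indicators of the intervals between y and 0, up to
  sign. Their L1 norm is |y|, so a finite first moment is what Fubini asks for, and each interval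
  has an elementary Fourier transform.\<close>

lemma (in real_distribution) fourier_cdf:
  assumes int: "integrable M (\<lambda>x. x)"
  defines "E \<equiv> \<lambda>x. cdf M x - indicator {0..} x"
  shows "integrable lborel E"
    and "t \<noteq> 0 \<Longrightarrow> (CLINT x|lborel. E x * iexp (t * x)) = (1 - char M t) / (\<i> * t)"
proof -
  let ?g = "\<lambda>y x :: real. indicator {y..} x - indicator {0..} x :: real"
  let ?f = "\<lambda>t y x. ?g y x * iexp (t * x)"
  interpret P: pair_sigma_finite M lborel ..
  have meas_g [measurable]: "(\<lambda>(y, x). ?g y x) \<in> borel_measurable (M \<Otimes>\<^sub>M lborel)"
  proof -
    have "(\<lambda>(y, x). ?g y x) = (\<lambda>(y, x). (if y \<le> x then 1 else 0) - (if 0 \<le> x then 1 else 0))"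
      by (auto simp: fun_eq_iff)
    also have "\<dots> \<in> borel_measurable (M \<Otimes>\<^sub>M lborel)" by measurable
    finally show ?thesis .
  qed
  have meas_f [measurable]: "(\<lambda>(y, x). ?f t y x) \<in> borel_measurable (M \<Otimes>\<^sub>M lborel)" for t
  proof -
    have "(\<lambda>(y, x). ?f t y x) = (\<lambda>p. complex_of_real ((\<lambda>(y, x). ?g y x) p) * iexp (t * snd p))"
      by (simp add: fun_eq_iff)
    also have "\<dots> \<in> borel_measurable (M \<Otimes>\<^sub>M lborel)" by measurable
    finally show ?thesis .
  qed
  have abs_g: "\<bar>?g y x\<bar> = indicator {min y 0..<max y 0} x" for x y :: real
    by (auto split: split_indicator)
  have int_abs: "(LINT x|lborel. \<bar>?g y x\<bar>) = \<bar>y\<bar>" for y :: real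
    unfolding abs_g by (simp add: min_def max_def)
  have norm_f: "norm (?f t y x) = \<bar>?g y x\<bar>" for t y x
    unfolding norm_mult norm_of_real by simp
  have int_abs_g: "integrable lborel (\<lambda>x. \<bar>?g y x\<bar>)" for y :: real
    unfolding abs_g by (intro integrable_real_indicator) (auto simp: min_def max_def)
  have int_g: "integrable (M \<Otimes>\<^sub>M lborel) (\<lambda>(y, x). ?g y x)"
  proof (rule P.Fubini_integrable)
    show "integrable M (\<lambda>y. LINT x|lborel. norm (case (y, x) of (y, x) \<Rightarrow> ?g y x))"
      using int_abs integrable_abs[OF int] by simp
    show "AE y in M. integrable lborel (\<lambda>x. case (y, x) of (y, x) \<Rightarrow> ?g y x)"
    proof (rule AE_I2)
      fix y
      show "integrable lborel (\<lambda>x. case (y, x) of (y, x) \<Rightarrow> ?g y x)"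
        using int_abs_g[of y] by (subst integrable_norm_iff[symmetric]) auto
    qed
  qed measurable
  have int_f: "integrable (M \<Otimes>\<^sub>M lborel) (\<lambda>(y, x). ?f t y x)" for t
    by (rule Bochner_Integration.integrable_bound[OF int_g]) (use norm_f in \<open>auto simp del: of_real_diff\<close>)
  have cdf: "(LINT y|M. ?g y x) = E x" for x
  proof -
    have "(\<lambda>y. indicator {y..} x :: real) = indicator {..x}" by (auto simp: fun_eq_iff split: split_indicator)
    then have "(LINT y|M. indicator {y..} x :: real) = cdf M x"
      by (simp add: cdf_def)
    moreover have "integrable M (\<lambda>y. indicator {y..} x :: real)"
      unfolding \<open>(\<lambda>y. indicator {y..} x :: real) = indicator {..x}\<close>
      by (intro integrable_real_indicator) (auto simp: less_top[symmetric])
    ultimately show ?thesis by (simp add: E_def prob_space[unfolded space_eq_univ])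
  qed
  show "integrable lborel E"
    using P.integrable_snd[OF int_g] unfolding cdf .
  assume t: "t \<noteq> 0"
  have "(CLINT x|lborel. E x * iexp (t * x)) = (CLINT x|lborel. CLINT y|M. ?f t y x)"
    by (simp only: integral_mult_left_zero integral_complex_of_real cdf)
  also have "\<dots> = (CLINT y|M. CLINT x|lborel. ?f t y x)"
    by (rule P.Fubini_integral[OF int_f])
  also have "\<dots> = (CLINT y|M. (1 - iexp (t * y)) / (\<i> * t))"
  proof (rule Bochner_Integration.integral_cong[OF refl])
    fix y
    show "(CLINT x|lborel. ?f t y x) = (1 - iexp (t * y)) / (\<i> * t)"
    proof (cases "y \<le> 0")
      case True
      have "?f t y x = indicator {y..<0} x *\<^sub>R iexp (t * x)" for x
        using True by (auto split: split_indicator)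
      then show ?thesis using CLINT_iexp_Ico[OF True t] by simp
    next
      case False
      have "?f t y x = - (indicator {0..<y} x *\<^sub>R iexp (t * x))" for x
        using False by (auto split: split_indicator)
      then have "(CLINT x|lborel. ?f t y x) = - (CLINT x|lborel. indicator {0..<y} x *\<^sub>R iexp (t * x))"
        by simp
      also have "\<dots> = - ((iexp (t * y) - iexp (t * 0)) / (\<i> * t))"
        using False t by (subst CLINT_iexp_Ico) auto
      finally show ?thesis by (simp only: minus_divide_left) simp
    qed
  qed
  also have "\<dots> = (1 - char M t) / (\<i> * t)"
    unfolding char_def by (simp add: integrable_iexp prob_space[unfolded space_eq_univ])
  finally show "(CLINT x|lborel. E x * iexp (t * x)) = (1 - char M t) / (\<i> * t)" .
qed

text \<open>Convolving with the Fejer kernel multiplies the Fourier transform of the difference of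
  the cdfs by a triangle supported on [-T, T] and bounded by 1. That transform is (char N - char M)
  / (i t), which explains the factor |t| in front of \<open>g\<close>. The two Heaviside functions
  cancel in the difference.\<close>

lemma (in real_distribution) smoothed_cdf_diff_le:
  assumes N: "real_distribution N"
    and intM: "integrable M (\<lambda>x. x)" and intN: "integrable N (\<lambda>x. x)" and T: "T > 0"
    and g: "integrable lborel g" "\<And>t. g t \<ge> 0"
    and le: "\<And>t. \<bar>t\<bar> \<le> T \<Longrightarrow> norm (char M t - char N t) \<le> \<bar>t\<bar> * g t"
  shows "\<bar>LINT u|lborel. (cdf M (x - u) - cdf N (x - u)) * fejer T u\<bar> \<le> (LINT t|lborel. g t)"
proof -
  interpret N: real_distribution N by fact
  define D where "D = (\<lambda>x. cdf M x - cdf N x)"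
  have D_eq: "D = (\<lambda>x. (cdf M x - indicator {0..} x) - (cdf N x - indicator {0..} x))"
    by (simp add: D_def)
  have intD [simp, measurable]: "integrable lborel D"
    unfolding D_eq using fourier_cdf(1)[OF intM] N.fourier_cdf(1)[OF intN]
    by (rule Bochner_Integration.integrable_diff)
  have int_iexp: "integrable lborel (\<lambda>x. complex_of_real (f x) * iexp (t * x))"
    if "integrable lborel f" for f :: "real \<Rightarrow> real" and t
    by (rule Bochner_Integration.integrable_bound[OF that])
       (use borel_measurable_integrable[OF that] in \<open>auto simp: norm_mult\<close>)
  have D_fourier: "(CLINT x|lborel. D x * iexp (t * x)) = (char N t - char M t) / (\<i> * t)" if "t \<noteq> 0" for t
  proof -
    have "(CLINT x|lborel. D x * iexp (t * x)) =
       (CLINT x|lborel. complex_of_real (cdf M x - indicator {0..} x) * iexp (t * x)) -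
       (CLINT x|lborel. complex_of_real (cdf N x - indicator {0..} x) * iexp (t * x))"
      unfolding D_eq of_real_diff[of "_ - _" "_ - _"] left_diff_distrib[of "complex_of_real (_ - _)" "complex_of_real (_ - _)"]
      by (rule Bochner_Integration.integral_diff)
         (rule int_iexp fourier_cdf(1)[OF intM] N.fourier_cdf(1)[OF intN])+
    also have "\<dots> = (char N t - char M t) / (\<i> * t)"
      unfolding fourier_cdf(2)[OF intM that] N.fourier_cdf(2)[OF intN that]
      by (simp add: diff_divide_distrib)
    finally show ?thesis .
  qed
  let ?tri = "\<lambda>t. indicator {-T..T} t *\<^sub>R complex_of_real (1 - \<bar>t\<bar> / T)"
  let ?k = "\<lambda>t y. ?tri t * iexp (t * (y - x)) * D y"
  have norm_tri: "norm (?tri t) \<le> indicator {-T..T} t" for t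
    using T unfolding norm_scaleR norm_of_real by (auto split: split_indicator simp: abs_le_iff field_simps)
  have norm_k: "norm (?k t y) = norm (?tri t) * \<bar>D y\<bar>" for t y
    unfolding norm_mult norm_of_real by simp
  have int_tri: "integrable lborel (\<lambda>t. norm (?tri t))"
  proof (rule Bochner_Integration.integrable_bound)
    show "integrable lborel (indicator {-T..T} :: real \<Rightarrow> real)"
      by (intro integrable_real_indicator) (auto simp: emeasure_lborel_Icc_eq)
  qed (use norm_tri in auto)
  have int_k: "integrable (lborel \<Otimes>\<^sub>M lborel) (\<lambda>(t, y). ?k t y)"
  proof (rule lborel_pair.Fubini_integrable)
    show "(\<lambda>(t, y). ?k t y) \<in> borel_measurable (lborel \<Otimes>\<^sub>M lborel)" by measurable
    show "integrable lborel (\<lambda>t. LINT y|lborel. norm (case (t, y) of (t, y) \<Rightarrow> ?k t y))"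
      unfolding prod.case norm_k using int_tri by simp
    show "AE t in lborel. integrable lborel (\<lambda>y. case (t, y) of (t, y) \<Rightarrow> ?k t y)"
    proof (rule AE_I2)
      fix t
      have "integrable lborel (\<lambda>y. norm (?k t y))"
        unfolding norm_k using intD by simp
      then show "integrable lborel (\<lambda>y. case (t, y) of (t, y) \<Rightarrow> ?k t y)"
        by (subst (asm) integrable_norm_iff) auto
    qed
  qed
  have inner_y: "(CLINT y|lborel. ?k t y) = ?tri t * iexp (- (t * x)) * (CLINT y|lborel. D y * iexp (t * y))" for t
    by (subst integral_mult_right_zero[symmetric], rule Bochner_Integration.integral_cong)
       (auto simp: algebra_simps exp_diff exp_minus field_simps)
  have inner_t: "(CLINT t|lborel. ?k t y) = of_real (D y * fejer T (y - x))" if "y \<noteq> x" for y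
  proof -
    have "(CLINT t|lborel. ?k t y) = (CLINT t:{-T..T}|lborel. complex_of_real (1 - \<bar>t\<bar> / T) * iexp (t * (y - x))) * D y"
      unfolding set_lebesgue_integral_def
      by (subst integral_mult_left_zero[symmetric], rule Bochner_Integration.integral_cong) (auto simp: scaleR_conv_of_real)
    then show ?thesis using fejer_fourier[OF T, of "y - x"] that by simp
  qed
  have "complex_of_real (LINT y|lborel. D y * fejer T (y - x)) = (CLINT y|lborel. of_real (D y * fejer T (y - x)))"
    by (rule integral_complex_of_real[symmetric])
  also have "\<dots> = (CLINT y|lborel. CLINT t|lborel. ?k t y)"
  proof (rule integral_cong_AE)
    show "AE y in lborel. of_real (D y * fejer T (y - x)) = (CLINT t|lborel. ?k t y)"
      using AE_lborel_singleton[of x] by eventually_elim (rule inner_t[symmetric])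
    show "(\<lambda>y. CLINT t|lborel. ?k t y) \<in> borel_measurable lborel"
      using lborel_pair.integrable_snd[OF int_k] by simp
  qed measurable
  also have "\<dots> = (CLINT t|lborel. CLINT y|lborel. ?k t y)"
    by (rule lborel_pair.Fubini_integral[OF int_k])
  finally have eq: "complex_of_real (LINT y|lborel. D y * fejer T (y - x)) = (CLINT t|lborel. CLINT y|lborel. ?k t y)" .
  have "norm (CLINT t|lborel. CLINT y|lborel. ?k t y) \<le> (LINT t|lborel. norm (CLINT y|lborel. ?k t y))"
    by (rule integral_norm_bound)
  also have "\<dots> \<le> (LINT t|lborel. g t)"
  proof (rule integral_mono_AE)
    show "integrable lborel (\<lambda>t. norm (CLINT y|lborel. ?k t y))"
      using lborel_pair.integrable_fst[OF int_k] by (rule integrable_norm)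
    show "AE t in lborel. norm (CLINT y|lborel. ?k t y) \<le> g t"
      using AE_lborel_singleton[of 0]
    proof eventually_elim
      fix t :: real assume t: "t \<noteq> 0"
      have "norm (CLINT y|lborel. ?k t y) = norm (?tri t) * (norm (char M t - char N t) / \<bar>t\<bar>)"
        unfolding inner_y norm_mult D_fourier[OF t] norm_divide by (simp add: norm_minus_commute)
      also have "\<dots> \<le> g t"
      proof (cases "\<bar>t\<bar> \<le> T")
        case True
        have "norm (?tri t) * (norm (char M t - char N t) / \<bar>t\<bar>) \<le> 1 * g t"
          using norm_tri[of t] le[OF True] t g(2)[of t]
          by (intro mult_mono) (auto simp: field_simps split: split_indicator_asm)
        then show ?thesis by simp
      next
        case False
        then have "indicator {-T..T} t = (0 :: real)" by (auto simp: indicator_def)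
        then show ?thesis using g by simp
      qed
      finally show "norm (CLINT y|lborel. ?k t y) \<le> g t" .
    qed
  qed (rule g)
  finally have "\<bar>LINT y|lborel. D y * fejer T (y - x)\<bar> \<le> (LINT t|lborel. g t)"
    unfolding eq[symmetric] by simp
  also have "(LINT y|lborel. D y * fejer T (y - x)) = (LINT u|lborel. D (x - u) * fejer T u)"
    by (subst lborel_integral_real_affine[where c = "-1" and t = x]) (simp_all add: fejer_minus)
  finally show ?thesis by (simp add: D_def)
qed

text \<open>Where D nearly attains its maximal modulus, the one-sided Lipschitz bound keeps D >= 3/4
  \<Delta> - 2 L h on [p, p + 2 h]. Centring the kernel at p + h puts its bulk |u| <= h on this
  interval; the tail, of mass at most c / 8, costs at most \<Delta> c / 8.\<close>

lemma unsmooth_one_sided: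
  fixes D V :: "real \<Rightarrow> real"
  assumes D [measurable]: "D \<in> borel_measurable borel"
    and decr: "\<And>x s. s \<ge> 0 \<Longrightarrow> D (x + s) \<ge> D x - L * s"
    and V: "integrable lborel V" "\<And>u. V u \<ge> 0"
    and c: "(LINT u|lborel. V u) = c" "c > 0"
    and tail: "(LINT u|lborel. indicator {u. \<bar>u\<bar> > h} u * V u) \<le> c / 8"
    and h: "h \<ge> 0" and L: "L \<ge> 0"
    and \<Delta>: "\<And>x. \<bar>D x\<bar> \<le> \<Delta>" and p: "D p \<ge> 3 / 4 * \<Delta>"
    and \<eta>: "\<bar>LINT u|lborel. D (p + h - u) * V u\<bar> \<le> \<eta>"
  shows "\<Delta> \<le> 2 * \<eta> / c + 4 * L * h"
proof -
  have \<Delta>0: "\<Delta> \<ge> 0" using \<Delta>[of 0] by linarith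
  have \<eta>0: "\<eta> \<ge> 0" using \<eta> by linarith
  have Lh: "L * h \<ge> 0" using L h by simp
  define I where "I = (\<lambda>u::real. indicator {u. \<bar>u\<bar> > h} u :: real)"
  have [measurable]: "I \<in> borel_measurable borel" unfolding I_def by measurable
  define \<tau> where "\<tau> = (LINT u|lborel. I u * V u)"
  have intI: "integrable lborel (\<lambda>u. I u * V u)"
    using V(1) by (rule Bochner_Integration.integrable_bound)
      (use V in \<open>auto simp: I_def split: split_indicator\<close>)
  have \<tau>: "0 \<le> \<tau>" "\<tau> \<le> c / 8"
    using tail V(2) by (auto simp: \<tau>_def I_def intro!: Bochner_Integration.integral_nonneg)
  define \<delta> where "\<delta> = 3 / 4 * \<Delta> - 2 * L * h"
  show ?thesis
  proof (cases "\<delta> \<ge> 0")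
    case False
    have "\<Delta> \<le> 4 * L * h" using False Lh by (simp add: \<delta>_def)
    then show ?thesis using \<eta>0 c(2) by (smt (verit) divide_nonneg_pos)
  next
    case True
    have "\<delta> * (c - \<tau>) - \<Delta> * \<tau> = (LINT u|lborel. \<delta> * (V u - I u * V u) - \<Delta> * (I u * V u))"
      using V(1) intI c by (simp add: \<tau>_def)
    also have "\<dots> \<le> (LINT u|lborel. D (p + h - u) * V u)"
    proof (rule integral_mono)
      show "integrable lborel (\<lambda>u. \<delta> * (V u - I u * V u) - \<Delta> * (I u * V u))"
        using V(1) intI by simp
      have "integrable lborel (\<lambda>u. \<Delta> * V u)" using V(1) by simp
      then show "integrable lborel (\<lambda>u. D (p + h - u) * V u)"
        by (rule Bochner_Integration.integrable_bound)
           (use V \<Delta> \<Delta>0 in \<open>auto simp: abs_mult intro!: mult_right_mono borel_measurable_integrable[THEN borel_measurable_times[rotated]]\<close>)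
      fix u :: real
      show "\<delta> * (V u - I u * V u) - \<Delta> * (I u * V u) \<le> D (p + h - u) * V u"
      proof (cases "\<bar>u\<bar> > h")
        case True
        have "- \<Delta> * V u \<le> D (p + h - u) * V u"
          using \<Delta>[of "p + h - u"] V(2)[of u] by (intro mult_right_mono) auto
        then show ?thesis using True by (simp add: I_def)
      next
        case False
        have "D p - L * (h - u) \<le> D (p + (h - u))" using False by (intro decr) auto
        moreover have "L * (h - u) \<le> L * (2 * h)" using False L by (intro mult_left_mono) auto
        ultimately have "\<delta> \<le> D (p + h - u)" using p by (simp add: \<delta>_def algebra_simps)
        then have "\<delta> * V u \<le> D (p + h - u) * V u" using V(2) by (rule mult_right_mono)
        then show ?thesis using False by (simp add: I_def)
      qed
    qed
    also have "\<dots> \<le> \<eta>" using \<eta> by linarith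
    finally have "\<delta> * (c - \<tau>) - \<Delta> * \<tau> \<le> \<eta>" .
    moreover have "\<delta> * (7 / 8 * c) \<le> \<delta> * (c - \<tau>)" using True \<tau> by (intro mult_left_mono) auto
    moreover have "\<Delta> * \<tau> \<le> \<Delta> * (c / 8)" using \<Delta>0 \<tau> by (intro mult_left_mono) auto
    ultimately have "\<delta> * (7 / 8 * c) - \<Delta> * (c / 8) \<le> \<eta>" by linarith
    \<comment> \<open>Here 17/32 = 3/4 * 7/8 - 1/8 and 7/4 = 2 * 7/8. The factors 2 and 4 of the
      claim round up 32/17 and 56/17.\<close>
    then have "(17 / 32 * \<Delta> - 7 / 4 * (L * h)) * c \<le> \<eta>" by (simp add: \<delta>_def algebra_simps)
    then have "17 / 32 * \<Delta> - 7 / 4 * (L * h) \<le> \<eta> / c" using c(2) by (simp add: pos_le_divide_eq)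
    then have "17 * \<Delta> \<le> 32 * (\<eta> / c) + 56 * (L * h)" by simp
    moreover have "\<eta> / c \<ge> 0" using \<eta>0 c(2) by simp
    ultimately have "\<Delta> \<le> 2 * (\<eta> / c) + 4 * (L * h)" using Lh by linarith
    then show ?thesis by (simp add: mult.assoc)
  qed
qed

text \<open>The supremum of |D| need not be attained, hence the level 3/4. If D is large negative
  there, passing to -D(-x) leads back to the positive case: this keeps the one-sided Lipschitz bound
  and leaves the even kernel unchanged.\<close>

lemma unsmooth:
  fixes D V :: "real \<Rightarrow> real"
  assumes D [measurable]: "D \<in> borel_measurable borel"
    and decr: "\<And>x s. s \<ge> 0 \<Longrightarrow> D (x + s) \<ge> D x - L * s"
    and V: "integrable lborel V" "\<And>u. V u \<ge> 0" "\<And>u. V (- u) = V u"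
    and c: "(LINT u|lborel. V u) = c" "c > 0"
    and tail: "(LINT u|lborel. indicator {u. \<bar>u\<bar> > h} u * V u) \<le> c / 8"
    and h: "h \<ge> 0" and L: "L \<ge> 0"
    and bdd: "\<And>x. \<bar>D x\<bar> \<le> B"
    and \<eta>: "\<And>x. \<bar>LINT u|lborel. D (x - u) * V u\<bar> \<le> \<eta>"
  shows "\<bar>D x\<bar> \<le> 2 * \<eta> / c + 4 * L * h"
proof -
  define \<Delta> where "\<Delta> = (SUP x. \<bar>D x\<bar>)"
  have bdd': "bdd_above (range (\<lambda>x. \<bar>D x\<bar>))" using bdd by (auto intro!: bdd_aboveI)
  have \<Delta>: "\<bar>D x\<bar> \<le> \<Delta>" for x unfolding \<Delta>_def using bdd' by (rule cSUP_upper[OF UNIV_I])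
  have "\<Delta> \<le> 2 * \<eta> / c + 4 * L * h"
  proof (cases "\<Delta> > 0")
    case True
    then have "3 / 4 * \<Delta> < \<Delta>" by simp
    then obtain x0 where "3 / 4 * \<Delta> < \<bar>D x0\<bar>"
      using less_cSUP_iff[OF UNIV_not_empty bdd', of "3 / 4 * \<Delta>"] unfolding \<Delta>_def by blast
    then consider "D x0 \<ge> 3 / 4 * \<Delta>" | "- D x0 \<ge> 3 / 4 * \<Delta>" by linarith
    then show ?thesis
    proof cases
      case 1
      show ?thesis
        by (rule unsmooth_one_sided[OF D decr V(1,2) c tail h L \<Delta> 1 \<eta>])
    next
      case 2
      let ?D = "\<lambda>x. - D (- x)"
      have refl: "(LINT u|lborel. ?D (x - u) * V u) = - (LINT u|lborel. D (- x - u) * V u)" for x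
        by (subst lborel_integral_real_affine[where c = "-1" and t = 0]) (simp_all add: V)
      show ?thesis
      proof (rule unsmooth_one_sided[where D = ?D and p = "- x0"])
        show "?D (x + s) \<ge> ?D x - L * s" if "s \<ge> 0" for x s
          using decr[OF that, of "- x - s"] by simp
        show "\<bar>LINT u|lborel. ?D (- x0 + h - u) * V u\<bar> \<le> \<eta>"
          unfolding refl using \<eta>[of "- (- x0 + h)"] by simp
      qed (use V c tail h L \<Delta> 2 in auto)
    qed
  next
    case False
    have "\<eta> \<ge> 0" using \<eta>[of 0] by linarith
    then show ?thesis using False c h L by (smt (verit) divide_nonneg_pos mult_nonneg_nonneg)
  qed
  then show ?thesis using \<Delta>[of x] by linarith
qed

text \<open>The density is at most 1 / sqrt (2 pi) <= 1. Together with the monotonicity of the other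
  cdf, this gives the one-sided Lipschitz bound with L = 1.\<close>

lemma cdf_std_normal_lipschitz:
  assumes "s \<ge> 0"
  shows "cdf std_normal_distribution (x + s) - cdf std_normal_distribution x \<le> s"
proof (cases "s = 0")
  case False
  interpret N: real_distribution std_normal_distribution by (rule real_dist_normal_dist)
  have "cdf std_normal_distribution (x + s) - cdf std_normal_distribution x = measure std_normal_distribution {x<..x + s}"
    using assms False by (intro N.cdf_diff_eq) auto
  also have "\<dots> = (LINT y|std_normal_distribution. indicator {x<..x + s} y)" by simp
  also have "\<dots> = (LINT y|lborel. std_normal_density y * indicator {x<..x + s} y)"
    by (subst integral_density) auto
  also have "\<dots> \<le> (LINT y|lborel. indicator {x<..x + s} y)"
  proof (rule integral_mono)
    show int: "integrable lborel (indicator {x<..x + s} :: real \<Rightarrow> real)"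
      using assms by (intro integrable_real_indicator) auto
    have le: "std_normal_density y \<le> 1" for y
    proof -
      have "sqrt (2 * pi) \<ge> 1" using pi_ge_two by simp
      then have "1 / sqrt (2 * pi) * exp (- y\<^sup>2 / 2) \<le> 1 * 1"
        by (intro mult_mono) auto
      then show ?thesis by (simp add: std_normal_density_def)
    qed
    show "integrable lborel (\<lambda>y. std_normal_density y * indicator {x<..x + s} y)"
      using int by (rule Bochner_Integration.integrable_bound) (use le in \<open>auto split: split_indicator\<close>)
    show "std_normal_density y * indicator {x<..x + s} y \<le> indicator {x<..x + s} y" for y
      using le[of y] by (auto split: split_indicator)
  qed
  also have "\<dots> = s" using assms by simp
  finally show ?thesis .
qed simp

text \<open>\<open>C\<close> has to be independent of M, T and g. It is built from the total mass c
  of \<open>fejer 1\<close> and a cutoff h beyond which the kernel has mass at most c / 8; rescaling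
  the kernel by T turns h into h / T.\<close>

theorem esseen_smoothing:
  "\<exists>C>0. \<forall>M T g x. real_distribution M \<longrightarrow> integrable M (\<lambda>x. x) \<longrightarrow> T > 0 \<longrightarrow>
     integrable lborel g \<longrightarrow> (\<forall>t. g t \<ge> 0) \<longrightarrow>
     (\<forall>t. \<bar>t\<bar> \<le> T \<longrightarrow> norm (char M t - char std_normal_distribution t) \<le> \<bar>t\<bar> * g t) \<longrightarrow>
     \<bar>cdf M x - cdf std_normal_distribution x\<bar> \<le> C * ((LINT t|lborel. g t) + 1 / T)"
proof -
  let ?N = std_normal_distribution
  interpret N: real_distribution ?N by (rule real_dist_normal_dist)
  define c where "c = (LINT y|lborel. fejer 1 y)"
  have c: "c > 0" unfolding c_def by (rule integral_fejer_pos)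
  let ?tail = "\<lambda>h. LINT u|lborel. indicator {u. \<bar>u\<bar> > h} u * fejer 1 u"
  have "(\<lambda>n. ?tail (real n)) \<longlonglongrightarrow> (LINT u::real|lborel. 0)"
  proof (rule integral_dominated_convergence[OF _ _ integrable_fejer])
    show "AE u in lborel. (\<lambda>n. indicator {u. \<bar>u\<bar> > real n} u * fejer 1 u) \<longlonglongrightarrow> 0"
    proof (rule AE_I2)
      fix u :: real
      have "eventually (\<lambda>n. indicator {u. \<bar>u\<bar> > real n} u * fejer 1 u = 0) sequentially"
        using eventually_ge_at_top[of "nat \<lceil>\<bar>u\<bar>\<rceil>"]
      proof eventually_elim
        case (elim n)
        then have "\<bar>u\<bar> \<le> real n" by linarith
        then show ?case by simp
      qed
      then show "(\<lambda>n. indicator {u. \<bar>u\<bar> > real n} u * fejer 1 u) \<longlonglongrightarrow> 0"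
        by (rule tendsto_eventually)
    qed
    show "AE u in lborel. norm (indicator {u. \<bar>u\<bar> > real n} u * fejer 1 u) \<le> fejer 1 u" for n
      by (rule AE_I2) (auto simp: fejer_nonneg split: split_indicator)
  qed measurable
  then have "eventually (\<lambda>n. ?tail (real n) < c / 8) sequentially"
    using c by (intro order_tendstoD) auto
  then obtain n where "?tail (real n) < c / 8" by (auto dest: eventually_happens)
  then obtain h where h: "h \<ge> 0" "?tail h \<le> c / 8" using of_nat_0_le_iff[of n] less_imp_le by blast
  define C where "C = 2 / c + 4 * h"
  have C: "C > 0" "2 / c \<le> C" "4 * h \<le> C" using c h by (auto simp: C_def add_pos_nonneg)
  show ?thesis
  proof (intro exI[of _ C] conjI allI impI C(1))
    fix M and T :: real and g :: "real \<Rightarrow> real" and x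
    assume M: "real_distribution M" and intM: "integrable M (\<lambda>x. x)" and T: "T > 0"
      and g: "integrable lborel g" "\<forall>t. g t \<ge> 0"
      and le: "\<forall>t. \<bar>t\<bar> \<le> T \<longrightarrow> norm (char M t - char ?N t) \<le> \<bar>t\<bar> * g t"
    interpret M: real_distribution M by fact
    have "fejer T = (\<lambda>y. T * fejer 1 (0 + T * y))"
      using fejer_scale[OF T] by (simp add: fun_eq_iff)
    have intV: "integrable lborel (fejer T)"
      unfolding \<open>fejer T = _\<close> using T lborel_integrable_real_affine[OF integrable_fejer, of T 0] by simp
    have cT: "(LINT u|lborel. fejer T u) = c"
      unfolding \<open>fejer T = _\<close> c_def
      using T by (subst (2) lborel_integral_real_affine[where c = T and t = 0]) auto
    have tail: "(LINT u|lborel. indicator {u. \<bar>u\<bar> > h / T} u * fejer T u) = ?tail h"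
      using T unfolding \<open>fejer T = _\<close>
      by (subst (2) lborel_integral_real_affine[where c = T and t = 0])
         (auto simp: integral_mult_right_zero[symmetric] abs_mult field_simps indicator_def
           intro!: Bochner_Integration.integral_cong simp del: integral_mult_right_zero)
    have intN: "integrable ?N (\<lambda>x. x)"
      using integrable_std_normal_distribution_moment[of 1] by simp
    have "\<bar>cdf M x - cdf ?N x\<bar> \<le> 2 * (LINT t|lborel. g t) / c + 4 * 1 * (h / T)"
    proof (rule unsmooth[where V = "fejer T" and B = 1 and D = "\<lambda>x. cdf M x - cdf ?N x"
          and L = 1 and h = "h / T" and c = c])
      show "cdf M x - cdf ?N x - 1 * s \<le> cdf M (x + s) - cdf ?N (x + s)" if "s \<ge> 0" for x s
        using cdf_std_normal_lipschitz[OF that, of x] M.cdf_nondecreasing[of x "x + s"] that by simp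
      show "\<bar>cdf M x - cdf ?N x\<bar> \<le> 1" for x
        using M.cdf_nonneg[of x] M.cdf_bounded_prob[of x] N.cdf_nonneg[of x] N.cdf_bounded_prob[of x]
        by linarith
      show "\<bar>LINT u|lborel. (cdf M (x - u) - cdf ?N (x - u)) * fejer T u\<bar> \<le> (LINT t|lborel. g t)" for x
        using M.smoothed_cdf_diff_le[OF N.real_distribution_axioms intM intN T g(1)] g(2) le by blast
      show "(\<lambda>x. cdf M x - cdf ?N x) \<in> borel_measurable borel"
      proof -
        have "mono (cdf M)" "mono (cdf ?N)"
          using M.cdf_nondecreasing N.cdf_nondecreasing by (auto simp: mono_def)
        then show ?thesis using borel_measurable_mono by (intro borel_measurable_diff) auto
      qed
    qed (use T h c intV cT tail fejer_nonneg[OF T] fejer_minus in auto)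
    also have "\<dots> = (2 / c) * (LINT t|lborel. g t) + (4 * h) * (1 / T)" by simp
    also have "\<dots> \<le> C * (LINT t|lborel. g t) + C * (1 / T)"
      using C T g by (intro add_mono mult_right_mono) (auto intro!: Bochner_Integration.integral_nonneg)
    finally show "\<bar>cdf M x - cdf ?N x\<bar> \<le> C * ((LINT t|lborel. g t) + 1 / T)"
      by (simp add: distrib_left)
  qed
qed

subsection \<open>Coefficients of the square root\<close>

text \<open>The coefficients of sqrt (1 - x); \<open>sqrt_fps c\<close> is the series of sqrt (1 - c
  X). They decay like n^(-3/2), but enter below only through ratios.\<close>

definition sqrt_coeff :: "nat \<Rightarrow> real" where
  "sqrt_coeff n = (-1) ^ n * ((1 / 2) gchoose n)"

definition sqrt_fps :: "complex \<Rightarrow> complex fps" where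
  "sqrt_fps c = Abs_fps (\<lambda>n. of_real (sqrt_coeff n) * c ^ n)"

lemma sqrt_coeff_0 [simp]: "sqrt_coeff 0 = 1"
  by (simp add: sqrt_coeff_def)

lemma sqrt_coeff_Suc: "sqrt_coeff (Suc n) = sqrt_coeff n * ((real n - 1 / 2) / (real n + 1))"
proof -
  have "(1 / 2 gchoose Suc n) * (real n + 1) = (1 / 2 gchoose n) * (1 / 2 - real n)"
    using gbinomial_mult_1[of "1 / 2 :: real" n] by (simp add: algebra_simps)
  then have 1: "(1 / 2 gchoose Suc n) = (1 / 2 gchoose n) * (1 / 2 - real n) / (real n + 1)"
    by (simp add: field_simps)
  show ?thesis unfolding sqrt_coeff_def 1 by (simp add: field_simps)
qed

lemma sqrt_coeff_neg: "n \<ge> 1 \<Longrightarrow> sqrt_coeff n < 0"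
proof (induction n rule: nat_induct_at_least)
  case base
  then show ?case using sqrt_coeff_Suc[of 0] by simp
next
  case (Suc n)
  then show ?case unfolding sqrt_coeff_Suc by (intro mult_neg_pos) auto
qed

lemma sqrt_coeff_nonzero: "sqrt_coeff n \<noteq> 0"
  using sqrt_coeff_neg[of n] by (cases "n = 0") auto

lemma sqrt_fps_square: "sqrt_fps c * sqrt_fps c = 1 - fps_const c * fps_X"
proof -
  let ?g = "fps_const (- c) * fps_X :: complex fps"
  have half: "complex_of_real (1 / 2 gchoose n) = 1 / 2 gchoose n" for n
    by (simp add: gbinomial_prod_rev)
  have "sqrt_fps c = fps_binomial (1 / 2) oo ?g"
    unfolding fps_compose_linear
    by (rule fps_ext) (simp add: sqrt_fps_def sqrt_coeff_def half power_minus[of c])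
  then have "sqrt_fps c * sqrt_fps c = (fps_binomial (1 / 2) * fps_binomial (1 / 2)) oo ?g"
    by (simp add: fps_compose_mult_distrib)
  also have "\<dots> = (1 + fps_X) oo ?g"
    by (simp add: fps_binomial_add_mult[symmetric] fps_binomial_1)
  also have "\<dots> = 1 - fps_const c * fps_X"
    by (simp add: fps_compose_add_distrib)
  finally show ?thesis .
qed

lemma abs_sqrt_coeff_Suc:
  "n \<ge> 1 \<Longrightarrow> \<bar>sqrt_coeff (Suc n)\<bar> = \<bar>sqrt_coeff n\<bar> * ((real n - 1 / 2) / (real n + 1))"
  by (simp add: sqrt_coeff_Suc abs_mult)

text \<open>The weight n^2 outgrows the decay n^(-3/2); concretely (k + 1) (k - 1/2) >= k^2 for k >=
  1.\<close>

lemma sqrt_coeff_weighted_mono: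
  assumes "i \<ge> 1"
  shows "(real i)\<^sup>2 * \<bar>sqrt_coeff i\<bar> \<le> (real (i + j))\<^sup>2 * \<bar>sqrt_coeff (i + j)\<bar>"
proof (induction j)
  case (Suc j)
  define k where "k = i + j"
  have k: "real k \<ge> 1" using assms by (simp add: k_def)
  have "(real k)\<^sup>2 \<le> (real k + 1)\<^sup>2 * ((real k - 1 / 2) / (real k + 1))"
  proof -
    have "(real k + 1)\<^sup>2 * ((real k - 1 / 2) / (real k + 1)) = (real k + 1) * (real k - 1 / 2)"
      using k by (simp add: power2_eq_square)
    then show ?thesis using k by (simp only:) (simp add: power2_eq_square algebra_simps)
  qed
  then have "(real k)\<^sup>2 * \<bar>sqrt_coeff k\<bar> \<le> (real k + 1)\<^sup>2 * ((real k - 1 / 2) / (real k + 1)) * \<bar>sqrt_coeff k\<bar>"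
    by (rule mult_right_mono) simp
  also have "\<dots> = (real (Suc k))\<^sup>2 * \<bar>sqrt_coeff (Suc k)\<bar>"
    using k by (subst abs_sqrt_coeff_Suc) (auto simp: algebra_simps)
  finally show ?case using Suc by (simp add: k_def)
qed simp

text \<open>Going back by j costs a factor polynomial in j, which any geometric decay absorbs. The
  extra 2 pays for j = n, since the coefficient of index 0 is 1 and that of index 1 is -1/2.\<close>

lemma sqrt_coeff_diff_le:
  assumes "j \<le> n"
  shows "\<bar>sqrt_coeff (n - j)\<bar> \<le> (real j + 1)\<^sup>2 * (2 * \<bar>sqrt_coeff n\<bar>)"
proof -
  have pos: "\<bar>sqrt_coeff i\<bar> \<le> (real j + 1)\<^sup>2 * \<bar>sqrt_coeff (i + j)\<bar>" if "i \<ge> 1" for i j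
  proof -
    have "real (i + j) \<le> real i * (real j + 1)"
    proof -
      have "real j \<le> real i * real j" using that by (simp add: mult_le_cancel_right1)
      then show ?thesis by (simp add: algebra_simps)
    qed
    then have "(real (i + j))\<^sup>2 \<le> (real i * (real j + 1))\<^sup>2" by (intro power_mono) auto
    then have "(real (i + j))\<^sup>2 * \<bar>sqrt_coeff (i + j)\<bar> \<le> (real i * (real j + 1))\<^sup>2 * \<bar>sqrt_coeff (i + j)\<bar>"
      by (intro mult_right_mono) auto
    then have "(real i)\<^sup>2 * \<bar>sqrt_coeff i\<bar> \<le> (real i)\<^sup>2 * ((real j + 1)\<^sup>2 * \<bar>sqrt_coeff (i + j)\<bar>)"
      using sqrt_coeff_weighted_mono[OF that, of j] by (simp add: power_mult_distrib mult.assoc)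
    moreover have "(real i)\<^sup>2 > 0" using that by simp
    ultimately show ?thesis by (simp only: mult_le_cancel_left_pos)
  qed
  show ?thesis
  proof (cases "n - j \<ge> 1")
    case True
    have "\<bar>sqrt_coeff (n - j)\<bar> \<le> (real j + 1)\<^sup>2 * \<bar>sqrt_coeff n\<bar>"
      using pos[OF True, of j] assms by simp
    also have "\<dots> \<le> (real j + 1)\<^sup>2 * (2 * \<bar>sqrt_coeff n\<bar>)" by (intro mult_left_mono) auto
    finally show ?thesis .
  next
    case False
    then have nj: "n = j" using assms by simp
    show ?thesis
    proof (cases "j = 0")
      case False
      have "\<bar>sqrt_coeff 1\<bar> = 1 / 2" using sqrt_coeff_Suc[of 0] by simp
      then have "1 \<le> 2 * \<bar>sqrt_coeff 1\<bar>" by simp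
      also have "\<dots> \<le> 2 * ((real (j - 1) + 1)\<^sup>2 * \<bar>sqrt_coeff (1 + (j - 1))\<bar>)"
        using pos[of 1 "j - 1"] by simp
      also have "\<dots> \<le> (real j + 1)\<^sup>2 * (2 * \<bar>sqrt_coeff j\<bar>)"
        using False by (auto intro!: mult_right_mono power_mono simp: of_nat_diff)
      finally show ?thesis by (simp add: nj)
    qed (simp add: nj)
  qed
qed

section \<open>Convolutions with geometrically decaying coefficients\<close>

lemma summable_geometric_times_power:
  assumes "0 \<le> \<theta>" "\<theta> < (1 :: real)"
  shows "summable (\<lambda>j. \<theta> ^ j * (real j + 1) ^ p)"
proof -
  obtain c where c: "\<theta> < c" "c < 1" using assms dense by blast
  have "(\<lambda>j. (real j + 2) / (real j + 1)) \<longlonglongrightarrow> 1" by real_asymp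
  then have "(\<lambda>j. \<theta> * ((real j + 2) / (real j + 1)) ^ p) \<longlonglongrightarrow> \<theta> * 1 ^ p"
    by (intro tendsto_intros)
  then have "eventually (\<lambda>j. \<theta> * ((real j + 2) / (real j + 1)) ^ p < c) sequentially"
    using c by (intro order_tendstoD) auto
  then obtain N where N: "\<And>j. j \<ge> N \<Longrightarrow> \<theta> * ((real j + 2) / (real j + 1)) ^ p < c"
    by (auto simp: eventually_sequentially)
  show ?thesis
  proof (rule summable_ratio_test[OF c(2)])
    fix j assume j: "j \<ge> N"
    have "\<theta> ^ Suc j * (real (Suc j) + 1) ^ p =
        \<theta> * ((real j + 2) / (real j + 1)) ^ p * (\<theta> ^ j * (real j + 1) ^ p)"
      by (simp add: power_divide add_ac)
    also have "\<dots> \<le> c * (\<theta> ^ j * (real j + 1) ^ p)"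
      using N[OF j] assms by (intro mult_right_mono) auto
    finally show "norm (\<theta> ^ Suc j * (real (Suc j) + 1) ^ p) \<le> c * norm (\<theta> ^ j * (real j + 1) ^ p)"
      using assms by simp
  qed
qed

definition geom_sum :: "real \<Rightarrow> nat \<Rightarrow> real" where
  "geom_sum \<theta> p = (\<Sum>j. \<theta> ^ j * (real j + 1) ^ p)"

lemma geom_sum_ge:
  assumes "0 \<le> \<theta>" "\<theta> < 1"
  shows "\<theta> ^ n * (real n + 1) ^ p \<le> geom_sum \<theta> p"
  unfolding geom_sum_def
  using sum_le_suminf[OF summable_geometric_times_power[OF assms, of p], of "{n}"] assms by simp

text \<open>Multiplying by a series that is analytic in a larger disc preserves the order \<beta> of
  the coefficients: the factors (\<rho> / R)^j outweigh the polynomial loss of the index shift. The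
  constant depends neither on n nor on z.\<close>

lemma convolution_le:
  fixes k b :: "nat \<Rightarrow> complex"
  assumes k: "\<And>j. norm (k j) \<le> B / R ^ j" and b: "\<And>j. j \<le> n \<Longrightarrow> norm (b (n - j)) \<le> (real j + 1) ^ p * \<beta>"
    and z: "norm z \<le> \<rho>" "\<rho> < R" and "\<beta> \<ge> 0"
  shows "norm (\<Sum>j=0..n. k j * z ^ j * b (n - j)) \<le> B * geom_sum (\<rho> / R) p * \<beta>"
proof -
  have \<rho>: "\<rho> \<ge> 0" using z(1) norm_ge_zero order_trans by blast
  have R: "R > 0" using \<rho> z(2) by simp
  have B: "B \<ge> 0" using order_trans[OF norm_ge_zero k[of 0]] by simp
  have \<theta>: "0 \<le> \<rho> / R" "\<rho> / R < 1" using \<rho> R z(2) by auto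
  have "norm (\<Sum>j=0..n. k j * z ^ j * b (n - j)) \<le> (\<Sum>j=0..n. norm (k j * z ^ j * b (n - j)))"
    by (rule norm_sum)
  also have "\<dots> \<le> (\<Sum>j=0..n. B * ((\<rho> / R) ^ j * (real j + 1) ^ p) * \<beta>)"
  proof (rule sum_mono)
    fix j assume j: "j \<in> {0..n}"
    have "norm (k j * z ^ j * b (n - j)) \<le> (B / R ^ j * \<rho> ^ j) * ((real j + 1) ^ p * \<beta>)"
      unfolding norm_mult norm_power using k[of j] b[of j] z j \<rho> R B
      by (intro mult_mono power_mono) auto
    then show "norm (k j * z ^ j * b (n - j)) \<le> B * ((\<rho> / R) ^ j * (real j + 1) ^ p) * \<beta>"
      by (simp add: power_divide algebra_simps)
  qed
  also have "\<dots> = B * (\<Sum>j=0..n. (\<rho> / R) ^ j * (real j + 1) ^ p) * \<beta>"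
    by (simp add: sum_distrib_left sum_distrib_right)
  also have "\<dots> \<le> B * geom_sum (\<rho> / R) p * \<beta>"
    unfolding geom_sum_def using \<theta> B assms(5)
    by (intro mult_right_mono mult_left_mono sum_le_suminf summable_geometric_times_power) auto
  finally show ?thesis .
qed

lemma Cauchy_coeff_le:
  assumes "f has_fps_expansion F" "f holomorphic_on ball 0 R'" "0 < R" "R < R'"
    and "\<And>z. norm z < R' \<Longrightarrow> norm (f z) \<le> B"
  shows "norm (fps_nth F n) \<le> B / R ^ n"
proof -
  have "norm ((deriv ^^ n) f 0) \<le> fact n * B / R ^ n"
  proof (rule Cauchy_inequality[OF _ _ assms(3)])
    show "f holomorphic_on ball 0 R" "continuous_on (cball 0 R) f"
      using assms(4) by (auto intro!: holomorphic_on_imp_continuous_on holomorphic_on_subset[OF assms(2)])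
  qed (use assms(4,5) in auto)
  then show ?thesis
    unfolding fps_nth_fps_expansion[OF assms(1)] by (simp add: norm_divide field_simps)
qed

subsection \<open>Number of plane trees\<close>

text \<open>For v = 1 the functional equation is T (1 - T) = X, so 1 - 2 T is a square root of 1 - 4
  X; the constant coefficient decides the sign.\<close>

lemma tree_gf_eq_sqrt: "1 - 2 * tree_gf (\<lambda>_. 1) = sqrt_fps 4"
proof -
  let ?T = "tree_gf (\<lambda>_. 1) :: complex fps"
  have W: "path_cut_gf 0 (1 :: complex) = ?T"
    by (simp add: path_cut_gf_def)
  have eq: "?T * (1 - ?T) = fps_X"
    using path_cut_gf_eq[of 0 "1 :: complex"] unfolding W by simp
  have "(1 - 2 * ?T) * (1 - 2 * ?T) = 1 - 4 * (?T * (1 - ?T))"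
    by (simp add: algebra_simps)
  also have "\<dots> = sqrt_fps 4 * sqrt_fps 4"
    unfolding eq sqrt_fps_square by (simp add: fps_numeral_fps_const)
  finally have "1 - 2 * ?T = sqrt_fps 4 \<or> 1 - 2 * ?T = - sqrt_fps 4"
    by (simp add: square_eq_iff)
  moreover have "fps_nth (1 - 2 * ?T) 0 \<noteq> fps_nth (- sqrt_fps 4) 0"
    by (simp add: sqrt_fps_def)
  ultimately show ?thesis by metis
qed

text \<open>The Catalan numbers, expressed by the very quantity in which all coefficient bounds are
  stated, so that normalizing by the number of trees is exact.\<close>

lemma card_plane_trees:
  assumes "n \<ge> 1"
  shows "real (card (plane_trees n)) = - (4 ^ n * sqrt_coeff n) / 2"
proof -
  have "fps_nth (1 - 2 * tree_gf (\<lambda>_. 1)) n = fps_nth (sqrt_fps 4) n"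
    by (simp only: tree_gf_eq_sqrt)
  then have "complex_of_real (- 2 * real (card (plane_trees n))) = complex_of_real (sqrt_coeff n * 4 ^ n)"
    using assms by (simp add: sqrt_fps_def tree_gf_def)
  then have "- 2 * real (card (plane_trees n)) = sqrt_coeff n * 4 ^ n" by (simp only: of_real_eq_iff)
  then show ?thesis using mult.commute[of "sqrt_coeff n" "4 ^ n"] by linarith
qed

subsection \<open>Uniform coefficient bounds near the singularity\<close>

lemma csqrt_near_one:
  assumes "norm (w - 1) < 1"
  shows "w \<notin> \<real>\<^sub>\<le>\<^sub>0" "norm (csqrt w) \<le> 2"
proof -
  have "\<bar>Re (w - 1)\<bar> < 1" using abs_Re_le_cmod[of "w - 1"] assms by linarith
  then show "w \<notin> \<real>\<^sub>\<le>\<^sub>0" by (auto simp: complex_nonpos_Reals_iff)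
  have "norm w \<le> 2" using norm_triangle_ineq[of "w - 1" 1] assms by simp
  then have "sqrt (norm w) \<le> sqrt 4" by (intro real_sqrt_le_mono) simp
  then show "norm (csqrt w) \<le> 2" by simp
qed

text \<open>The divided difference q of g at z0 is bounded by sup |g'| <= 1/2, so the cofactor h =
  z0 (4 - q) differs from 1 by at most 4/16 + 5/16 * 1/2 < 1. Hence its principal square root is
  holomorphic and bounded, uniformly over all admissible g and z0.\<close>

lemma sqrt_factorization:
  fixes F :: "complex fps" and g \<Delta> :: "complex \<Rightarrow> complex"
  assumes g: "g holomorphic_on ball 0 R'" "\<And>z. norm z < R' \<Longrightarrow> norm (deriv g z) \<le> 1 / 2"
    and z0: "norm (z0 - 1 / 4) \<le> 1 / 16" "norm z0 < R'" "1 - 4 * z0 + g z0 = 0" and g0: "g 0 = 0"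
  obtains k where "k holomorphic_on ball 0 R'" "\<And>z. norm z < R' \<Longrightarrow> norm (k z) \<le> 2" "k 0 = 1"
    "\<And>z. norm z < R' \<Longrightarrow> 1 - 4 * z + g z = (1 - z / z0) * (k z)\<^sup>2"
proof -
  define q where "q = (\<lambda>z. if z = z0 then deriv g z0 else (g z - g z0) / (z - z0))"
  define h where "h = (\<lambda>z. z0 * (4 - q z))"
  have z0_nz: "z0 \<noteq> 0" using z0(1) by (auto simp: norm_divide)
  have holq: "q holomorphic_on ball 0 R'"
    unfolding q_def using g(1) by (intro pole_lemma_open) auto
  have q: "norm (q z) \<le> 1 / 2" if z: "norm z < R'" for z
  proof (cases "z = z0")
    case False
    have "norm (g z - g z0) \<le> 1 / 2 * norm (z - z0)"
    proof (rule field_differentiable_bound[where S = "ball 0 R'" and f' = "deriv g"])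
      show "(g has_field_derivative deriv g w) (at w within ball 0 R')" if "w \<in> ball 0 R'" for w
        using holomorphic_derivI[OF g(1) open_ball that] by (rule has_field_derivative_at_within)
    qed (use g(2) z z0(2) in auto)
    then show ?thesis using False by (simp add: q_def norm_divide field_simps)
  qed (use g(2) z0(2) in \<open>simp add: q_def\<close>)
  have h: "norm (h z - 1) < 1" if "norm z < R'" for z
  proof -
    have "norm z0 \<le> 5 / 16"
      using norm_triangle_ineq[of "z0 - 1 / 4" "1 / 4"] z0(1) by (simp add: norm_divide)
    then have "norm (z0 * q z) \<le> 5 / 16 * (1 / 2)"
      unfolding norm_mult using q[OF that] by (intro mult_mono) auto
    moreover have "norm (4 * (z0 - 1 / 4)) \<le> 4 * (1 / 16)"
      unfolding norm_mult using z0(1) by simp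
    ultimately have "norm (4 * (z0 - 1 / 4) - z0 * q z) < 1"
      using norm_triangle_ineq4[of "4 * (z0 - 1 / 4)" "z0 * q z"] by linarith
    moreover have "h z - 1 = 4 * (z0 - 1 / 4) - z0 * q z" by (simp add: h_def algebra_simps)
    ultimately show ?thesis by (simp only:)
  qed
  have fac: "1 - 4 * z + g z = (1 - z / z0) * h z" for z
  proof (cases "z = z0")
    case True
    then show ?thesis using z0(3) z0_nz by simp
  next
    case False
    have "(1 - z / z0) * h z = (z0 - z) * (4 - q z)" using z0_nz by (simp add: h_def field_simps)
    also have "\<dots> = 4 * (z0 - z) + (g z - g z0)" using False by (simp add: q_def field_simps)
    also have "\<dots> = 1 - 4 * z + g z" using z0(3) by (simp add: algebra_simps)
    finally show ?thesis by simp
  qed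
  show ?thesis
  proof (rule that[of "\<lambda>z. csqrt (h z)"])
    show "(\<lambda>z. csqrt (h z)) holomorphic_on ball 0 R'"
      unfolding h_def using holq csqrt_near_one(1)[OF h] by (intro holomorphic_intros) (auto simp: h_def)
    show "norm (csqrt (h z)) \<le> 2" if "norm z < R'" for z
      using csqrt_near_one(2)[OF h[OF that]] .
    show "csqrt (h 0) = 1" using fac[of 0] g0 by simp
    show "1 - 4 * z + g z = (1 - z / z0) * (csqrt (h z))\<^sup>2" for z
      using fac[of z] by simp
  qed
qed

text \<open>Scaling by z0^n moves the singularity to 1: the singular factor then contributes plain
  \<open>sqrt_coeff\<close>, and the bound does not depend on the position of z0.\<close>

lemma fps_nth_sqrt_mult_le:
  assumes k: "k has_fps_expansion K" "k holomorphic_on ball 0 R'" "\<And>z. norm z < R' \<Longrightarrow> norm (k z) \<le> B"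
    and R: "0 < R" "R < R'" and z0: "z0 \<noteq> 0" "norm z0 \<le> \<rho>" "\<rho> < R"
  shows "norm (fps_nth (sqrt_fps (1 / z0) * K) n * z0 ^ n) \<le> B * geom_sum (\<rho> / R) 2 * (2 * \<bar>sqrt_coeff n\<bar>)"
proof -
  have "fps_nth (sqrt_fps (1 / z0) * K) n * z0 ^ n = (\<Sum>j=0..n. fps_nth K j * z0 ^ j * of_real (sqrt_coeff (n - j)))"
  proof -
    have "fps_nth (sqrt_fps (1 / z0) * K) n * z0 ^ n =
        (\<Sum>j=0..n. fps_nth K j * (of_real (sqrt_coeff (n - j)) * (1 / z0) ^ (n - j)) * z0 ^ n)"
      by (subst mult.commute) (simp add: fps_mult_nth sum_distrib_right sqrt_fps_def)
    also have "\<dots> = (\<Sum>j=0..n. fps_nth K j * z0 ^ j * of_real (sqrt_coeff (n - j)))"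
    proof (rule sum.cong)
      fix j assume "j \<in> {0..n}"
      then have "z0 ^ n = z0 ^ (n - j) * z0 ^ j" by (simp flip: power_add)
      then show "fps_nth K j * (of_real (sqrt_coeff (n - j)) * (1 / z0) ^ (n - j)) * z0 ^ n =
          fps_nth K j * z0 ^ j * of_real (sqrt_coeff (n - j))"
        using z0(1) by (simp add: field_simps)
    qed simp
    finally show ?thesis .
  qed
  also have "norm \<dots> \<le> B * geom_sum (\<rho> / R) 2 * (2 * \<bar>sqrt_coeff n\<bar>)"
    using Cauchy_coeff_le[OF k(1,2) R k(3)] sqrt_coeff_diff_le z0 by (intro convolution_le) auto
  finally show ?thesis .
qed

text \<open>A series without singularity in the disc obeys the same bound: its scaled coefficients
  are geometrically small, whereas \<open>sqrt_coeff n\<close> is at least of order n^(-2), by the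
  comparison with index 0.\<close>

lemma analytic_coeff_le:
  assumes k: "k has_fps_expansion K" "k holomorphic_on ball 0 R'" "\<And>z. norm z < R' \<Longrightarrow> norm (k z) \<le> B"
    and R: "0 < R" "R < R'" and z0: "norm z0 \<le> \<rho>" "\<rho> < R"
  shows "norm (fps_nth K n * z0 ^ n) \<le> B * geom_sum (\<rho> / R) 2 * (2 * \<bar>sqrt_coeff n\<bar>)"
proof -
  have \<rho>: "\<rho> \<ge> 0" using order_trans[OF norm_ge_zero z0(1)] .
  have B: "B \<ge> 0" using k(3)[of 0] R order_trans[OF norm_ge_zero] by force
  have \<theta>: "0 \<le> \<rho> / R" "\<rho> / R < 1" using \<rho> z0(2) R by auto
  have "norm (fps_nth K n) \<le> B / R ^ n" by (rule Cauchy_coeff_le[OF k(1,2) R]) (rule k(3))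
  moreover have "norm z0 ^ n \<le> \<rho> ^ n" using z0(1) by (rule power_mono) simp
  ultimately have "norm (fps_nth K n * z0 ^ n) \<le> B / R ^ n * \<rho> ^ n"
    unfolding norm_mult norm_power by (rule mult_mono) (use B R(1) in auto)
  also have "\<dots> = B * (\<rho> / R) ^ n * 1" by (simp add: power_divide)
  also have "1 \<le> (real n + 1)\<^sup>2 * (2 * \<bar>sqrt_coeff n\<bar>)"
    using sqrt_coeff_diff_le[of n n] by simp
  then have "B * (\<rho> / R) ^ n * 1 \<le> B * (\<rho> / R) ^ n * ((real n + 1)\<^sup>2 * (2 * \<bar>sqrt_coeff n\<bar>))"
    using B \<theta> by (intro mult_left_mono) auto
  also have "\<dots> = B * ((\<rho> / R) ^ n * (real n + 1)\<^sup>2) * (2 * \<bar>sqrt_coeff n\<bar>)" by simp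
  also have "\<dots> \<le> B * geom_sum (\<rho> / R) 2 * (2 * \<bar>sqrt_coeff n\<bar>)"
    using geom_sum_ge[OF \<theta>, of n 2] B by (intro mult_right_mono mult_left_mono) auto
  finally show ?thesis .
qed

text \<open>For v near 1 the discriminant of the quadratic equation for W is 1 - 4 z plus a
  perturbation g with the factor v - 1. The number 2 B + 4 + 2 B^2 bounds |2 A' - 4 + 2 (v - 1) A
  A'|, so the hypothesis on v says that |g'| <= 1/2, as the factorization demands.\<close>

lemma path_cut_gf_coeff_le:
  fixes r :: nat
  defines "F \<equiv> cut_away_gf r :: complex fps"
  assumes R: "0 < R" "R < R'" "ereal R' \<le> fps_conv_radius F" "\<rho> < R"
    and B: "\<And>z. norm z < R' \<Longrightarrow> norm (eval_fps F z) \<le> B"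
      "\<And>z. norm z < R' \<Longrightarrow> norm (eval_fps (fps_deriv F) z) \<le> B"
    and v: "norm (v - 1) * (2 * B + 4 + 2 * B\<^sup>2) \<le> 1 / 2" "norm (v - 1) \<le> 1"
    and z0: "norm (z0 - 1 / 4) \<le> 1 / 16" "norm z0 \<le> \<rho>" "(1 - (1 - v) * eval_fps F z0)\<^sup>2 = 4 * v * z0"
    and n: "n \<ge> 1"
  shows "norm (fps_nth (path_cut_gf r v) n * z0 ^ n) \<le> (B + 2) * geom_sum (\<rho> / R) 2 * (2 * \<bar>sqrt_coeff n\<bar>)"
proof -
  define A where "A = eval_fps F"
  define \<epsilon> where "\<epsilon> = v - 1"
  define g where "g = (\<lambda>z. \<epsilon> * (2 * A z - 4 * z + \<epsilon> * (A z)\<^sup>2))"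
  have rad: "ereal (norm z) < fps_conv_radius F" if "norm z < R'" for z
    using less_le_trans[OF _ R(3), of "ereal (norm z)"] that by simp
  have F_pos: "fps_conv_radius F > 0" using rad[of 0] R by (simp add: zero_ereal_def)
  have B0: "B \<ge> 0" using order_trans[OF norm_ge_zero B(1)[of 0]] R by simp
  have dA: "(A has_field_derivative eval_fps (fps_deriv F) z) (at z)" if "norm z < R'" for z
    unfolding A_def using rad[OF that] by (rule has_field_derivative_eval_fps)
  have dg: "(g has_field_derivative \<epsilon> * (2 * eval_fps (fps_deriv F) z - 4 + \<epsilon> * (2 * A z * eval_fps (fps_deriv F) z))) (at z)"
    if "norm z < R'" for z
    unfolding g_def by (rule refl dA[OF that] derivative_eq_intros)+ simp
  have holA: "A holomorphic_on ball 0 R'"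
    using dA by (auto simp: holomorphic_on_open intro!: exI)
  have holg: "g holomorphic_on ball 0 R'"
    using dg by (auto simp: holomorphic_on_open intro!: exI)
  have A0: "A 0 = 0" by (simp add: A_def F_def eval_fps_at_0)
  have bound_dg: "norm (deriv g z) \<le> 1 / 2" if z: "norm z < R'" for z
  proof -
    have "norm (2 * eval_fps (fps_deriv F) z - 4 + \<epsilon> * (2 * A z * eval_fps (fps_deriv F) z)) \<le> 2 * B + 4 + 2 * B\<^sup>2"
    proof -
      have "norm (2 * eval_fps (fps_deriv F) z - 4) \<le> 2 * B + 4"
        using norm_triangle_ineq4[of "2 * eval_fps (fps_deriv F) z" 4] B(2)[OF z] by (simp add: norm_mult)
      moreover have "norm (\<epsilon> * (2 * A z * eval_fps (fps_deriv F) z)) \<le> 1 * (2 * B * B)"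
        unfolding norm_mult using v(2) B(1,2)[OF z] B0 by (intro mult_mono) (auto simp: A_def \<epsilon>_def)
      moreover have "1 * (2 * B * B) = 2 * B\<^sup>2" by (simp add: power2_eq_square)
      ultimately show ?thesis
        using norm_triangle_ineq[of "2 * eval_fps (fps_deriv F) z - 4" "\<epsilon> * (2 * A z * eval_fps (fps_deriv F) z)"]
        by linarith
    qed
    then have "norm (deriv g z) \<le> norm \<epsilon> * (2 * B + 4 + 2 * B\<^sup>2)"
      unfolding DERIV_imp_deriv[OF dg[OF z]] norm_mult[of \<epsilon>] by (intro mult_left_mono) auto
    then show ?thesis using v(1) by (simp add: \<epsilon>_def)
  qed
  have \<Delta>: "1 - 4 * z + g z = (1 + \<epsilon> * A z)\<^sup>2 - 4 * v * z" for z
    by (simp add: g_def \<epsilon>_def power2_eq_square algebra_simps)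
  have "norm z0 < R'" using z0(2) R by simp
  moreover have "1 - 4 * z0 + g z0 = 0"
    unfolding \<Delta> using z0(3) by (simp add: \<epsilon>_def A_def algebra_simps)
  moreover have "g 0 = 0" by (simp add: g_def A0)
  ultimately obtain k where k: "k holomorphic_on ball 0 R'" "\<And>z. norm z < R' \<Longrightarrow> norm (k z) \<le> 2" "k 0 = 1"
    "\<And>z. norm z < R' \<Longrightarrow> 1 - 4 * z + g z = (1 - z / z0) * (k z)\<^sup>2"
    using sqrt_factorization[OF holg bound_dg z0(1)] by blast
  define K where "K = fps_expansion k 0"
  have k_exp: "k has_fps_expansion K"
    unfolding K_def using k(1) R by (intro has_fps_expansion_fps_expansion[of "ball 0 R'"]) auto
  have A_exp: "A has_fps_expansion F"
    unfolding A_def using F_pos by (rule eval_fps_has_fps_expansion)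
  define D where "D = (1 + fps_const \<epsilon> * F)\<^sup>2 - fps_const (4 * v) * fps_X"
  define W where "W = path_cut_gf r v"
  \<comment> \<open>By the quadratic formula W = (1 + (1 - v) A - P) / 2, with P^2 equal to the
    discriminant D.\<close>
  define P where "P = 1 + fps_const (1 - v) * F - 2 * W"
  have z0_nz: "z0 \<noteq> 0" using z0(1) by (auto simp: norm_divide)
  have e1: "(\<lambda>z. (1 + \<epsilon> * A z)\<^sup>2 - 4 * v * z) has_fps_expansion D"
    unfolding D_def power2_eq_square by (intro fps_expansion_intros A_exp)
  have e2: "(\<lambda>z. (1 - 1 / z0 * z) * (k z * k z)) has_fps_expansion (1 - fps_const (1 / z0) * fps_X) * (K * K)"
    by (intro fps_expansion_intros k_exp)
  have e3: "eventually (\<lambda>z. (1 - 1 / z0 * z) * (k z * k z) = (1 + \<epsilon> * A z)\<^sup>2 - 4 * v * z) (nhds 0)"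
  proof -
    have "eventually (\<lambda>z. z \<in> ball 0 R') (nhds (0 :: complex))"
      using R by (intro eventually_nhds_in_open) auto
    then show ?thesis
    proof eventually_elim
      case (elim z)
      then show ?case using k(4)[of z] \<Delta>[of z] by (simp add: power2_eq_square)
    qed
  qed
  have D_eq: "D = (1 - fps_const (1 / z0) * fps_X) * (K * K)"
    by (rule fps_expansion_unique_complex[OF e1 iffD1[OF has_fps_expansion_cong[OF e3 refl] e2]])
  have P_sq: "P * P = D"
  proof -
    define c where "c = fps_const (1 - v) * F"
    have c: "1 + fps_const \<epsilon> * F = 1 - c"
    proof -
      have "fps_const \<epsilon> = - fps_const (1 - v)" by (simp add: \<epsilon>_def)
      then show ?thesis unfolding c_def by (simp only: mult_minus_left add_uminus_conv_diff)
    qed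
    have WW: "(W - c) * (1 - W) = fps_const v * fps_X"
      using path_cut_gf_eq[of r v] by (simp add: W_def c_def F_def)
    have "P * P = (1 - c) * (1 - c) - 4 * ((W - c) * (1 - W))"
      unfolding P_def c_def[symmetric] by (simp add: algebra_simps)
    also have "\<dots> = D"
    proof -
      have "fps_const (4 * v) = 4 * fps_const v" by (simp add: fps_numeral_fps_const)
      then show ?thesis unfolding WW D_def c by (simp only: power2_eq_square mult.assoc)
    qed
    finally show ?thesis .
  qed
  have "P * P = (sqrt_fps (1 / z0) * K) * (sqrt_fps (1 / z0) * K)"
    unfolding P_sq D_eq sqrt_fps_square[symmetric] by (simp only: ac_simps)
  then have "P = sqrt_fps (1 / z0) * K \<or> P = - (sqrt_fps (1 / z0) * K)"
    by (simp only: square_eq_iff)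
  moreover have "fps_nth P 0 \<noteq> fps_nth (- (sqrt_fps (1 / z0) * K)) 0"
  proof -
    have "fps_nth K 0 = 1" using fps_nth_fps_expansion[OF k_exp, of 0] k(3) by simp
    moreover have "fps_nth P 0 = 1" by (simp add: P_def W_def F_def)
    ultimately show ?thesis by (simp add: sqrt_fps_def)
  qed
  ultimately have P_eq: "P = sqrt_fps (1 / z0) * K" by metis
  have W_nth: "fps_nth W n * z0 ^ n = (1 - v) / 2 * (fps_nth F n * z0 ^ n) - fps_nth P n * z0 ^ n / 2"
  proof -
    have "fps_nth P n = (1 - v) * fps_nth F n - 2 * fps_nth W n"
      using n by (simp add: P_def fps_numeral_fps_const)
    then have W_n: "fps_nth W n = ((1 - v) * fps_nth F n - fps_nth P n) / 2" by simp
    show ?thesis unfolding W_n by (simp add: field_simps)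
  qed
  define G where "G = geom_sum (\<rho> / R) 2 * (2 * \<bar>sqrt_coeff n\<bar>)"
  have P_le: "norm (fps_nth P n * z0 ^ n) \<le> 2 * G"
    using fps_nth_sqrt_mult_le[OF k_exp k(1,2) R(1,2) z0_nz z0(2) R(4), of n]
    unfolding P_eq by (simp add: G_def)
  have F_le: "norm (fps_nth F n * z0 ^ n) \<le> B * G"
    using analytic_coeff_le[OF A_exp holA _ R(1,2) z0(2) R(4), of B n] B(1) by (simp add: A_def G_def mult.assoc)
  have "norm (fps_nth W n * z0 ^ n) \<le> norm ((1 - v) / 2) * norm (fps_nth F n * z0 ^ n) + norm (fps_nth P n * z0 ^ n) / 2"
    unfolding W_nth by (rule order_trans[OF norm_triangle_ineq4]) (simp add: norm_mult norm_divide)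
  also have "\<dots> \<le> 1 * (B * G) + 2 * G / 2"
    using v(2) F_le P_le order_trans[OF norm_ge_zero F_le]
    by (intro add_mono mult_mono) (auto simp: norm_divide norm_minus_commute)
  also have "\<dots> \<le> (B + 2) * G"
    using order_trans[OF norm_ge_zero P_le] by (simp add: algebra_simps)
  finally show ?thesis by (simp add: W_def G_def mult.assoc)
qed

subsection \<open>The movable singularity\<close>

text \<open>With \<epsilon> = v - 1 the equation is A^2 \<epsilon>^2 + (2 A - 4 z) \<epsilon> + (1 -
  4 z) = 0, and Q^2 is its discriminant. Writing the root with Q in the denominator selects a
  solution that vanishes at z = 1/4 and still makes sense for A = 0, where the equation becomes
  linear.\<close>

lemma singularity_equation:
  fixes A z Q D v :: complex
  assumes Q: "Q\<^sup>2 = 16 * z * (z - A + A\<^sup>2)" and D: "D = (4 * z - 2 * A) + Q" "D \<noteq> 0"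
    and v: "v = 1 + 2 * (1 - 4 * z) / D"
  shows "(1 - (1 - v) * A)\<^sup>2 = 4 * v * z"
proof -
  define \<epsilon> where "\<epsilon> = 2 * (1 - 4 * z) / D"
  have \<epsilon>: "\<epsilon> * D = 2 * (1 - 4 * z)" using D(2) by (simp add: \<epsilon>_def)
  have "D\<^sup>2 - 2 * (4 * z - 2 * A) * D = Q\<^sup>2 - (4 * z - 2 * A)\<^sup>2"
    unfolding D(1) by (simp add: power2_eq_square algebra_simps)
  also have "\<dots> = - (4 * A\<^sup>2 * (1 - 4 * z))"
    unfolding Q by (simp add: power2_eq_square algebra_simps)
  finally have D2: "D\<^sup>2 - 2 * (4 * z - 2 * A) * D = - (4 * A\<^sup>2 * (1 - 4 * z))" .
  have "D\<^sup>2 * ((1 + \<epsilon> * A)\<^sup>2 - 4 * (1 + \<epsilon>) * z) =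
      A\<^sup>2 * (\<epsilon> * D)\<^sup>2 - (4 * z - 2 * A) * (\<epsilon> * D) * D + (1 - 4 * z) * D\<^sup>2"
    by (simp add: power2_eq_square algebra_simps)
  also have "\<dots> = (1 - 4 * z) * (4 * A\<^sup>2 * (1 - 4 * z) + (D\<^sup>2 - 2 * (4 * z - 2 * A) * D))"
    unfolding \<epsilon> by (simp add: power2_eq_square algebra_simps)
  also have "\<dots> = 0" unfolding D2 by simp
  finally have "(1 + \<epsilon> * A)\<^sup>2 - 4 * (1 + \<epsilon>) * z = 0" using D(2) by simp
  moreover have "1 - (1 - v) * A = 1 + \<epsilon> * A" "v = 1 + \<epsilon>" by (auto simp: v \<epsilon>_def)
  ultimately show ?thesis by simp
qed

text \<open>The function f expresses v through z, with f(1/4) = 1 and f'(1/4) = -8 / D(1/4) = -4 m,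
  so it has a local inverse; \<zeta> is this inverse composed with exp. The set N lets the caller
  prescribe how close to 1/4 the zero must stay.\<close>

lemma movable_singularity_exists:
  fixes F :: "complex fps" and m :: real
  assumes m: "m > 0" and rad: "fps_conv_radius F > ereal (1 / 4)"
    and F0: "eval_fps F (1 / 4) = of_real ((m - 1) / (2 * m))"
    and N: "open N" "1 / 4 \<in> N"
  obtains \<delta> \<zeta> where "\<delta> > 0" "\<zeta> holomorphic_on ball 0 \<delta>" "\<zeta> 0 = 1 / 4"
    "\<And>s. norm s < \<delta> \<Longrightarrow> \<zeta> s \<in> N"
    "\<And>s. norm s < \<delta> \<Longrightarrow> (1 - (1 - exp s) * eval_fps F (\<zeta> s))\<^sup>2 = 4 * exp s * \<zeta> s"
proof -
  define A where "A = eval_fps F"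
  define E where "E = eball (0 :: complex) (fps_conv_radius F)"
  define \<phi> where "\<phi> = (\<lambda>z. 16 * z * (z - A z + (A z)\<^sup>2))"
  define D where "D = (\<lambda>z. (4 * z - 2 * A z) + csqrt (\<phi> z))"
  define f where "f = (\<lambda>z. 1 + (1 - 4 * z) * (2 / D z))"
  have E: "open E" "1 / 4 \<in> E" using rad by (auto simp: E_def)
  have holA: "A holomorphic_on E" unfolding A_def E_def by (intro holomorphic_intros) auto
  have A0: "A (1 / 4) = of_real ((m - 1) / (2 * m))" by (simp add: A_def F0)
  have \<phi>0: "\<phi> (1 / 4) = of_real ((1 / m)\<^sup>2)"
  proof -
    have "\<phi> (1 / 4) = of_real (4 * (1 / 4 - (m - 1) / (2 * m) + ((m - 1) / (2 * m))\<^sup>2))"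
      by (simp add: \<phi>_def A0)
    also have "4 * (1 / 4 - (m - 1) / (2 * m) + ((m - 1) / (2 * m))\<^sup>2) = (1 / m)\<^sup>2"
      using m by (simp add: field_simps power2_eq_square)
    finally show ?thesis .
  qed
  have csqrt0: "csqrt (\<phi> (1 / 4)) = of_real (1 / m)"
    unfolding \<phi>0 using m by (simp add: of_real_sqrt[symmetric] real_sqrt_divide)
  have D0: "D (1 / 4) = of_real (2 / m)"
  proof -
    have "D (1 / 4) = of_real (1 - 2 * ((m - 1) / (2 * m)) + 1 / m)"
      unfolding D_def csqrt0 by (simp add: A0)
    also have "1 - 2 * ((m - 1) / (2 * m)) + 1 / m = 2 / m" using m by (simp add: field_simps)
    finally show ?thesis .
  qed
  have hol\<phi>: "\<phi> holomorphic_on E" unfolding \<phi>_def by (intro holomorphic_intros holA)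
  \<comment> \<open>A neighbourhood on which \<open>csqrt\<close> of \<phi> is holomorphic; it
    contains 1/4 because \<phi> has the value 1 / m^2 there.\<close>
  define E' where "E' = E \<inter> \<phi> -` {z. Re z > 0}"
  have E': "open E'" "1 / 4 \<in> E'"
  proof -
    show "open E'"
      unfolding E'_def using hol\<phi> E(1)
      by (intro continuous_open_preimage holomorphic_on_imp_continuous_on open_halfspace_Re_gt)
    show "1 / 4 \<in> E'" using E(2) m by (simp add: E'_def \<phi>0)
  qed
  have E'_sub: "E' \<subseteq> E" by (auto simp: E'_def)
  have holD: "D holomorphic_on E'"
    unfolding D_def
  proof (intro holomorphic_intros holomorphic_on_subset[OF holA E'_sub] holomorphic_on_subset[OF hol\<phi> E'_sub])
    show "\<phi> z \<notin> \<real>\<^sub>\<le>\<^sub>0" if "z \<in> E'" for z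
      using that by (auto simp: E'_def complex_nonpos_Reals_iff)
  qed
  define U where "U = (E' \<inter> D -` (- {0})) \<inter> N"
  have U: "open U" "1 / 4 \<in> U"
  proof -
    have "open (E' \<inter> D -` (- {0}))"
      using holD E'(1) by (intro continuous_open_preimage holomorphic_on_imp_continuous_on) auto
    then show "open U" unfolding U_def using N(1) by (rule open_Int)
    show "1 / 4 \<in> U" using E'(2) N(2) m by (simp add: U_def D0)
  qed
  have holDU: "D holomorphic_on U" using holD by (rule holomorphic_on_subset) (auto simp: U_def)
  have D_nz: "D z \<noteq> 0" if "z \<in> U" for z using that by (simp add: U_def)
  have holf: "f holomorphic_on U"
    unfolding f_def by (intro holomorphic_intros holDU D_nz)
  \<comment> \<open>The factor 1 - 4 z vanishes at 1/4, so only its own derivative contributes and D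
    is merely evaluated.\<close>
  have "deriv f (1 / 4) \<noteq> 0"
  proof -
    define H where "H = (\<lambda>z. 2 / D z)"
    have dH: "(H has_field_derivative deriv H (1 / 4)) (at (1 / 4))"
      unfolding H_def by (rule holomorphic_derivI[OF _ U]) (intro holomorphic_intros holDU D_nz)
    have "f = (\<lambda>z. 1 + (1 - 4 * z) * H z)" by (simp add: f_def H_def)
    then have "(f has_field_derivative - 4 * H (1 / 4)) (at (1 / 4))"
      using dH by (auto intro!: derivative_eq_intros)
    then have "(f has_field_derivative - 4 * (2 / D (1 / 4))) (at (1 / 4))" by (simp add: H_def)
    then have "deriv f (1 / 4) = - 4 * (2 / D (1 / 4))" by (rule DERIV_imp_deriv)
    then show ?thesis using D_nz[OF U(2)] by simp
  qed
  then obtain \<rho> where \<rho>: "\<rho> > 0" "ball (1 / 4) \<rho> \<subseteq> U" "open (f ` ball (1 / 4) \<rho>)" "inj_on f (ball (1 / 4) \<rho>)"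
    using has_complex_derivative_locally_invertible[OF holf U(2) U(1)] by blast
  obtain g where g: "g holomorphic_on f ` ball (1 / 4) \<rho>" "\<And>z. z \<in> ball (1 / 4) \<rho> \<Longrightarrow> g (f z) = z"
    using holomorphic_has_inverse[OF holomorphic_on_subset[OF holf \<rho>(2)] open_ball \<rho>(4)] by metis
  have f0: "f (1 / 4) = 1" by (simp add: f_def)
  have "1 \<in> f ` ball (1 / 4) \<rho>" using \<rho>(1) f0 by (intro image_eqI[of _ _ "1 / 4"]) auto
  then have "0 \<in> exp -` (f ` ball (1 / 4) \<rho>)" by simp
  moreover have "open (exp -` (f ` ball (1 / 4) \<rho>) :: complex set)"
    using \<rho>(3) by (intro open_vimage continuous_intros)
  ultimately obtain \<delta> where "\<delta> > 0" "ball 0 \<delta> \<subseteq> exp -` (f ` ball (1 / 4) \<rho>)"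
    by (meson open_contains_ball)
  then have \<delta>: "\<delta> > 0" "\<And>s. norm s < \<delta> \<Longrightarrow> exp s \<in> f ` ball (1 / 4) \<rho>" by auto
  show ?thesis
  proof (rule that[of \<delta> "\<lambda>s. g (exp s)"])
    show "(\<lambda>s. g (exp s)) holomorphic_on ball 0 \<delta>"
      using \<delta>(2) by (intro holomorphic_on_compose_gen[OF _ g(1), unfolded o_def] holomorphic_intros) auto
    show "g (exp 0) = 1 / 4" using g(2)[of "1 / 4"] \<rho>(1) f0 by simp
    fix s :: complex assume s: "norm s < \<delta>"
    obtain z where z: "z \<in> ball (1 / 4) \<rho>" "exp s = f z" using \<delta>(2)[OF s] by auto
    have gz: "g (exp s) = z" using g(2) z by simp
    have zU: "z \<in> U" using z(1) \<rho>(2) by blast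
    then show "g (exp s) \<in> N" by (simp add: gz U_def)
    show "(1 - (1 - exp s) * eval_fps F (g (exp s)))\<^sup>2 = 4 * exp s * g (exp s)"
      unfolding gz using D_nz[OF zU]
      by (intro singularity_equation[where Q = "csqrt (\<phi> z)" and D = "D z"])
         (auto simp: A_def \<phi>_def D_def z(2) f_def)
  qed (rule \<delta>(1))
qed

text \<open>Implicit differentiation of w^2 = 4 exp s \<zeta>(s) with w = 1 + (exp s - 1)
  A(\<zeta>(s)). Since exp s - 1 vanishes at 0, the second derivative there involves A and A' but
  not A''.\<close>

lemma movable_singularity_derivs:
  fixes F :: "complex fps"
  assumes \<delta>: "\<delta> > 0" and hol: "\<zeta> holomorphic_on ball 0 \<delta>" and z0: "\<zeta> 0 = 1 / 4"
    and rad: "\<And>s. norm s < \<delta> \<Longrightarrow> ereal (norm (\<zeta> s)) < fps_conv_radius F"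
    and eq: "\<And>s. norm s < \<delta> \<Longrightarrow> (1 - (1 - exp s) * eval_fps F (\<zeta> s))\<^sup>2 = 4 * exp s * \<zeta> s"
  defines "\<alpha> \<equiv> eval_fps F (1 / 4)" and "\<beta> \<equiv> eval_fps (fps_deriv F) (1 / 4)"
  shows "deriv \<zeta> 0 = (2 * \<alpha> - 1) / 4"
    and "2 * \<alpha>\<^sup>2 + 2 * (\<alpha> + 2 * \<beta> * deriv \<zeta> 0) = 1 + 8 * deriv \<zeta> 0 + 4 * deriv (deriv \<zeta>) 0"
proof -
  define A A1 A2 where "A = (\<lambda>s. eval_fps F (\<zeta> s))" and "A1 = (\<lambda>s. eval_fps (fps_deriv F) (\<zeta> s))"
    and "A2 = (\<lambda>s. eval_fps (fps_deriv (fps_deriv F)) (\<zeta> s))"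
  have A00: "A 0 = \<alpha>" "A1 0 = \<beta>" by (simp_all add: A_def A1_def \<alpha>_def \<beta>_def z0)
  define \<zeta>1 where "\<zeta>1 = deriv \<zeta>"
  have d\<zeta>: "(\<zeta> has_field_derivative \<zeta>1 s) (at s)" if "norm s < \<delta>" for s
    unfolding \<zeta>1_def using holomorphic_derivI[OF hol open_ball] that by simp
  have hol1: "\<zeta>1 holomorphic_on ball 0 \<delta>"
    unfolding \<zeta>1_def using hol by (intro holomorphic_deriv) auto
  have d\<zeta>1: "(\<zeta>1 has_field_derivative deriv \<zeta>1 s) (at s)" if "norm s < \<delta>" for s
    using holomorphic_derivI[OF hol1 open_ball] that by simp
  have dA: "(A has_field_derivative A1 s * \<zeta>1 s) (at s)" if "norm s < \<delta>" for s
    unfolding A_def A1_def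
    by (rule DERIV_chain2[OF has_field_derivative_eval_fps[OF rad[OF that]] d\<zeta>[OF that]])
  have dA1: "(A1 has_field_derivative A2 s * \<zeta>1 s) (at s)" if "norm s < \<delta>" for s
  proof -
    have "ereal (norm (\<zeta> s)) < fps_conv_radius (fps_deriv F)"
      using rad[OF that] fps_conv_radius_deriv[of F] by (rule less_le_trans)
    from DERIV_chain2[OF has_field_derivative_eval_fps[OF this] d\<zeta>[OF that]]
    show ?thesis unfolding A1_def A2_def .
  qed
  define w w1 where "w = (\<lambda>s. 1 + (exp s - 1) * A s)"
    and "w1 = (\<lambda>s. exp s * A s + (exp s - 1) * (A1 s * \<zeta>1 s))"
  have dw: "(w has_field_derivative w1 s) (at s)" if "norm s < \<delta>" for s
    unfolding w_def w1_def using dA[OF that] by (auto intro!: derivative_eq_intros)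
  have dw1: "(w1 has_field_derivative \<alpha> + 2 * (\<beta> * \<zeta>1 0)) (at 0)"
    unfolding w1_def using dA[of 0] dA1[of 0] d\<zeta>1[of 0] \<delta>
    by (auto intro!: derivative_eq_intros simp: A00)
  have eq0: "w s * w s = 4 * exp s * \<zeta> s" if "norm s < \<delta>" for s
    using eq[OF that] by (simp add: w_def A_def power2_eq_square algebra_simps)
  have eq1: "2 * w s * w1 s = 4 * exp s * (\<zeta> s + \<zeta>1 s)" if s: "norm s < \<delta>" for s
  proof (rule DERIV_unique)
    show "((\<lambda>s. w s * w s) has_field_derivative 2 * w s * w1 s) (at s)"
      using dw[OF s] by (auto intro!: derivative_eq_intros)
    have "((\<lambda>s. 4 * exp s * \<zeta> s) has_field_derivative 4 * exp s * (\<zeta> s + \<zeta>1 s)) (at s)"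
      using d\<zeta>[OF s] by (auto intro!: derivative_eq_intros simp: algebra_simps)
    then show "((\<lambda>s. w s * w s) has_field_derivative 4 * exp s * (\<zeta> s + \<zeta>1 s)) (at s)"
      by (rule has_field_derivative_transform_within_open[where S = "ball 0 \<delta>"]) (use s eq0 in auto)
  qed
  have w0: "w 0 = 1" "w1 0 = \<alpha>" by (simp_all add: w_def w1_def A00)
  have \<zeta>1: "\<zeta>1 0 = (2 * \<alpha> - 1) / 4"
  proof -
    have "2 * \<alpha> = 4 * (1 / 4 + \<zeta>1 0)" using eq1[of 0] \<delta> w0 z0 by simp
    then show ?thesis by simp
  qed
  show "deriv \<zeta> 0 = (2 * \<alpha> - 1) / 4" using \<zeta>1 by (simp only: \<zeta>1_def)
  have "2 * \<alpha> * \<alpha> + 2 * (\<alpha> + 2 * (\<beta> * \<zeta>1 0)) = 4 * (1 / 4 + 2 * \<zeta>1 0 + deriv \<zeta>1 0)"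
  proof (rule DERIV_unique)
    show "((\<lambda>s. 2 * w s * w1 s) has_field_derivative 2 * \<alpha> * \<alpha> + 2 * (\<alpha> + 2 * (\<beta> * \<zeta>1 0))) (at 0)"
      using dw[of 0] dw1 w0 \<delta> by (auto intro!: derivative_eq_intros)
    have "((\<lambda>s. 4 * exp s * (\<zeta> s + \<zeta>1 s)) has_field_derivative 4 * (1 / 4 + 2 * \<zeta>1 0 + deriv \<zeta>1 0)) (at 0)"
      using d\<zeta>[of 0] d\<zeta>1[of 0] \<delta> z0 by (auto intro!: derivative_eq_intros simp: algebra_simps)
    then show "((\<lambda>s. 2 * w s * w1 s) has_field_derivative 4 * (1 / 4 + 2 * \<zeta>1 0 + deriv \<zeta>1 0)) (at 0)"
      by (rule has_field_derivative_transform_within_open[where S = "ball 0 \<delta>"]) (use eq1 \<delta> in auto)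
  qed
  then show "2 * \<alpha>\<^sup>2 + 2 * (\<alpha> + 2 * \<beta> * deriv \<zeta> 0) = 1 + 8 * deriv \<zeta> 0 + 4 * deriv (deriv \<zeta>) 0"
    by (simp add: \<zeta>1_def power2_eq_square algebra_simps)
qed

lemma continuous_on_cball_bounded:
  fixes f :: "complex \<Rightarrow> complex"
  assumes "continuous_on (cball 0 R) f"
  obtains B where "\<And>z. norm z \<le> R \<Longrightarrow> norm (f z) \<le> B"
proof -
  have "bounded (f ` cball 0 R)"
    using assms by (intro compact_imp_bounded compact_continuous_image) auto
  then obtain B where "\<forall>x\<in>f ` cball 0 R. norm x \<le> B" unfolding bounded_iff by blast
  then show ?thesis by (intro that[of B]) (simp add: dist_norm)
qed

section \<open>The quasi-power estimate for the moment generating function\<close>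

definition size_mgf :: "nat \<Rightarrow> nat \<Rightarrow> complex \<Rightarrow> complex" where
  "size_mgf r n s = (\<Sum>t\<in>plane_trees n. exp (s * of_nat (path_cut_size r t))) / of_nat (card (plane_trees n))"

text \<open>The coefficients grow like \<zeta>(s)^(-n) and the number of trees like 4^n, both with
  the same factor \<open>sqrt_coeff n\<close>, hence \<Lambda> = - Ln (4 \<zeta>). As m^2 - 1 = 2 *
  2^(r+1) (2^r - 1), the second derivative is the claimed variance constant.\<close>

theorem size_mgf_quasi_power:
  fixes r :: nat
  defines "m \<equiv> 2 ^ (r + 1) - 1 :: real"
  obtains \<delta> C \<Lambda> where "\<delta> > 0" "\<Lambda> holomorphic_on ball 0 \<delta>" "\<Lambda> 0 = 0"
    "deriv \<Lambda> 0 = of_real (1 / m)" "deriv (deriv \<Lambda>) 0 = of_real ((m\<^sup>2 - 1) / (6 * m\<^sup>2))"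
    "\<And>n s. n \<ge> 1 \<Longrightarrow> norm s < \<delta> \<Longrightarrow> norm (size_mgf r n s * exp (- of_nat n * \<Lambda> s)) \<le> C"
proof -
  define F :: "complex fps" where "F = cut_away_gf r"
  have m1: "m \<ge> 1" using self_le_power[of "2 :: real" "r + 1"] by (simp add: m_def)
  have mc: "2 ^ (r + 1) - 1 = complex_of_real m" by (simp add: m_def)
  have rad: "fps_conv_radius F > ereal (1 / 4)"
    and F0: "eval_fps F (1 / 4) = of_real ((m - 1) / (2 * m))"
    and F1: "eval_fps (fps_deriv F) (1 / 4) = of_real (2 / 3 * (m\<^sup>2 - 1) / m)"
    using cut_away_gf_singular_data[of r] unfolding F_def mc by simp_all
  obtain R' where R': "1 / 4 < R'" "ereal R' < fps_conv_radius F"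
    using ereal_dense2[OF rad] by auto
  \<comment> \<open>Nested radii 1/4 < \<rho> < R < R': the zero stays within \<rho>, Cauchy's
    estimate is taken at R, and the functions are bounded on R'.\<close>
  define R where "R = (1 / 4 + R') / 2"
  define \<rho> where "\<rho> = (1 / 4 + R) / 2"
  have R: "0 < R" "R < R'" "1 / 4 < \<rho>" "\<rho> < R"
  proof -
    have "R = 1 / 8 + R' / 2" by (simp add: R_def add_divide_distrib)
    then have 1: "1 / 4 < R" "R < R'" using R'(1) by simp_all
    have 2: "\<rho> = 1 / 8 + R / 2" by (simp add: \<rho>_def add_divide_distrib)
    show "0 < R" "R < R'" using 1 by simp_all
    show "1 / 4 < \<rho>" "\<rho> < R" using 1(1) 2 by simp_all
  qed
  have rad': "ereal (norm z) < fps_conv_radius F" if "norm z \<le> R'" for z :: complex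
    using le_less_trans[OF _ R'(2), of "ereal (norm z)"] that by simp
  obtain B where B: "\<And>z. norm z \<le> R' \<Longrightarrow> norm (eval_fps F z) \<le> B"
    "\<And>z. norm z \<le> R' \<Longrightarrow> norm (eval_fps (fps_deriv F) z) \<le> B"
  proof -
    have "cball (0 :: complex) R' \<subseteq> eball 0 (fps_conv_radius F)" using rad' by (auto simp: dist_norm)
    then obtain B1 where B1: "\<And>z. norm z \<le> R' \<Longrightarrow> norm (eval_fps F z) \<le> B1"
      using continuous_on_cball_bounded[OF continuous_on_subset[OF continuous_on_eval_fps]] by blast
    have "cball (0 :: complex) R' \<subseteq> eball 0 (fps_conv_radius (fps_deriv F))"
      using less_le_trans[OF rad' fps_conv_radius_deriv] by (auto simp: dist_norm)
    then obtain B2 where B2: "\<And>z. norm z \<le> R' \<Longrightarrow> norm (eval_fps (fps_deriv F) z) \<le> B2"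
      using continuous_on_cball_bounded[OF continuous_on_subset[OF continuous_on_eval_fps]] by blast
    show ?thesis using B1 B2 by (intro that[of "max B1 B2"]) (auto simp: le_max_iff_disj)
  qed
  have B0: "B \<ge> 0" using order_trans[OF norm_ge_zero B(1)[of 0]] R'(1) by simp
  define N where "N = ball (1 / 4 :: complex) (1 / 16) \<inter> ball 0 \<rho>"
  have N: "open N" "1 / 4 \<in> N" using R by (auto simp: N_def)
  obtain \<delta>1 \<zeta> where \<zeta>: "\<delta>1 > 0" "\<zeta> holomorphic_on ball 0 \<delta>1" "\<zeta> 0 = 1 / 4"
    "\<And>s. norm s < \<delta>1 \<Longrightarrow> \<zeta> s \<in> N"
    "\<And>s. norm s < \<delta>1 \<Longrightarrow> (1 - (1 - exp s) * eval_fps F (\<zeta> s))\<^sup>2 = 4 * exp s * \<zeta> s"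
    using movable_singularity_exists[OF _ rad F0 N] m1 by auto
  \<comment> \<open>Chosen such that |exp s - 1| < 1 / M yields the smallness condition of the
    coefficient bound; M >= 8 also yields |exp s - 1| <= 1.\<close>
  define M where "M = 2 * (2 * B + 4 + 2 * B\<^sup>2)"
  have M: "M \<ge> 8" using B0 by (simp add: M_def)
  have "isCont exp (0 :: complex)" by (intro continuous_intros)
  then have "\<forall>e>0. \<exists>d>0. \<forall>s. norm (s - 0) < d \<longrightarrow> norm (exp s - exp (0 :: complex)) < e"
    unfolding continuous_at_eps_delta dist_norm .
  moreover have "1 / M > 0" using M by simp
  ultimately have "\<exists>d>0. \<forall>s. norm (s - 0) < d \<longrightarrow> norm (exp s - exp (0 :: complex)) < 1 / M" by blast
  then obtain \<delta>2 where \<delta>2: "\<delta>2 > 0" "\<And>s :: complex. norm s < \<delta>2 \<Longrightarrow> norm (exp s - 1) < 1 / M"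
    by auto
  define \<delta> where "\<delta> = min \<delta>1 \<delta>2"
  have \<delta>: "\<delta> > 0" "\<delta> \<le> \<delta>1" "\<delta> \<le> \<delta>2" using \<zeta>(1) \<delta>2(1) by (auto simp: \<delta>_def)
  have \<zeta>N: "norm (\<zeta> s - 1 / 4) < 1 / 16" "norm (\<zeta> s) < \<rho>" if "norm s < \<delta>" for s
    using \<zeta>(4)[of s] that \<delta>(2) by (auto simp: N_def dist_norm norm_minus_commute)
  have hol\<zeta>: "\<zeta> holomorphic_on ball 0 \<delta>"
    using \<zeta>(2) by (rule holomorphic_on_subset) (use \<delta>(2) in auto)
  have \<zeta>_nonpos: "4 * \<zeta> s \<notin> \<real>\<^sub>\<le>\<^sub>0" if s: "norm s < \<delta>" for s
  proof (rule csqrt_near_one(1))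
    have "4 * \<zeta> s - 1 = 4 * (\<zeta> s - 1 / 4)" by simp
    then have "norm (4 * \<zeta> s - 1) = 4 * norm (\<zeta> s - 1 / 4)" by (simp only: norm_mult norm_numeral)
    then show "norm (4 * \<zeta> s - 1) < 1" using \<zeta>N(1)[OF s] by linarith
  qed
  have \<zeta>_nz: "\<zeta> s \<noteq> 0" if "norm s < \<delta>" for s using \<zeta>_nonpos[OF that] by auto
  define \<Lambda> where "\<Lambda> = (\<lambda>s. - Ln (4 * \<zeta> s))"
  have hol\<Lambda>: "\<Lambda> holomorphic_on ball 0 \<delta>"
    unfolding \<Lambda>_def using \<zeta>_nonpos by (intro holomorphic_intros hol\<zeta>) auto
  have d\<zeta>: "(\<zeta> has_field_derivative deriv \<zeta> s) (at s)" if "norm s < \<delta>" for s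
    using holomorphic_derivI[OF hol\<zeta> open_ball] that by simp
  have d\<Lambda>: "deriv \<Lambda> s = - (deriv \<zeta> s / \<zeta> s)" if s: "norm s < \<delta>" for s
  proof (rule DERIV_imp_deriv)
    show "(\<Lambda> has_field_derivative - (deriv \<zeta> s / \<zeta> s)) (at s)"
      unfolding \<Lambda>_def using \<zeta>_nonpos[OF s] \<zeta>_nz[OF s]
      by (auto intro!: derivative_eq_intros d\<zeta>[OF s] simp: field_simps)
  qed
  have d\<zeta>1: "(deriv \<zeta> has_field_derivative deriv (deriv \<zeta>) 0) (at 0)"
    using holomorphic_derivI[OF holomorphic_deriv[OF hol\<zeta> open_ball] open_ball] \<delta>(1) by simp
  have d2\<Lambda>: "deriv (deriv \<Lambda>) 0 = - (4 * deriv (deriv \<zeta>) 0 - 16 * (deriv \<zeta> 0)\<^sup>2)"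
  proof (rule DERIV_imp_deriv)
    have "((\<lambda>s. - (deriv \<zeta> s / \<zeta> s)) has_field_derivative - (4 * deriv (deriv \<zeta>) 0 - 16 * (deriv \<zeta> 0)\<^sup>2)) (at 0)"
      using d\<zeta>[of 0] \<delta>(1) by (auto intro!: derivative_eq_intros d\<zeta>1 simp: power2_eq_square \<zeta>(3))
    then show "(deriv \<Lambda> has_field_derivative - (4 * deriv (deriv \<zeta>) 0 - 16 * (deriv \<zeta> 0)\<^sup>2)) (at 0)"
      by (rule has_field_derivative_transform_within_open[where S = "ball 0 \<delta>"]) (use \<delta>(1) d\<Lambda> in auto)
  qed
  have rad\<zeta>: "ereal (norm (\<zeta> s)) < fps_conv_radius F" if "norm s < \<delta>" for s
    using \<zeta>N(2)[OF that] R by (intro rad') simp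
  have eq: "(1 - (1 - exp s) * eval_fps F (\<zeta> s))\<^sup>2 = 4 * exp s * \<zeta> s" if "norm s < \<delta>" for s
    using \<zeta>(5)[of s] that \<delta>(2) by simp
  note derivs = movable_singularity_derivs[OF \<delta>(1) hol\<zeta> \<zeta>(3) rad\<zeta> eq]
  have \<zeta>1: "deriv \<zeta> 0 = of_real (- 1 / (4 * m))"
  proof -
    have "deriv \<zeta> 0 = of_real ((2 * ((m - 1) / (2 * m)) - 1) / 4)"
      using derivs(1) unfolding F0 by simp
    also have "(2 * ((m - 1) / (2 * m)) - 1) / 4 = - 1 / (4 * m)" using m1 by (simp add: field_simps)
    finally show ?thesis .
  qed
  have \<zeta>2: "4 * deriv (deriv \<zeta>) 0 = of_real (1 / m\<^sup>2 - (m\<^sup>2 - 1) / (6 * m\<^sup>2))"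
  proof -
    define a b c where "a = (m - 1) / (2 * m)" and "b = 2 / 3 * (m\<^sup>2 - 1) / m" and "c = - 1 / (4 * m)"
    have "4 * deriv (deriv \<zeta>) 0 = of_real (2 * a\<^sup>2 + 2 * (a + 2 * b * c) - 1 - 8 * c)"
      using derivs(2) unfolding F0 F1 \<zeta>1 a_def[symmetric] b_def[symmetric] c_def[symmetric]
      by (simp add: algebra_simps)
    also have "2 * a\<^sup>2 + 2 * (a + 2 * b * c) - 1 - 8 * c = 1 / m\<^sup>2 - (m\<^sup>2 - 1) / (6 * m\<^sup>2)"
      using m1 by (simp add: a_def b_def c_def field_simps power2_eq_square)
    finally show ?thesis .
  qed
  \<comment> \<open>The 4 is the 2 of the coefficient bound times the 2 in
    \<open>card = 4 ^ n * \<bar>sqrt_coeff n\<bar> / 2\<close>.\<close>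
  define C where "C = (B + 2) * geom_sum (\<rho> / R) 2 * 4"
  show ?thesis
  proof (rule that[of \<delta> \<Lambda> C])
    show "\<Lambda> 0 = 0" by (simp add: \<Lambda>_def \<zeta>(3))
    show "deriv \<Lambda> 0 = of_real (1 / m)"
      using d\<Lambda>[of 0] \<delta>(1) \<zeta>(3) \<zeta>1 by simp
    show "deriv (deriv \<Lambda>) 0 = of_real ((m\<^sup>2 - 1) / (6 * m\<^sup>2))"
    proof -
      have "deriv (deriv \<Lambda>) 0 = of_real (- (1 / m\<^sup>2 - (m\<^sup>2 - 1) / (6 * m\<^sup>2) - 16 * (- 1 / (4 * m))\<^sup>2))"
        unfolding d2\<Lambda> \<zeta>2 \<zeta>1 by simp
      also have "- (1 / m\<^sup>2 - (m\<^sup>2 - 1) / (6 * m\<^sup>2) - 16 * (- 1 / (4 * m))\<^sup>2) = (m\<^sup>2 - 1) / (6 * m\<^sup>2)"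
        using m1 by (simp add: field_simps power2_eq_square)
      finally show ?thesis .
    qed
    fix n :: nat and s :: complex assume n: "n \<ge> 1" and s: "norm s < \<delta>"
    have "norm (exp s - 1) < 1 / M" using \<delta>2(2) s \<delta>(3) by simp
    then have v: "norm (exp s - 1) * (2 * B + 4 + 2 * B\<^sup>2) \<le> 1 / 2" "norm (exp s - 1) \<le> 1"
    proof -
      have "norm (exp s - 1) * M < 1" using \<open>norm (exp s - 1) < 1 / M\<close> M by (simp add: pos_less_divide_eq)
      then show "norm (exp s - 1) * (2 * B + 4 + 2 * B\<^sup>2) \<le> 1 / 2" unfolding M_def by (simp add: algebra_simps)
      have "1 / M \<le> 1" using M by simp
      then show "norm (exp s - 1) \<le> 1" using \<open>norm (exp s - 1) < 1 / M\<close> by linarith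
    qed
    have z0: "norm (\<zeta> s - 1 / 4) \<le> 1 / 16" "norm (\<zeta> s) \<le> \<rho>"
      using \<zeta>N[OF s] by auto
    have W: "norm (fps_nth (path_cut_gf r (exp s)) n * \<zeta> s ^ n) \<le> (B + 2) * geom_sum (\<rho> / R) 2 * (2 * \<bar>sqrt_coeff n\<bar>)"
      by (rule path_cut_gf_coeff_le[where R = R and R' = R' and \<rho> = \<rho> and B = B])
         (use R R' B v z0 n eq[OF s] in \<open>auto simp: F_def less_imp_le\<close>)
    have nth: "fps_nth (path_cut_gf r (exp s)) n = (\<Sum>t\<in>plane_trees n. exp (s * of_nat (path_cut_size r t)))"
      by (simp add: path_cut_gf_def tree_gf_def mult.commute flip: exp_of_nat_mult)
    have "exp (- of_nat n * \<Lambda> s) = exp (of_nat n * Ln (4 * \<zeta> s))" by (simp add: \<Lambda>_def)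
    also have "\<dots> = (4 * \<zeta> s) ^ n" using \<zeta>_nz[OF s] by (simp add: exp_of_nat_mult)
    finally have "size_mgf r n s * exp (- of_nat n * \<Lambda> s) =
        fps_nth (path_cut_gf r (exp s)) n * \<zeta> s ^ n * (4 ^ n / of_nat (card (plane_trees n)))"
      unfolding size_mgf_def nth[symmetric] by (simp add: power_mult_distrib)
    then have "norm (size_mgf r n s * exp (- of_nat n * \<Lambda> s)) =
        norm (fps_nth (path_cut_gf r (exp s)) n * \<zeta> s ^ n) * (4 ^ n / real (card (plane_trees n)))"
      by (simp add: norm_mult norm_divide norm_power)
    also have "real (card (plane_trees n)) = 4 ^ n * \<bar>sqrt_coeff n\<bar> / 2"
      using card_plane_trees[OF n] sqrt_coeff_neg[OF n] by simp
    also have "norm (fps_nth (path_cut_gf r (exp s)) n * \<zeta> s ^ n) * (4 ^ n / (4 ^ n * \<bar>sqrt_coeff n\<bar> / 2)) \<le>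
        (B + 2) * geom_sum (\<rho> / R) 2 * (2 * \<bar>sqrt_coeff n\<bar>) * (4 ^ n / (4 ^ n * \<bar>sqrt_coeff n\<bar> / 2))"
      using W by (rule mult_right_mono) simp
    also have "\<dots> = C"
      using sqrt_coeff_nonzero[of n] by (simp add: C_def)
    finally show "norm (size_mgf r n s * exp (- of_nat n * \<Lambda> s)) \<le> C" .
  qed (use \<delta> hol\<Lambda> in auto)
qed

subsection \<open>The mean\<close>

text \<open>The coefficients of (1 - 4 X)^(3/2). They are smaller than those of the root by a factor
  of order n, the source of the error 1 / n of the mean.\<close>

lemma sqrt_fps_4_cube_nth:
  "fps_nth ((1 - 4 * fps_X) * sqrt_fps 4) n = 4 ^ n * of_real (- 3 * sqrt_coeff n / (2 * real n - 3))"
proof (cases n)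
  case 0
  then show ?thesis by (simp add: sqrt_fps_def algebra_simps)
next
  case (Suc k)
  have "fps_nth ((1 - 4 * fps_X) * sqrt_fps 4) (Suc k) = 4 ^ Suc k * of_real (sqrt_coeff (Suc k) - sqrt_coeff k)"
    by (simp add: sqrt_fps_def left_diff_distrib mult.assoc fps_numeral_fps_const algebra_simps)
  also have "sqrt_coeff (Suc k) - sqrt_coeff k = - 3 * sqrt_coeff (Suc k) / (2 * real (Suc k) - 3)"
  proof -
    have nz: "2 * real k - 1 \<noteq> 0"
    proof
      assume "2 * real k - 1 = 0"
      then have "real (2 * k) = real 1" by simp
      then have "2 * k = 1" by (simp only: of_nat_eq_iff)
      then show False by presburger
    qed
    define d e where "d = real k - 1 / 2" and "e = real k + 1"
    have d: "d \<noteq> 0" "d - e = - 3 / 2" "2 * real (Suc k) - 3 = 2 * d" "e \<noteq> 0"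
      using nz by (auto simp: d_def e_def)
    have "sqrt_coeff k * (d / e) - sqrt_coeff k = sqrt_coeff k * (d - e) / e"
      using d(4) by (simp add: field_simps)
    also have "\<dots> = - 3 * (sqrt_coeff k * (d / e)) / (2 * d)"
      unfolding d(2) using d(1) by simp
    finally show ?thesis
      unfolding sqrt_coeff_Suc d_def[symmetric] e_def[symmetric] d(3) .
  qed
  finally show ?thesis by (simp only: Suc)
qed

text \<open>Differentiating S^2 = 1 - 4 X gives S S' = -2, so 1 / S is -S' / 2.\<close>

lemma inverse_sqrt_fps_4_nth:
  "fps_nth (inverse (sqrt_fps 4)) n = - (4 ^ n) * of_real ((2 * real n - 1) * sqrt_coeff n)"
proof -
  let ?S = "sqrt_fps 4"
  have S0: "fps_nth ?S 0 \<noteq> 0" by (simp add: sqrt_fps_def)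
  have "fps_deriv (?S * ?S) = fps_const (- 4)"
    unfolding sqrt_fps_square by simp
  then have "fps_const (1 / 2) * (fps_const 2 * (?S * fps_deriv ?S)) = fps_const (1 / 2) * fps_const (- 4)"
    by (simp add: mult.commute fps_numeral_fps_const[symmetric])
  then have "?S * fps_deriv ?S = fps_const (- 2)"
    by (simp only: mult.assoc[symmetric] fps_const_mult) simp
  then have "inverse ?S * (?S * fps_deriv ?S) = inverse ?S * fps_const (- 2)" by simp
  then have "inverse ?S * ?S * fps_deriv ?S = fps_const (- 2) * inverse ?S"
    by (simp only: mult.assoc mult.commute[of "inverse ?S" "fps_const (- 2)"])
  then have "fps_deriv ?S = fps_const (- 2) * inverse ?S"
    unfolding inverse_mult_eq_1[OF S0] by simp
  then have "fps_nth (fps_deriv ?S) n = - 2 * fps_nth (inverse ?S) n" by (simp only: fps_mult_left_const_nth)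
  moreover define x where "x = fps_nth (inverse ?S) n"
  ultimately have "x = - fps_nth (fps_deriv ?S) n / 2" by simp
  also have "fps_nth (fps_deriv ?S) n = of_nat (n + 1) * of_real (sqrt_coeff (Suc n)) * 4 ^ Suc n"
    by (simp add: sqrt_fps_def)
  finally have "x = - (of_nat (n + 1) * of_real (sqrt_coeff (Suc n)) * 4 ^ Suc n) / 2" .
  also have "\<dots> = - (4 ^ n) * of_real (2 * (real n + 1) * sqrt_coeff (Suc n))" by simp
  also have "2 * (real n + 1) * sqrt_coeff (Suc n) = (2 * real n - 1) * sqrt_coeff n"
    unfolding sqrt_coeff_Suc by (simp add: field_simps)
  finally show ?thesis by (simp only: x_def)
qed

text \<open>With T = (1 - S) / 2 and X = T (1 - T) the factor (1 - T)^2 - X becomes S (1 + S) / 2,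
  and 1 + S cancels. What remains is an analytic right-hand side divided by S.\<close>

lemma size_gf_eq_sqrt:
  fixes r :: nat
  defines "F \<equiv> cut_away_gf r :: complex fps" and "S \<equiv> sqrt_fps 4"
  shows "(2 * size_gf r + F) * S = 2 * fps_X - F"
proof -
  define M :: "complex fps" where "M = size_gf r"
  define T :: "complex fps" where "T = tree_gf (\<lambda>_. 1)"
  have S: "S = 1 - 2 * T" by (simp only: S_def T_def tree_gf_eq_sqrt)
  have S2: "S * S = 1 - 4 * fps_X"
    unfolding S_def sqrt_fps_square by (simp add: fps_numeral_fps_const)
  have "2 * M * S * (1 + S) = M * ((1 + S)\<^sup>2 - (1 - S * S))"
    by (simp add: power2_eq_square algebra_simps)
  also have "\<dots> = 4 * (M * ((1 - T)\<^sup>2 - fps_X))"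
    unfolding S2 unfolding S by (simp add: power2_eq_square algebra_simps)
  also have "\<dots> = 4 * ((T - F) * (1 - T)\<^sup>2)"
    unfolding M_def T_def F_def size_gf_eq ..
  also have "\<dots> = (T - F) * (1 + S) * (1 + S)"
    unfolding S by (simp add: power2_eq_square algebra_simps)
  finally have "2 * M * S * (1 + S) = (T - F) * (1 + S) * (1 + S)" .
  moreover have "1 + S \<noteq> 0"
  proof
    assume "1 + S = 0"
    then have "fps_nth (1 + S) 0 = 0" by simp
    then show False by (simp add: S_def sqrt_fps_def)
  qed
  ultimately have "2 * M * S = (T - F) * (1 + S)" by simp
  then have "2 * (2 * M * S) = 2 * ((T - F) * (1 + S))" by simp
  also have "\<dots> = (1 - S * S) - 2 * F - 2 * F * S"
    unfolding S by (simp add: algebra_simps)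
  also have "\<dots> = 2 * (2 * fps_X - F - F * S)" unfolding S2 by (simp add: algebra_simps)
  finally have "2 * M * S = 2 * fps_X - F - F * S" by (simp only: mult_cancel_left) simp
  then show ?thesis unfolding M_def by (simp add: algebra_simps)
qed

definition mean_size :: "nat \<Rightarrow> nat \<Rightarrow> real" where
  "mean_size r n = (\<Sum>t\<in>plane_trees n. real (path_cut_size r t)) / real (card (plane_trees n))"

text \<open>Compared with \<open>sqrt_coeff_diff_le\<close> the shift costs one more factor j + 1,
  because n <= 2 (j + 1) |2 i - 3| for i = n - j. The odd number 2 i - 3 is never 0, and 12 = 3 * 2
  * 2.\<close>

lemma cube_coeff_le:
  assumes n: "n \<ge> 1" and j: "j \<le> n"
  shows "\<bar>- 3 * sqrt_coeff (n - j) / (2 * real (n - j) - 3)\<bar> \<le> (real j + 1) ^ 3 * (12 * \<bar>sqrt_coeff n\<bar> / real n)"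
proof -
  define i where "i = n - j"
  have n_eq: "n = i + j" using j by (simp add: i_def)
  have "real n \<le> 2 * (real j + 1) * \<bar>2 * real i - 3\<bar>"
  proof -
    consider "i = 0" | "i = 1" | "i \<ge> 2" by linarith
    then show ?thesis
    proof cases
      case 3
      then have i: "real i \<ge> 2" by simp
      define w where "w = real j * (2 * real i - 3)"
      have "real j * 1 \<le> w" unfolding w_def using i by (intro mult_left_mono) auto
      then have "real i + real j \<le> 2 * (2 * real i - 3) + 2 * w"
        using i by simp
      also have "\<dots> = 2 * (real j + 1) * \<bar>2 * real i - 3\<bar>" using i by (simp add: w_def algebra_simps)
      finally show ?thesis by (simp add: n_eq)
    qed (auto simp: n_eq)
  qed
  moreover have "\<bar>2 * real i - 3\<bar> > 0"
  proof -
    have "2 * i \<noteq> 3" by presburger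
    then have "real (2 * i) \<noteq> real 3" using of_nat_eq_iff by blast
    then show ?thesis by simp
  qed
  moreover define x where "x = \<bar>2 * real i - 3\<bar>"
  ultimately have x: "real n \<le> 2 * (real j + 1) * x" "x > 0" by auto
  have "3 * real n \<le> 3 * (2 * (real j + 1) * x)" using x(1) by (rule mult_left_mono) simp
  then have "3 \<le> 6 * (real j + 1) * x / real n" using n by (simp add: pos_le_divide_eq mult_ac)
  then have "3 / x \<le> 6 * (real j + 1) / real n" using x(2) by (simp add: pos_divide_le_eq)
  then have "3 / x * \<bar>sqrt_coeff i\<bar> \<le> 6 * (real j + 1) / real n * ((real j + 1)\<^sup>2 * (2 * \<bar>sqrt_coeff n\<bar>))"
    using sqrt_coeff_diff_le[OF j] x(2) by (intro mult_mono) (auto simp: i_def)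
  also have "\<dots> = (real j + 1) ^ 3 * (12 * \<bar>sqrt_coeff n\<bar> / real n)"
    by (simp add: power2_eq_square power3_eq_cube)
  finally show ?thesis by (simp add: i_def x_def abs_mult)
qed

text \<open>Expanding 2 z - A(z) at 1/4 to second order and dividing by S leaves the powers -1/2,
  1/2 and 3/2 of 1 - 4 z. The coefficients of the two leading ones are explicit multiples of
  \<open>sqrt_coeff n\<close> and give a (2 n - 1) + b; the remaining one is smaller by a factor of
  order n even after multiplication by an analytic series.\<close>

theorem mean_size_asymptotics:
  fixes r :: nat
  defines "m \<equiv> 2 ^ (r + 1) - 1 :: real"
  obtains C where "\<And>n. n \<ge> 1 \<Longrightarrow> \<bar>mean_size r n - (real n / m - (m - 1) * (m - 2) / (6 * m))\<bar> \<le> C / real n"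
proof -
  define F :: "complex fps" where "F = cut_away_gf r"
  define A where "A = eval_fps F"
  define S where "S = sqrt_fps 4"
  define \<beta> where "\<beta> = 2 / 3 * (m\<^sup>2 - 1) / m"
  have m1: "m \<ge> 1" using self_le_power[of "2 :: real" "r + 1"] by (simp add: m_def)
  have mc: "2 ^ (r + 1) - 1 = complex_of_real m" by (simp add: m_def)
  have rad: "fps_conv_radius F > ereal (1 / 4)"
    and F0: "eval_fps F (1 / 4) = of_real ((m - 1) / (2 * m))"
    and F1: "eval_fps (fps_deriv F) (1 / 4) = of_real \<beta>"
    using cut_away_gf_singular_data[of r] unfolding F_def mc \<beta>_def by simp_all
  obtain R' where R': "1 / 4 < R'" "ereal R' < fps_conv_radius F"
    using ereal_dense2[OF rad] by auto
  obtain R where R: "1 / 4 < R" "R < R'" using R'(1) dense by blast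
  have \<theta>: "0 \<le> 1 / 4 / R" "1 / 4 / R < 1" using R(1) by auto
  have rad': "ereal (norm z) < fps_conv_radius F" if "norm z \<le> R'" for z :: complex
    using le_less_trans[OF _ R'(2), of "ereal (norm z)"] that by simp
  have sub: "cball (0 :: complex) R' \<subseteq> eball 0 (fps_conv_radius F)" using rad' by (auto simp: dist_norm)
  define E where "E = eball (0 :: complex) (fps_conv_radius F)"
  have E: "open E" "cball 0 R' \<subseteq> E" using sub by (auto simp: E_def)
  define q where "q = (\<lambda>z. 2 * z - A z)"
  \<comment> \<open>Iterated divided differences at 1/4 with the removable singularity filled in;
    \<open>k\<close> is the remainder of the second-order expansion and inherits the domain of
    A.\<close>
  define q1 where "q1 = (\<lambda>z. if z = 1 / 4 then deriv q (1 / 4) else (q z - q (1 / 4)) / (z - 1 / 4))"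
  define k where "k = (\<lambda>z. if z = 1 / 4 then deriv q1 (1 / 4) else (q1 z - q1 (1 / 4)) / (z - 1 / 4))"
  have holA: "A holomorphic_on E" unfolding A_def E_def by (intro holomorphic_intros) auto
  have holq: "q holomorphic_on E" unfolding q_def by (intro holomorphic_intros holA)
  have holq1: "q1 holomorphic_on E" unfolding q1_def by (intro pole_lemma_open holq E(1))
  have holk: "k holomorphic_on E" unfolding k_def by (intro pole_lemma_open holq1 E(1))
  have dq: "deriv q (1 / 4) = of_real (2 - \<beta>)"
  proof (rule DERIV_imp_deriv)
    have "(A has_field_derivative of_real \<beta>) (at (1 / 4))"
      unfolding A_def F1[symmetric] using rad by (intro has_field_derivative_eval_fps) simp
    then show "(q has_field_derivative of_real (2 - \<beta>)) (at (1 / 4))"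
      unfolding q_def by (auto intro!: derivative_eq_intros)
  qed
  define a b where "a = 1 / (2 * m)" and "b = (2 - \<beta>) / 4"
  have q0: "q (1 / 4) = of_real a"
  proof -
    have "q (1 / 4) = of_real (1 / 2 - (m - 1) / (2 * m))" by (simp add: q_def A_def F0)
    also have "1 / 2 - (m - 1) / (2 * m) = a" using m1 by (simp add: a_def field_simps)
    finally show ?thesis .
  qed
  have q_eq: "q z = of_real a - of_real b * (1 - 4 * z) + (1 - 4 * z)\<^sup>2 * (k z / 16)" for z
  proof (cases "z = 1 / 4")
    case True
    show ?thesis unfolding True by (simp add: q0)
  next
    case False
    then have "q1 z = q1 (1 / 4) + (z - 1 / 4) * k z" by (simp add: k_def)
    moreover have "q z = q (1 / 4) + (z - 1 / 4) * q1 z" using False by (simp add: q1_def)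
    moreover have "q1 (1 / 4) = of_real (4 * b)" by (simp add: q1_def dq b_def)
    ultimately have "q z = of_real a + (z - 1 / 4) * (4 * of_real b + (z - 1 / 4) * k z)" by (simp add: q0)
    also have "\<dots> = of_real a - of_real b * (1 - 4 * z) + (1 - 4 * z)\<^sup>2 * (k z / 16)"
      by (simp add: power2_eq_square algebra_simps)
    finally show ?thesis .
  qed
  obtain B1 where B1: "\<And>z. norm z \<le> R' \<Longrightarrow> norm (A z) \<le> B1"
    using continuous_on_cball_bounded[OF holomorphic_on_imp_continuous_on[OF holomorphic_on_subset[OF holA E(2)]]] by blast
  obtain B2 where B2: "\<And>z. norm z \<le> R' \<Longrightarrow> norm (k z) \<le> B2"
    using continuous_on_cball_bounded[OF holomorphic_on_imp_continuous_on[OF holomorphic_on_subset[OF holk E(2)]]] by blast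
  define K where "K = fps_expansion k 0"
  have "0 \<in> E" using E(2) R'(1) by auto
  then have k_exp: "k has_fps_expansion K"
    unfolding K_def using holk E(1) by (intro has_fps_expansion_fps_expansion[of E]) auto
  have A_exp: "A has_fps_expansion F"
    unfolding A_def using \<open>0 \<in> E\<close> by (intro eval_fps_has_fps_expansion) (simp add: E_def zero_ereal_def)
  have q_exp: "q has_fps_expansion 2 * fps_X - F"
    unfolding q_def by (intro fps_expansion_intros A_exp)
  have q_exp': "(\<lambda>z. of_real a - of_real b * (1 - 4 * z) + (1 - 4 * z) * (1 - 4 * z) * (1 / 16 * k z)) has_fps_expansion
     fps_const (of_real a) - fps_const (of_real b) * (1 - 4 * fps_X) + (1 - 4 * fps_X) * (1 - 4 * fps_X) * (fps_const (1 / 16) * K)"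
    by (intro fps_expansion_intros k_exp)
  have q_eq': "q = (\<lambda>z. of_real a - of_real b * (1 - 4 * z) + (1 - 4 * z) * (1 - 4 * z) * (1 / 16 * k z))"
    by (rule ext) (simp add: q_eq power2_eq_square)
  have fps_eq: "2 * fps_X - F = fps_const (of_real a) - fps_const (of_real b) * (1 - 4 * fps_X)
      + (1 - 4 * fps_X) * (1 - 4 * fps_X) * (fps_const (1 / 16) * K)"
    by (rule fps_expansion_unique_complex[OF q_exp]) (subst q_eq', rule q_exp')
  have S2: "S * S = 1 - 4 * fps_X"
    unfolding S_def sqrt_fps_square by (simp add: fps_numeral_fps_const)
  have IS: "S * inverse S = 1" using inverse_mult_eq_1'[of S] by (simp add: S_def sqrt_fps_def)
  have ring: "(a' - b' * (S * S) + (S * S) * Y * (c' * K')) * I = a' * I - b' * S * (S * I) + c' * (K' * (Y * S)) * (S * I)"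
    for a' b' c' K' Y I :: "complex fps"
    by (simp only: left_diff_distrib right_diff_distrib distrib_left distrib_right ac_simps)
  have "2 * size_gf r + F = (2 * size_gf r + F) * S * inverse S" using IS by (simp add: mult.assoc)
  also have "\<dots> = (fps_const (of_real a) - fps_const (of_real b) * (S * S) + (S * S) * (1 - 4 * fps_X) * (fps_const (1 / 16) * K)) * inverse S"
    unfolding size_gf_eq_sqrt[of r, folded F_def S_def] fps_eq S2 ..
  also have "\<dots> = fps_const (of_real a) * inverse S - fps_const (of_real b) * S * (S * inverse S)
      + fps_const (1 / 16) * (K * ((1 - 4 * fps_X) * S)) * (S * inverse S)"
    by (rule ring)
  finally have M_eq: "2 * size_gf r + F = fps_const (of_real a) * inverse S - fps_const (of_real b) * S
      + fps_const (1 / 16) * (K * ((1 - 4 * fps_X) * S))"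
    unfolding IS by simp
  define C where "C = 3 * B2 / 4 * geom_sum (1 / 4 / R) 3 + 2 * B1 * geom_sum (1 / 4 / R) 3"
  show ?thesis
  proof (rule that[of C])
    fix n :: nat assume n: "n \<ge> 1"
    define s where "s = sqrt_coeff n"
    have s: "s < 0" unfolding s_def using sqrt_coeff_neg[OF n] .
    define c where "c = fps_nth (K * ((1 - 4 * fps_X) * S)) n * (1 / 4) ^ n"
    define d where "d = fps_nth F n * (1 / 4) ^ n"
    have c_le: "norm c \<le> B2 * geom_sum (1 / 4 / R) 3 * (12 * \<bar>s\<bar> / real n)"
    proof -
      have "c = (\<Sum>j=0..n. fps_nth K j * (1 / 4) ^ j * of_real (- 3 * sqrt_coeff (n - j) / (2 * real (n - j) - 3)))"
        unfolding c_def fps_mult_nth[of K] sum_distrib_right S_def sqrt_fps_4_cube_nth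
      proof (rule sum.cong)
        fix j assume "j \<in> {0..n}"
        then have p: "(1 / 4 :: complex) ^ n = (1 / 4) ^ (n - j) * (1 / 4) ^ j" by (simp flip: power_add)
        have key: "(4 :: complex) ^ (n - j) * (1 / 4) ^ (n - j) = 1" by (simp flip: power_mult_distrib)
        have r: "x * (u * y) * (w * z) = x * z * y * (u * w)" for x y z u w :: complex
          by (simp only: ac_simps)
        show "fps_nth K j * (4 ^ (n - j) * complex_of_real (- 3 * sqrt_coeff (n - j) / (2 * real (n - j) - 3))) * (1 / 4) ^ n =
            fps_nth K j * (1 / 4) ^ j * complex_of_real (- 3 * sqrt_coeff (n - j) / (2 * real (n - j) - 3))"
          unfolding p r key by simp
      qed simp
      also have "norm \<dots> \<le> B2 * geom_sum (1 / 4 / R) 3 * (12 * \<bar>s\<bar> / real n)"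
      proof (rule convolution_le)
        show "norm (fps_nth K j) \<le> B2 / R ^ j" for j
          by (rule Cauchy_coeff_le[OF k_exp holomorphic_on_subset[OF holk] _ R(2)])
             (use E(2) R(1) B2 in \<open>auto intro: ball_subset_cball[THEN subsetD, THEN E(2)[THEN subsetD]]\<close>)
        show "norm (complex_of_real (- 3 * sqrt_coeff (n - j) / (2 * real (n - j) - 3))) \<le> (real j + 1) ^ 3 * (12 * \<bar>s\<bar> / real n)"
          if "j \<le> n" for j
          unfolding norm_of_real s_def by (rule cube_coeff_le[OF n that])
      qed (use R in auto)
      finally show ?thesis .
    qed
    \<comment> \<open>The cut-away series is analytic beyond 1/4, so its share is geometrically
      small; it is weakened here to the order of the other error.\<close>
    have d_le: "norm d \<le> B1 * geom_sum (1 / 4 / R) 3 * (2 * \<bar>s\<bar> / real n)"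
    proof -
      have B1_0: "B1 \<ge> 0" using order_trans[OF norm_ge_zero B1[of 0]] R'(1) by simp
      have "norm (fps_nth F n) \<le> B1 / R ^ n"
        by (rule Cauchy_coeff_le[OF A_exp holomorphic_on_subset[OF holA] _ R(2)])
           (use E(2) R(1) B1 in \<open>auto intro: ball_subset_cball[THEN subsetD, THEN E(2)[THEN subsetD]]\<close>)
      then have "norm d \<le> B1 / R ^ n * (1 / 4) ^ n"
        unfolding d_def norm_mult norm_power using B1_0 R(1) by (intro mult_mono) auto
      also have "\<dots> = B1 * (1 / 4 / R) ^ n * 1" by (simp add: power_divide)
      also have "1 \<le> (real n + 1) / real n * ((real n + 1)\<^sup>2 * (2 * \<bar>s\<bar>))"
      proof -
        have "1 * 1 \<le> (real n + 1) / real n * ((real n + 1)\<^sup>2 * (2 * \<bar>s\<bar>))"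
          using sqrt_coeff_diff_le[of n n] n by (intro mult_mono) (auto simp: s_def)
        then show ?thesis by simp
      qed
      then have "B1 * (1 / 4 / R) ^ n * 1 \<le> B1 * (1 / 4 / R) ^ n * ((real n + 1) / real n * ((real n + 1)\<^sup>2 * (2 * \<bar>s\<bar>)))"
        using B1_0 R(1) by (intro mult_left_mono) auto
      also have "\<dots> = B1 * ((1 / 4 / R) ^ n * (real n + 1) ^ 3) * (2 * \<bar>s\<bar> / real n)"
        by (simp add: power2_eq_square power3_eq_cube)
      also have "\<dots> \<le> B1 * geom_sum (1 / 4 / R) 3 * (2 * \<bar>s\<bar> / real n)"
        using geom_sum_ge[OF \<theta>, of n 3] B1_0 by (intro mult_right_mono mult_left_mono) auto
      finally show ?thesis .
    qed
    have card: "real (card (plane_trees n)) = - (4 ^ n * s) / 2" using card_plane_trees[OF n] by (simp add: s_def)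
    have size: "fps_nth (size_gf r) n = complex_of_real (mean_size r n * real (card (plane_trees n)))"
    proof -
      have "real (card (plane_trees n)) \<noteq> 0" using s card by simp
      then show ?thesis by (simp add: size_gf_def tree_gf_def mean_size_def)
    qed
    have "fps_nth (2 * size_gf r + F) n * (1 / 4) ^ n =
       (of_real a * (- (4 ^ n) * of_real ((2 * real n - 1) * s)) - of_real b * (of_real s * 4 ^ n)
         + 1 / 16 * fps_nth (K * ((1 - 4 * fps_X) * S)) n) * (1 / 4) ^ n"
      unfolding M_eq using inverse_sqrt_fps_4_nth[of n] by (simp add: S_def s_def sqrt_fps_def)
    also have "\<dots> = of_real (- a * (2 * real n - 1) * s - b * s) + c / 16"
    proof -
      have "(a' * (- q * u) - b' * (s' * q) + 1 / 16 * y) * p = (- a' * u - b' * s') * (q * p) + y * p / 16"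
        for a' b' q u s' y p :: complex
        by (simp add: algebra_simps)
      moreover have "(4 :: complex) ^ n * (1 / 4) ^ n = 1" by (simp flip: power_mult_distrib)
      ultimately show ?thesis by (simp add: c_def mult.assoc)
    qed
    finally have "2 * of_real (mean_size r n * (- (4 ^ n * s) / 2)) * (1 / 4) ^ n + d = of_real (- a * (2 * real n - 1) * s - b * s) + c / 16"
      using size card by (simp add: fps_numeral_fps_const d_def distrib_right left_diff_distrib)
    then have "of_real (- mean_size r n * s) + d = of_real (- a * (2 * real n - 1) * s - b * s) + c / 16"
      by (simp add: power_divide)
    then have "of_real (- s * (mean_size r n - (a * (2 * real n - 1) + b))) = c / 16 - d"
      by (simp add: algebra_simps)
    then have "\<bar>- s * (mean_size r n - (a * (2 * real n - 1) + b))\<bar> = norm (c / 16 - d)"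
      by (metis norm_of_real)
    also have "\<dots> \<le> norm c / 16 + norm d"
      using norm_triangle_ineq4[of "c / 16" d] by (simp add: norm_divide)
    also have "\<dots> \<le> \<bar>s\<bar> * (C / real n)"
    proof -
      have "\<bar>s\<bar> * (C / real n) = B2 * geom_sum (1 / 4 / R) 3 * (12 * \<bar>s\<bar> / real n) / 16
          + B1 * geom_sum (1 / 4 / R) 3 * (2 * \<bar>s\<bar> / real n)"
        unfolding C_def using n by (simp add: field_simps)
      then show ?thesis
        by (simp only:) (intro add_mono divide_right_mono c_le d_le, simp)
    qed
    finally have "\<bar>s\<bar> * \<bar>mean_size r n - (a * (2 * real n - 1) + b)\<bar> \<le> \<bar>s\<bar> * (C / real n)"
      by (simp only: abs_mult abs_minus)
    then have "\<bar>mean_size r n - (a * (2 * real n - 1) + b)\<bar> \<le> C / real n"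
      using s by (simp only: mult_le_cancel_left_pos zero_less_abs_iff)
    moreover have "a * (2 * real n - 1) + b = real n / m - (m - 1) * (m - 2) / (6 * m)"
      using m1 by (simp add: a_def b_def \<beta>_def field_simps power2_eq_square)
    ultimately show "\<bar>mean_size r n - (real n / m - (m - 1) * (m - 2) / (6 * m))\<bar> \<le> C / real n" by simp
  qed
qed

subsection \<open>Consequences of a quasi-power moment generating function\<close>

lemma norm_exp_minus_one_le: "norm (exp w - 1) \<le> norm w * exp (norm w)" for w :: complex
proof -
  have "norm (exp w - exp 0) \<le> exp (norm w) * norm (w - 0)"
  proof (rule field_differentiable_bound[where S = "cball 0 (norm w)" and f' = exp])
    fix z :: complex assume "z \<in> cball 0 (norm w)"
    then have "norm z \<le> norm w" by simp
    then show "norm (exp z) \<le> exp (norm w)"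
      using norm_exp[of z] by (meson exp_le_cancel_iff order_trans)
  qed (auto intro!: derivative_eq_intros)
  then show ?thesis by (simp add: mult.commute)
qed

lemma power_le_fact_exp:
  assumes "x \<ge> (0 :: real)"
  shows "x ^ j \<le> fact j * exp x"
proof -
  have sums: "(\<lambda>i. x ^ i / fact i) sums exp x"
    using exp_converges[of x] by (simp add: divide_inverse mult.commute)
  have "(\<Sum>i\<in>{j}. x ^ i / fact i) \<le> (\<Sum>i. x ^ i / fact i)"
    using assms by (intro sum_le_suminf sums_summable[OF sums]) auto
  then have "x ^ j / fact j \<le> exp x"
    using sums_unique[OF sums] by simp
  then show ?thesis by (simp add: field_simps)
qed

lemma holomorphic_cubic_remainder:
  fixes f :: "complex \<Rightarrow> complex"
  assumes "f holomorphic_on ball 0 \<delta>" "0 < \<rho>" "\<rho> < \<delta>"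
  obtains K where "K > 0" "\<And>s. norm s \<le> \<rho> \<Longrightarrow> norm (f s - (f 0 + deriv f 0 * s + deriv (deriv f) 0 * s\<^sup>2 / 2)) \<le> K * norm s ^ 3"
proof -
  have hol: "(deriv ^^ i) f holomorphic_on ball 0 \<delta>" for i
    using assms(1) by (intro holomorphic_higher_deriv) auto
  have der: "((deriv ^^ i) f has_field_derivative (deriv ^^ Suc i) f x) (at x within S)" if "norm x < \<delta>" for i x S
    using holomorphic_derivI[OF hol[of i] open_ball, of x] that by (auto intro: has_field_derivative_at_within)
  have "continuous_on (cball 0 \<rho>) ((deriv ^^ 3) f)"
    using hol[of 3] assms(3) by (intro holomorphic_on_imp_continuous_on) (auto elim: holomorphic_on_subset)
  then have "bounded ((deriv ^^ 3) f ` cball 0 \<rho>)"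
    by (intro compact_imp_bounded compact_continuous_image) auto
  then obtain B where B: "B > 0" "\<forall>x\<in>(deriv ^^ 3) f ` cball 0 \<rho>. norm x \<le> B"
    unfolding bounded_pos by blast
  show ?thesis
  proof (rule that[OF B(1)])
    fix s :: complex assume s: "norm s \<le> \<rho>"
    have "norm ((deriv ^^ 0) f s - (\<Sum>i\<le>2. (deriv ^^ i) f 0 * (s - 0) ^ i / fact i)) \<le> B * norm (s - 0) ^ Suc 2 / fact 2"
    proof (rule complex_Taylor[where S = "cball 0 \<rho>" and f = "\<lambda>i. (deriv ^^ i) f"])
      show "((deriv ^^ i) f has_field_derivative (deriv ^^ Suc i) f x) (at x within cball 0 \<rho>)"
        if "x \<in> cball 0 \<rho>" for i x
        using that assms(3) by (intro der) auto
      show "norm ((deriv ^^ Suc 2) f x) \<le> B" if "x \<in> cball 0 \<rho>" for x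
        using B(2) that by (simp add: numeral_3_eq_3 numeral_2_eq_2)
    qed (use s assms in auto)
    also have "\<dots> \<le> B * norm s ^ 3"
      using B(1) by (simp add: numeral_3_eq_3 numeral_2_eq_2)
    finally show "norm (f s - (f 0 + deriv f 0 * s + deriv (deriv f) 0 * s\<^sup>2 / 2)) \<le> B * norm s ^ 3"
      by (simp add: numeral_2_eq_2)
  qed
qed

text \<open>All that the limit theorems use of the trees: finite supports, which make expectations
  finite sums and thus holomorphic in s, and a bound uniform in n and s. Everything is restricted to
  n >= 1, where the uniform distribution is meaningful.\<close>

locale quasi_power =
  fixes p :: "nat \<Rightarrow> 'a pmf" and X :: "'a \<Rightarrow> real" and \<Lambda> :: "complex \<Rightarrow> complex" and \<delta> C \<mu> \<sigma>2 :: real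
  assumes fin: "n \<ge> 1 \<Longrightarrow> finite (set_pmf (p n))"
    and \<delta>: "\<delta> > 0" and hol: "\<Lambda> holomorphic_on ball 0 \<delta>"
    and \<Lambda>0: "\<Lambda> 0 = 0" and \<Lambda>1: "deriv \<Lambda> 0 = of_real \<mu>" and \<Lambda>2: "deriv (deriv \<Lambda>) 0 = of_real \<sigma>2"
    and bound: "n \<ge> 1 \<Longrightarrow> norm s < \<delta> \<Longrightarrow>
      norm (measure_pmf.expectation (p n) (\<lambda>a. exp (s * of_real (X a))) * exp (- of_nat n * \<Lambda> s)) \<le> C"
begin

abbreviation \<E> :: "nat \<Rightarrow> ('a \<Rightarrow> 'b::{banach, second_countable_topology}) \<Rightarrow> 'b" where
  "\<E> n \<equiv> measure_pmf.expectation (p n)"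

definition Y :: "nat \<Rightarrow> 'a \<Rightarrow> real" where "Y n a = X a - \<mu> * real n"

definition \<Psi> :: "nat \<Rightarrow> complex \<Rightarrow> complex" where
  "\<Psi> n s = \<E> n (\<lambda>a. exp (s * of_real (X a))) * exp (- of_nat n * \<Lambda> s)"

text \<open>The exponent that belongs to the centred variable \<open>Y\<close>; it vanishes to
  second order at 0.\<close>

definition L :: "complex \<Rightarrow> complex" where "L s = \<Lambda> s - of_real \<mu> * s"

lemma integrable [simp, intro]:
  fixes f :: "'a \<Rightarrow> 'b::{banach, second_countable_topology}"
  shows "n \<ge> 1 \<Longrightarrow> integrable (measure_pmf (p n)) f"
  by (intro integrable_measure_pmf_finite fin)

lemma expectation_eq_sum:
  fixes f :: "'a \<Rightarrow> 'b::{banach, second_countable_topology}"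
  assumes "n \<ge> 1"
  shows "\<E> n f = (\<Sum>a\<in>set_pmf (p n). pmf (p n) a *\<^sub>R f a)"
  using fin[OF assms] by (intro integral_measure_pmf) auto

lemma C_nonneg: "C \<ge> 0"
  using order_trans[OF norm_ge_zero bound[of 1 0]] \<delta> by simp

lemma hol_\<Psi>: "n \<ge> 1 \<Longrightarrow> \<Psi> n holomorphic_on ball 0 \<delta>"
  unfolding \<Psi>_def expectation_eq_sum by (intro holomorphic_intros hol)

lemma \<Psi>_0: "n \<ge> 1 \<Longrightarrow> \<Psi> n 0 = 1"
  by (simp add: \<Psi>_def \<Lambda>0 measure_pmf.prob_space)

lemma \<Psi>_le: "n \<ge> 1 \<Longrightarrow> norm s < \<delta> \<Longrightarrow> norm (\<Psi> n s) \<le> C"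
  unfolding \<Psi>_def by (rule bound)

text \<open>The disc of radius \<delta> / 2 around z stays inside the disc of radius \<delta>, where
  C bounds \<Psi> for every n. This makes all derivative bounds independent of n.\<close>

lemma deriv_\<Psi>_le:
  assumes "n \<ge> 1" "norm z < \<delta> / 2"
  shows "norm ((deriv ^^ k) (\<Psi> n) z) \<le> fact k * C / (\<delta> / 2) ^ k"
proof (rule Cauchy_inequality)
  have sub: "cball z (\<delta> / 2) \<subseteq> ball 0 \<delta>"
  proof
    fix w assume "w \<in> cball z (\<delta> / 2)"
    then have "norm (w - z) \<le> \<delta> / 2" by (simp add: dist_norm norm_minus_commute)
    then show "w \<in> ball 0 \<delta>" using assms(2) norm_triangle_ineq[of "w - z" z] by (simp add: dist_norm)
  qed
  show "\<Psi> n holomorphic_on ball z (\<delta> / 2)"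
    using hol_\<Psi>[OF assms(1)] by (rule holomorphic_on_subset) (use sub ball_subset_cball in blast)
  show "continuous_on (cball z (\<delta> / 2)) (\<Psi> n)"
    using hol_\<Psi>[OF assms(1)] sub by (blast intro: holomorphic_on_imp_continuous_on holomorphic_on_subset)
  show "norm (\<Psi> n w) \<le> C" if "norm (z - w) = \<delta> / 2" for w
    using sub that by (intro \<Psi>_le assms(1)) (auto simp: dist_norm)
qed (use \<delta> in auto)

lemma \<Psi>_diff_le:
  assumes n: "n \<ge> 1" and s: "norm s < \<delta> / 2"
  shows "norm (\<Psi> n s - 1) \<le> C / (\<delta> / 2) * norm s"
proof -
  have "norm (\<Psi> n s - \<Psi> n 0) \<le> C / (\<delta> / 2) * norm (s - 0)"
  proof (rule field_differentiable_bound[where S = "ball 0 (\<delta> / 2)" and f' = "deriv (\<Psi> n)"])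
    fix z :: complex assume z: "z \<in> ball 0 (\<delta> / 2)"
    then have "z \<in> ball 0 \<delta>" using \<delta> by simp
    then show "(\<Psi> n has_field_derivative deriv (\<Psi> n) z) (at z within ball 0 (\<delta> / 2))"
      using holomorphic_derivI[OF hol_\<Psi>[OF n] open_ball] by (blast intro: has_field_derivative_at_within)
    show "norm (deriv (\<Psi> n) z) \<le> C / (\<delta> / 2)"
      using deriv_\<Psi>_le[OF n, of z 1] z by simp
  qed (use s \<delta> in auto)
  then show ?thesis by (simp add: \<Psi>_0[OF n])
qed

lemma mgf_Y:
  assumes "n \<ge> 1"
  shows "\<E> n (\<lambda>a. exp (s * of_real (Y n a))) = exp (of_nat n * L s) * \<Psi> n s"
proof -
  have "exp (s * of_real (Y n a)) = exp (s * of_real (X a)) * exp (- (s * of_real \<mu> * of_nat n))" for a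
    by (simp add: Y_def algebra_simps flip: exp_add)
  then have "\<E> n (\<lambda>a. exp (s * of_real (Y n a))) =
      \<E> n (\<lambda>a. exp (s * of_real (X a))) * exp (- (s * of_real \<mu> * of_nat n))"
    by simp
  also have "\<dots> = exp (of_nat n * L s) * \<Psi> n s"
    by (simp add: \<Psi>_def L_def mult_ac flip: exp_add) (simp add: algebra_simps flip: exp_add)
  finally show ?thesis .
qed

lemma hol_L: "L holomorphic_on ball 0 \<delta>"
  unfolding L_def by (intro holomorphic_intros hol)

lemma L_derivs: "L 0 = 0" "deriv L 0 = 0" "deriv (deriv L) 0 = of_real \<sigma>2"
proof -
  have d: "(L has_field_derivative deriv \<Lambda> s - of_real \<mu>) (at s)" if "norm s < \<delta>" for s
    unfolding L_def using holomorphic_derivI[OF hol open_ball, of s] that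
    by (auto intro!: derivative_eq_intros)
  show "L 0 = 0" by (simp add: L_def \<Lambda>0)
  show "deriv L 0 = 0" using DERIV_imp_deriv[OF d[of 0]] \<delta> by (simp add: \<Lambda>1)
  have "((\<lambda>s. deriv \<Lambda> s - of_real \<mu>) has_field_derivative of_real \<sigma>2) (at 0)"
    using holomorphic_derivI[OF holomorphic_deriv[OF hol open_ball] open_ball, of 0] \<delta>
    by (auto intro!: derivative_eq_intros simp: \<Lambda>2)
  then have "(deriv L has_field_derivative of_real \<sigma>2) (at 0)"
    by (rule has_field_derivative_transform_within_open[where S = "ball 0 \<delta>"])
       (use \<delta> in \<open>auto simp: DERIV_imp_deriv[OF d]\<close>)
  then show "deriv (deriv L) 0 = of_real \<sigma>2" by (rule DERIV_imp_deriv)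
qed

lemma L_remainder:
  obtains K where "K > 0" "\<And>s. norm s \<le> \<delta> / 2 \<Longrightarrow> norm (L s - of_real \<sigma>2 * s\<^sup>2 / 2) \<le> K * norm s ^ 3"
  using holomorphic_cubic_remainder[OF hol_L, of "\<delta> / 2"] \<delta> unfolding L_derivs by auto

text \<open>Both sides of \<open>mgf_Y\<close> are differentiated at 0. As L and L' vanish there,
  the mean of Y sees only the prefactor, and the second moment gains n L''(0).\<close>

lemma expectation_Y:
  assumes n: "n \<ge> 1"
  shows "complex_of_real (\<E> n (Y n)) = deriv (\<Psi> n) 0"
    and "complex_of_real (\<E> n (\<lambda>a. (Y n a)\<^sup>2)) = of_nat n * of_real \<sigma>2 + deriv (deriv (\<Psi> n)) 0"
proof -
  let ?f = "\<lambda>k s. \<Sum>a\<in>set_pmf (p n). of_real (pmf (p n) a * Y n a ^ k) * exp (s * of_real (Y n a))"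
  have df: "(?f k has_field_derivative ?f (Suc k) s) (at s)" for k s
    by (auto intro!: derivative_eq_intros sum.cong)
  have f_eq: "?f 0 s = exp (of_nat n * L s) * \<Psi> n s" for s
    using mgf_Y[OF n, of s] by (simp add: expectation_eq_sum[OF n] scaleR_conv_of_real)
  have dL: "(L has_field_derivative deriv L s) (at s)" and d\<Psi>: "(\<Psi> n has_field_derivative deriv (\<Psi> n) s) (at s)"
    if "norm s < \<delta>" for s
    using holomorphic_derivI[OF hol_L open_ball] holomorphic_derivI[OF hol_\<Psi>[OF n] open_ball] that by auto
  have dL1: "(deriv L has_field_derivative of_real \<sigma>2) (at 0)"
    using holomorphic_derivI[OF holomorphic_deriv[OF hol_L open_ball] open_ball, of 0] \<delta> by (simp add: L_derivs)
  have d\<Psi>1: "(deriv (\<Psi> n) has_field_derivative deriv (deriv (\<Psi> n)) 0) (at 0)"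
    using holomorphic_derivI[OF holomorphic_deriv[OF hol_\<Psi>[OF n] open_ball] open_ball, of 0] \<delta> by simp
  have f1: "?f 1 s = exp (of_nat n * L s) * (of_nat n * deriv L s * \<Psi> n s + deriv (\<Psi> n) s)" if s: "norm s < \<delta>" for s
  proof (rule DERIV_unique)
    show "(?f 0 has_field_derivative ?f 1 s) (at s)" using df[of 0 s] by simp
    show "(?f 0 has_field_derivative exp (of_nat n * L s) * (of_nat n * deriv L s * \<Psi> n s + deriv (\<Psi> n) s)) (at s)"
      unfolding f_eq by (rule refl dL[OF s] d\<Psi>[OF s] derivative_eq_intros)+ (simp add: algebra_simps)
  qed
  have "?f 1 0 = deriv (\<Psi> n) 0" using f1[of 0] \<delta> by (simp add: L_derivs)
  then show "complex_of_real (\<E> n (Y n)) = deriv (\<Psi> n) 0"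
    by (simp add: expectation_eq_sum[OF n])
  have "?f 2 0 = of_nat n * of_real \<sigma>2 + deriv (deriv (\<Psi> n)) 0"
  proof (rule DERIV_unique)
    show "(?f 1 has_field_derivative ?f 2 0) (at 0)" using df[of 1 0] by (simp add: numeral_2_eq_2)
    have "((\<lambda>s. exp (of_nat n * L s) * (of_nat n * deriv L s * \<Psi> n s + deriv (\<Psi> n) s)) has_field_derivative
        of_nat n * of_real \<sigma>2 + deriv (deriv (\<Psi> n)) 0) (at 0)"
      using \<delta> by (auto intro!: derivative_eq_intros dL d\<Psi> dL1 d\<Psi>1 simp: L_derivs \<Psi>_0[OF n])
    then show "(?f 1 has_field_derivative of_nat n * of_real \<sigma>2 + deriv (deriv (\<Psi> n)) 0) (at 0)"
      by (rule has_field_derivative_transform_within_open[where S = "ball 0 \<delta>"]) (use \<delta> f1 in auto)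
  qed
  then show "complex_of_real (\<E> n (\<lambda>a. (Y n a)\<^sup>2)) = of_nat n * of_real \<sigma>2 + deriv (deriv (\<Psi> n)) 0"
    by (simp add: expectation_eq_sum[OF n])
qed

lemma expectation_Y_le:
  assumes n: "n \<ge> 1"
  shows "\<bar>\<E> n (Y n)\<bar> \<le> C / (\<delta> / 2)"
    and "\<bar>\<E> n (\<lambda>a. (Y n a)\<^sup>2) - \<sigma>2 * real n\<bar> \<le> 2 * C / (\<delta> / 2)\<^sup>2"
proof -
  have "norm (complex_of_real (\<E> n (Y n))) \<le> C / (\<delta> / 2)"
    unfolding expectation_Y(1)[OF n] using deriv_\<Psi>_le[OF n, of 0 1] \<delta> by simp
  then show "\<bar>\<E> n (Y n)\<bar> \<le> C / (\<delta> / 2)" by (simp only: norm_of_real)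
  have "complex_of_real (\<E> n (\<lambda>a. (Y n a)\<^sup>2) - \<sigma>2 * real n) = (deriv ^^ 2) (\<Psi> n) 0"
    using expectation_Y(2)[OF n] by (simp add: numeral_2_eq_2 mult.commute)
  then have "norm (complex_of_real (\<E> n (\<lambda>a. (Y n a)\<^sup>2) - \<sigma>2 * real n)) \<le> fact 2 * C / (\<delta> / 2) ^ 2"
    using deriv_\<Psi>_le[OF n, of 0 2] \<delta> by simp
  then show "\<bar>\<E> n (\<lambda>a. (Y n a)\<^sup>2) - \<sigma>2 * real n\<bar> \<le> 2 * C / (\<delta> / 2)\<^sup>2"
    by (simp only: norm_of_real fact_2)
qed

lemma variance_X:
  assumes n: "n \<ge> 1"
  shows "measure_pmf.variance (p n) X =
    \<E> n (\<lambda>a. (Y n a)\<^sup>2) - (\<E> n (Y n))\<^sup>2"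
proof -
  have EX: "\<E> n X = \<E> n (Y n) + \<mu> * real n"
    unfolding Y_def using n by (simp add: measure_pmf.prob_space)
  have "measure_pmf.variance (p n) X = measure_pmf.variance (p n) (Y n)"
    unfolding EX by (simp add: Y_def algebra_simps)
  also have "\<dots> = \<E> n (\<lambda>a. (Y n a)\<^sup>2) - (\<E> n (Y n))\<^sup>2"
    using n by (intro measure_pmf.variance_eq) auto
  finally show ?thesis .
qed

lemma variance_le:
  assumes n: "n \<ge> 1"
  shows "\<bar>measure_pmf.variance (p n) X - \<sigma>2 * real n\<bar> \<le> 2 * C / (\<delta> / 2)\<^sup>2 + (C / (\<delta> / 2))\<^sup>2"
proof -
  have "(\<E> n (Y n))\<^sup>2 \<le> (C / (\<delta> / 2))\<^sup>2"
    using expectation_Y_le(1)[OF n] by (simp add: abs_le_square_iff[symmetric] C_nonneg \<delta> less_imp_le)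
  moreover have "\<bar>a - b - c\<bar> \<le> A + B" if "\<bar>a - c\<bar> \<le> A" "0 \<le> b" "b \<le> B" for a b c A B :: real
    using that by linarith
  ultimately show ?thesis
    unfolding variance_X[OF n] using expectation_Y_le(2)[OF n] by simp
qed

text \<open>At s = a / sqrt n or s = - a / sqrt n with a = \<delta> / 2, the exponent n L(s) stays
  bounded, because L is of second order. Exponential moments on the scale sqrt n dominate the powers
  |Y|^j up to j! (sqrt n / a)^j.\<close>

lemma abs_moment_le:
  obtains B where "\<And>n. n \<ge> 1 \<Longrightarrow> \<E> n (\<lambda>a. \<bar>Y n a\<bar> ^ j) \<le> B * real n powr (real j / 2)"
proof -
  obtain K where K: "K > 0" "\<And>s. norm s \<le> \<delta> / 2 \<Longrightarrow> norm (L s - of_real \<sigma>2 * s\<^sup>2 / 2) \<le> K * norm s ^ 3"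
    using L_remainder by blast
  define a where "a = \<delta> / 2"
  have a: "a > 0" using \<delta> by (simp add: a_def)
  define G where "G = \<bar>\<sigma>2\<bar> * a\<^sup>2 / 2 + K * a ^ 3"
  show ?thesis
  proof (rule that[of "fact j * (2 * (exp G * C)) / a ^ j"])
    fix n :: nat assume n: "n \<ge> 1"
    define q where "q = sqrt (real n)"
    have q: "q \<ge> 1" "q\<^sup>2 = real n" using n by (auto simp: q_def)
    have mgf: "\<E> n (\<lambda>b. exp (s * Y n b)) \<le> exp G * C" if s: "\<bar>s\<bar> = a / q" for s :: real
    proof -
      have s_le: "\<bar>s\<bar> \<le> \<delta> / 2" using s q(1) a by (simp add: a_def divide_le_eq mult_le_cancel_left1)
      have ns: "norm (complex_of_real s) = a / q" using s by simp
      have "real n * norm (L s) \<le> G"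
      proof -
        have "norm (L s) \<le> norm (of_real \<sigma>2 * (complex_of_real s)\<^sup>2 / 2) + norm (L s - of_real \<sigma>2 * (complex_of_real s)\<^sup>2 / 2)"
          by (rule norm_triangle_sub)
        also have "\<dots> \<le> \<bar>\<sigma>2\<bar> * (a / q)\<^sup>2 / 2 + K * (a / q) ^ 3"
          using K(2)[of s] s_le s by (simp add: norm_mult norm_divide norm_power)
        finally have "real n * norm (L s) \<le> real n * (\<bar>\<sigma>2\<bar> * (a / q)\<^sup>2 / 2 + K * (a / q) ^ 3)"
          by (rule mult_left_mono) simp
        also have "\<dots> = \<bar>\<sigma>2\<bar> * a\<^sup>2 / 2 + K * a ^ 3 / q"
          unfolding q(2)[symmetric] using q(1) by (simp add: field_simps power2_eq_square power3_eq_cube)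
        also have "K * a ^ 3 / q \<le> K * a ^ 3"
        proof -
          have "K * a ^ 3 * 1 \<le> K * a ^ 3 * q" using K(1) a q(1) by (intro mult_left_mono) auto
          then show ?thesis using q(1) by (simp add: pos_divide_le_eq)
        qed
        finally show ?thesis by (simp add: G_def)
      qed
      then have "norm (of_nat n * L s) \<le> G" by (simp add: norm_mult)
      then have "norm (exp (of_nat n * L s)) \<le> exp G"
        using norm_exp[of "of_nat n * L s"] by (meson exp_le_cancel_iff order_trans)
      moreover have "norm (\<Psi> n s) \<le> C"
        using s_le \<delta> by (intro \<Psi>_le n) simp
      ultimately have "norm (exp (of_nat n * L s) * \<Psi> n s) \<le> exp G * C"
        unfolding norm_mult by (intro mult_mono) auto
      moreover have "exp (of_nat n * L s) * \<Psi> n s = complex_of_real (\<E> n (\<lambda>b. exp (s * Y n b)))"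
        unfolding mgf_Y[OF n, symmetric] by (simp add: exp_of_real[symmetric] flip: integral_complex_of_real)
      ultimately show ?thesis by simp
    qed
    have "\<E> n (\<lambda>b. \<bar>Y n b\<bar> ^ j) \<le>
      \<E> n (\<lambda>b. (q / a) ^ j * fact j * (exp (a / q * Y n b) + exp (- (a / q) * Y n b)))"
    proof (rule integral_mono)
      fix b
      have "(a / q * \<bar>Y n b\<bar>) ^ j \<le> fact j * exp (a / q * \<bar>Y n b\<bar>)"
        using a q by (intro power_le_fact_exp) simp
      also have "exp (a / q * \<bar>Y n b\<bar>) \<le> exp (a / q * Y n b) + exp (- (a / q) * Y n b)"
        by (cases "Y n b \<ge> 0") auto
      finally have "(q / a) ^ j * (a / q * \<bar>Y n b\<bar>) ^ j \<le> (q / a) ^ j * (fact j * (exp (a / q * Y n b) + exp (- (a / q) * Y n b)))"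
        using a q by (intro mult_left_mono) auto
      moreover have "(q / a) ^ j * (a / q * \<bar>Y n b\<bar>) ^ j = \<bar>Y n b\<bar> ^ j"
        using a q by (simp add: power_mult_distrib[symmetric])
      ultimately show "\<bar>Y n b\<bar> ^ j \<le> (q / a) ^ j * fact j * (exp (a / q * Y n b) + exp (- (a / q) * Y n b))"
        by (simp add: mult.assoc)
    qed (use n in auto)
    also have "\<dots> = (q / a) ^ j * fact j * (\<E> n (\<lambda>b. exp (a / q * Y n b)) +
        \<E> n (\<lambda>b. exp (- (a / q) * Y n b)))"
      using n by simp
    also have "\<dots> \<le> (q / a) ^ j * fact j * (exp G * C + exp G * C)"
      using mgf[of "a / q"] mgf[of "- (a / q)"] a q by (intro mult_left_mono add_mono) auto
    also have "\<dots> = fact j * (2 * (exp G * C)) / a ^ j * q ^ j"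
      by (simp add: power_divide)
    also have "q ^ j = real n powr (real j / 2)"
      using n by (simp add: q_def powr_half_sqrt[symmetric] powr_powr flip: powr_realpow)
    finally show "\<E> n (\<lambda>a. \<bar>Y n a\<bar> ^ j) \<le> fact j * (2 * (exp G * C)) / a ^ j * real n powr (real j / 2)" .
  qed
qed

end

section \<open>Characteristic functions and the normal limit\<close>

lemma integrable_gaussian_quadratic: "integrable lborel (\<lambda>t::real. (1 + t\<^sup>2) * exp (- t\<^sup>2 / 4))"
proof -
  have "integrable lborel (\<lambda>x. std_normal_density x * x ^ k)" for k
    using integrable_normal_moment[of 1 0 k] by simp
  from lborel_integrable_real_affine[OF this, of "1 / sqrt 2" 0]
  have int: "integrable lborel (\<lambda>x. std_normal_density (x / sqrt 2) * (x / sqrt 2) ^ k)" for k by simp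
  have dens: "sqrt (2 * pi) * std_normal_density (x / sqrt 2) = exp (- x\<^sup>2 / 4)" for x
    by (simp add: std_normal_density_def power_divide)
  have "integrable lborel (\<lambda>x. sqrt (2 * pi) * (std_normal_density (x / sqrt 2) * (x / sqrt 2) ^ 0) +
      2 * sqrt (2 * pi) * (std_normal_density (x / sqrt 2) * (x / sqrt 2) ^ 2))"
    by (intro Bochner_Integration.integrable_add integrable_mult_right int)
  also have "(\<lambda>x. sqrt (2 * pi) * (std_normal_density (x / sqrt 2) * (x / sqrt 2) ^ 0) +
      2 * sqrt (2 * pi) * (std_normal_density (x / sqrt 2) * (x / sqrt 2) ^ 2)) = (\<lambda>t. (1 + t\<^sup>2) * exp (- t\<^sup>2 / 4))"
  proof
    fix x :: real
    have "sqrt (2 * pi) * (std_normal_density (x / sqrt 2) * (x / sqrt 2) ^ 0) +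
      2 * sqrt (2 * pi) * (std_normal_density (x / sqrt 2) * (x / sqrt 2) ^ 2) =
      (1 + 2 * (x / sqrt 2) ^ 2) * (sqrt (2 * pi) * std_normal_density (x / sqrt 2))"
    proof -
      have "c * (d * 1) + 2 * c * (d * y) = (1 + 2 * y) * (c * d)" for c d y :: real
        by (simp add: algebra_simps)
      then show ?thesis unfolding power_0 .
    qed
    also have "\<dots> = (1 + x\<^sup>2) * exp (- x\<^sup>2 / 4)" unfolding dens by (simp add: power_divide)
    finally show "sqrt (2 * pi) * (std_normal_density (x / sqrt 2) * (x / sqrt 2) ^ 0) +
      2 * sqrt (2 * pi) * (std_normal_density (x / sqrt 2) * (x / sqrt 2) ^ 2) = (1 + x\<^sup>2) * exp (- x\<^sup>2 / 4)" .
  qed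
  finally show ?thesis .
qed

context quasi_power
begin

text \<open>At s = i t / (\<sigma> sqrt n) the exponent n L(s) is - t^2 / 2 plus an error of order
  |t|^3 / sqrt n, and \<Psi> - 1 is of order |t| / sqrt n. Both errors carry the factor |t| that the
  smoothing inequality divides out.\<close>

lemma char_diff_le:
  assumes \<sigma>2: "\<sigma>2 > 0"
  obtains c D where "c > 0" "D > 0"
    "\<And>n t. n \<ge> 1 \<Longrightarrow> \<bar>t\<bar> \<le> c * sqrt (real n) \<Longrightarrow>
      norm (\<E> n (\<lambda>a. iexp (t * (Y n a / sqrt (\<sigma>2 * real n)))) - of_real (exp (- (t\<^sup>2) / 2)))
      \<le> \<bar>t\<bar> * (D / sqrt (real n) * ((1 + t\<^sup>2) * exp (- t\<^sup>2 / 4)))"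
proof -
  obtain K where K: "K > 0" "\<And>s. norm s \<le> \<delta> / 2 \<Longrightarrow> norm (L s - of_real \<sigma>2 * s\<^sup>2 / 2) \<le> K * norm s ^ 3"
    using L_remainder by blast
  define \<sigma> where "\<sigma> = sqrt \<sigma>2"
  have \<sigma>: "\<sigma> > 0" "\<sigma>\<^sup>2 = \<sigma>2" using \<sigma>2 by (auto simp: \<sigma>_def)
  define \<kappa> where "\<kappa> = K / \<sigma> ^ 3"
  have \<kappa>: "\<kappa> > 0" using K(1) \<sigma> by (simp add: \<kappa>_def)
  \<comment> \<open>The left bound keeps |s| <= \<delta> / 4. The right one makes the error of the
    exponent at most t^2 / 4, so that the decay exp (- t^2 / 4) is left over.\<close>
  define c where "c = min (\<sigma> * \<delta> / 4) (1 / (4 * \<kappa>))"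
  have c: "c > 0" "c \<le> \<sigma> * \<delta> / 4" "\<kappa> * c \<le> 1 / 4"
  proof -
    show "c > 0" using \<sigma> \<kappa> \<delta> by (simp add: c_def)
    show "c \<le> \<sigma> * \<delta> / 4" by (simp add: c_def)
    have "\<kappa> * c \<le> \<kappa> * (1 / (4 * \<kappa>))" using \<kappa> by (intro mult_left_mono) (auto simp: c_def)
    then show "\<kappa> * c \<le> 1 / 4" using \<kappa> by simp
  qed
  define D where "D = C / (\<delta> / 2) / \<sigma> + \<kappa>"
  have D: "D > 0" using \<kappa> C_nonneg \<delta> \<sigma> by (simp add: D_def add_nonneg_pos)
  show ?thesis
  proof (rule that[OF c(1) D])
    fix n :: nat and t :: real
    assume n: "n \<ge> 1" and t: "\<bar>t\<bar> \<le> c * sqrt (real n)"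
    define q where "q = sqrt (real n)"
    have q: "q \<ge> 1" "q\<^sup>2 = real n" using n by (auto simp: q_def)
    define s where "s = \<i> * of_real (t / (\<sigma> * q))"
    have ns: "norm s = \<bar>t\<bar> / (\<sigma> * q)" using \<sigma> q unfolding s_def norm_mult norm_of_real by (simp add: abs_mult)
    have "\<bar>t\<bar> / (\<sigma> * q) \<le> c * q / (\<sigma> * q)" using t \<sigma> q by (intro divide_right_mono) (auto simp: q_def)
    also have "\<dots> = c / \<sigma>" using q by simp
    also have "\<dots> \<le> (\<sigma> * \<delta> / 4) / \<sigma>" using c(2) \<sigma> by (intro divide_right_mono) auto
    also have "\<dots> = \<delta> / 4" using \<sigma> by simp
    finally have "norm s \<le> \<delta> / 4" unfolding ns .
    then have s: "norm s < \<delta> / 2" using \<delta> by linarith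
    have s2: "of_nat n * (of_real \<sigma>2 * s\<^sup>2 / 2) = of_real (- (t\<^sup>2) / 2)"
    proof -
      have "of_nat n * (of_real \<sigma>2 * s\<^sup>2 / 2) = of_real (q\<^sup>2 * (\<sigma>\<^sup>2 * (- ((t / (\<sigma> * q))\<^sup>2)) / 2))"
      proof -
        have "s\<^sup>2 = of_real (- ((t / (\<sigma> * q))\<^sup>2))" by (simp add: s_def power_mult_distrib power_divide)
        then show ?thesis by (simp add: q(2) \<sigma>(2))
      qed
      also have "q\<^sup>2 * (\<sigma>\<^sup>2 * (- ((t / (\<sigma> * q))\<^sup>2)) / 2) = - (t\<^sup>2) / 2"
        using q(1) \<sigma>(1) by (simp add: power_divide power_mult_distrib)
      finally show ?thesis .
    qed
    define w where "w = of_nat n * (L s - of_real \<sigma>2 * s\<^sup>2 / 2)"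
    have nL: "of_nat n * L s = of_real (- (t\<^sup>2) / 2) + w"
      unfolding s2[symmetric] w_def by (simp add: algebra_simps)
    have w: "norm w \<le> \<kappa> * \<bar>t\<bar> ^ 3 / q"
    proof -
      have "norm w \<le> real n * (K * norm s ^ 3)"
        unfolding w_def norm_mult using K(2)[of s] s by (simp add: mult_left_mono)
      also have "\<dots> = \<kappa> * \<bar>t\<bar> ^ 3 / q"
        unfolding ns q(2)[symmetric] \<kappa>_def using q(1) \<sigma>(1)
        by (simp add: field_simps power2_eq_square power3_eq_cube)
      finally show ?thesis .
    qed
    have w4: "norm w \<le> t\<^sup>2 / 4"
    proof -
      have "\<kappa> * \<bar>t\<bar> ^ 3 / q = \<kappa> * (\<bar>t\<bar> / q) * t\<^sup>2"
        by (simp add: power3_eq_cube power2_eq_square)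
      also have "\<dots> \<le> \<kappa> * c * t\<^sup>2"
        using t q \<kappa> by (intro mult_right_mono mult_left_mono) (auto simp: q_def divide_le_eq)
      also have "\<dots> \<le> 1 / 4 * t\<^sup>2" using c(3) by (intro mult_right_mono) auto
      finally have "\<kappa> * \<bar>t\<bar> ^ 3 / q \<le> 1 / 4 * t\<^sup>2" .
      from order_trans[OF w this] show ?thesis by simp
    qed
    have e4: "exp (- (t\<^sup>2) / 2) * exp (norm w) \<le> exp (- t\<^sup>2 / 4)"
    proof -
      have "- (t\<^sup>2) / 2 + norm w \<le> - t\<^sup>2 / 4" using w4 by simp
      then show ?thesis by (simp flip: exp_add)
    qed
    have e1: "norm (exp (of_nat n * L s)) \<le> exp (- t\<^sup>2 / 4)"
    proof -
      have "norm (exp (of_nat n * L s)) = exp (- (t\<^sup>2) / 2) * norm (exp w)"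
        unfolding nL exp_add norm_mult exp_of_real norm_of_real by simp
      also have "\<dots> \<le> exp (- (t\<^sup>2) / 2) * exp (norm w)"
        using norm_exp[of w] by (intro mult_left_mono) auto
      finally show ?thesis using e4 by (rule order_trans)
    qed
    have e2: "norm (exp (of_nat n * L s) - of_real (exp (- (t\<^sup>2) / 2))) \<le> exp (- t\<^sup>2 / 4) * (\<kappa> * \<bar>t\<bar> ^ 3 / q)"
    proof -
      have "exp (of_nat n * L s) - of_real (exp (- (t\<^sup>2) / 2)) = of_real (exp (- (t\<^sup>2) / 2)) * (exp w - 1)"
        unfolding nL exp_add exp_of_real by (simp add: algebra_simps)
      then have "norm (exp (of_nat n * L s) - of_real (exp (- (t\<^sup>2) / 2))) = exp (- (t\<^sup>2) / 2) * norm (exp w - 1)"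
        by (simp only: norm_mult norm_of_real) simp
      also have "\<dots> \<le> exp (- (t\<^sup>2) / 2) * (norm w * exp (norm w))"
        using norm_exp_minus_one_le by (intro mult_left_mono) auto
      also have "\<dots> = exp (- (t\<^sup>2) / 2) * exp (norm w) * norm w" by simp
      also have "\<dots> \<le> exp (- t\<^sup>2 / 4) * (\<kappa> * \<bar>t\<bar> ^ 3 / q)"
        using e4 w by (intro mult_mono) auto
      finally show ?thesis .
    qed
    have e3: "norm (\<Psi> n s - 1) \<le> C / (\<delta> / 2) / \<sigma> * \<bar>t\<bar> / q"
      using \<Psi>_diff_le[OF n s] by (simp add: ns)
    have "iexp (t * (Y n a / sqrt (\<sigma>2 * real n))) = exp (s * of_real (Y n a))" for a
      by (simp add: s_def \<sigma>_def q_def real_sqrt_mult mult_ac)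
    then have "\<E> n (\<lambda>a. iexp (t * (Y n a / sqrt (\<sigma>2 * real n)))) = exp (of_nat n * L s) * \<Psi> n s"
      using mgf_Y[OF n, of s] by simp
    then have "norm (\<E> n (\<lambda>a. iexp (t * (Y n a / sqrt (\<sigma>2 * real n)))) - of_real (exp (- (t\<^sup>2) / 2)))
      = norm (exp (of_nat n * L s) * (\<Psi> n s - 1) + (exp (of_nat n * L s) - of_real (exp (- (t\<^sup>2) / 2))))"
      by (simp add: algebra_simps)
    also have "\<dots> \<le> norm (exp (of_nat n * L s)) * norm (\<Psi> n s - 1) + norm (exp (of_nat n * L s) - of_real (exp (- (t\<^sup>2) / 2)))"
      by (rule order_trans[OF norm_triangle_ineq]) (simp add: norm_mult)
    also have "\<dots> \<le> exp (- t\<^sup>2 / 4) * (C / (\<delta> / 2) / \<sigma> * \<bar>t\<bar> / q) + exp (- t\<^sup>2 / 4) * (\<kappa> * \<bar>t\<bar> ^ 3 / q)"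
      using e1 e2 e3 by (intro add_mono mult_mono) auto
    also have "\<dots> = \<bar>t\<bar> * (exp (- t\<^sup>2 / 4) / q) * (C / (\<delta> / 2) / \<sigma> + \<kappa> * t\<^sup>2)"
      by (simp add: power3_eq_cube power2_eq_square algebra_simps add_divide_distrib)
    also have "\<dots> \<le> \<bar>t\<bar> * (exp (- t\<^sup>2 / 4) / q) * (D * (1 + t\<^sup>2))"
    proof (rule mult_left_mono)
      have "0 \<le> C / (\<delta> / 2) / \<sigma> * t\<^sup>2" using C_nonneg \<delta> \<sigma> by simp
      then show "C / (\<delta> / 2) / \<sigma> + \<kappa> * t\<^sup>2 \<le> D * (1 + t\<^sup>2)"
        using \<kappa> unfolding D_def distrib_right distrib_left by simp
    qed (use q in auto)
    finally show "norm (\<E> n (\<lambda>a. iexp (t * (Y n a / sqrt (\<sigma>2 * real n)))) - of_real (exp (- (t\<^sup>2) / 2)))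
      \<le> \<bar>t\<bar> * (D / sqrt (real n) * ((1 + t\<^sup>2) * exp (- t\<^sup>2 / 4)))"
      by (simp add: q_def mult_ac)
  qed
qed

text \<open>The smoothing inequality is used with T = c sqrt n and g of order n^(-1/2) times a fixed
  integrable function, so both of its terms have order n^(-1/2).\<close>

theorem berry_esseen:
  assumes \<sigma>2: "\<sigma>2 > 0"
  obtains B where "\<And>n x. n \<ge> 1 \<Longrightarrow>
    \<bar>measure_pmf.prob (p n) {a. Y n a / sqrt (\<sigma>2 * real n) \<le> x} - cdf std_normal_distribution x\<bar> \<le> B / sqrt (real n)"
proof -
  obtain c D where c: "c > 0" and D: "D > 0" and char_le: "\<And>n t. n \<ge> 1 \<Longrightarrow> \<bar>t\<bar> \<le> c * sqrt (real n) \<Longrightarrow>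
      norm (\<E> n (\<lambda>a. iexp (t * (Y n a / sqrt (\<sigma>2 * real n)))) - of_real (exp (- (t\<^sup>2) / 2)))
      \<le> \<bar>t\<bar> * (D / sqrt (real n) * ((1 + t\<^sup>2) * exp (- t\<^sup>2 / 4)))"
    using char_diff_le[OF \<sigma>2] by blast
  obtain E where E: "E > 0" "\<And>M T g x. real_distribution M \<Longrightarrow> integrable M (\<lambda>x. x) \<Longrightarrow> T > 0 \<Longrightarrow>
     integrable lborel g \<Longrightarrow> (\<forall>t. g t \<ge> 0) \<Longrightarrow>
     (\<forall>t. \<bar>t\<bar> \<le> T \<longrightarrow> norm (char M t - char std_normal_distribution t) \<le> \<bar>t\<bar> * g t) \<Longrightarrow>
     \<bar>cdf M x - cdf std_normal_distribution x\<bar> \<le> E * ((LINT t|lborel. g t) + 1 / T)"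
    using esseen_smoothing by metis
  define J where "J = (LINT t|lborel. (1 + t\<^sup>2) * exp (- t\<^sup>2 / 4 :: real))"
  show ?thesis
  proof (rule that[of "E * (D * J + 1 / c)"])
    fix n :: nat and x :: real assume n: "n \<ge> 1"
    define Z where "Z = (\<lambda>a. Y n a / sqrt (\<sigma>2 * real n))"
    define M where "M = distr (measure_pmf (p n)) borel Z"
    have M: "real_distribution M"
      unfolding M_def by (rule prob_space.real_distribution_distr[OF measure_pmf.prob_space_axioms]) simp
    have int: "Bochner_Integration.integrable M (\<lambda>x. x)"
      unfolding M_def using n by (subst integrable_distr_eq) auto
    have char: "char M t = \<E> n (\<lambda>a. iexp (t * Z a))" for t
      unfolding char_def M_def by (subst integral_distr) auto
    have cdf: "cdf M x = measure_pmf.prob (p n) {a. Z a \<le> x}"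
      unfolding cdf_def M_def by (subst measure_distr) (auto simp: vimage_def)
    have "\<bar>cdf M x - cdf std_normal_distribution x\<bar> \<le>
        E * ((LINT t|lborel. D / sqrt (real n) * ((1 + t\<^sup>2) * exp (- t\<^sup>2 / 4))) + 1 / (c * sqrt (real n)))"
      using n c D char_le[OF n] integrable_gaussian_quadratic
      by (intro E(2) M int) (auto simp: char Z_def char_std_normal_distribution)
    also have "(LINT t|lborel. D / sqrt (real n) * ((1 + t\<^sup>2) * exp (- t\<^sup>2 / 4))) = D / sqrt (real n) * J"
      unfolding J_def by (rule integral_mult_right_zero)
    also have "E * (D / sqrt (real n) * J + 1 / (c * sqrt (real n))) = E * (D * J + 1 / c) / sqrt (real n)"
      by (simp add: add_divide_distrib distrib_left)
    finally show "\<bar>measure_pmf.prob (p n) {a. Y n a / sqrt (\<sigma>2 * real n) \<le> x} - cdf std_normal_distribution x\<bar> \<le> E * (D * J + 1 / c) / sqrt (real n)"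
      unfolding cdf Z_def .
  qed
qed

end

lemma cdf_std_normal_eq: "cdf std_normal_distribution x = 1 / sqrt (2 * pi) * (LBINT t:{..x}. exp (- (t ^ 2) / 2))"
proof -
  interpret N: real_distribution std_normal_distribution by (rule real_dist_normal_dist)
  have "cdf std_normal_distribution x = (LINT t|std_normal_distribution. indicator {..x} t)"
    by (simp add: cdf_def)
  also have "\<dots> = (LINT t|lborel. std_normal_density t * indicator {..x} t)"
    by (subst integral_density) auto
  also have "\<dots> = (LINT t|lborel. 1 / sqrt (2 * pi) * (indicator {..x} t * exp (- (t ^ 2) / 2)))"
    by (rule Bochner_Integration.integral_cong) (auto simp: std_normal_density_def)
  also have "\<dots> = 1 / sqrt (2 * pi) * (LINT t|lborel. indicator {..x} t * exp (- (t ^ 2) / 2))"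
    by (rule integral_mult_right_zero)
  finally show ?thesis by (simp add: set_lebesgue_integral_def)
qed

subsection \<open>Factorial moments\<close>

lemma bigo_powr_mult:
  fixes f g :: "nat \<Rightarrow> real"
  assumes "f \<in> O(\<lambda>n. real n powr a)" "g \<in> O(\<lambda>n. real n powr b)"
  shows "(\<lambda>n. f n * g n) \<in> O(\<lambda>n. real n powr (a + b))"
  using landau_o.big.mult[OF assms] by (simp only: powr_add)

lemma bigo_powr_mono:
  fixes f :: "nat \<Rightarrow> real"
  assumes "f \<in> O(\<lambda>n. real n powr a)" "a \<le> b"
  shows "f \<in> O(\<lambda>n. real n powr b)"
proof (rule landau_o.big_trans[OF assms(1)], rule bigoI[where c = 1])
  show "eventually (\<lambda>n. norm (real n powr a) \<le> 1 * norm (real n powr b)) at_top"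
    using eventually_ge_at_top[of "1 :: nat"] by eventually_elim (use assms(2) in \<open>simp add: powr_mono\<close>)
qed

lemma bigo_powrI:
  fixes f :: "nat \<Rightarrow> real"
  assumes "\<And>n. n \<ge> 1 \<Longrightarrow> \<bar>f n\<bar> \<le> B * real n powr a"
  shows "f \<in> O(\<lambda>n. real n powr a)"
proof (rule bigoI[where c = B])
  show "eventually (\<lambda>n. norm (f n) \<le> B * norm (real n powr a)) at_top"
    using eventually_ge_at_top[of "1 :: nat"] by eventually_elim (use assms in simp)
qed

lemma bigo_scaled_power: "(\<lambda>n. (c * real n) ^ k) \<in> O(\<lambda>n. real n powr real k)"
proof (rule bigo_powrI[where B = "\<bar>c\<bar> ^ k"])
  fix n :: nat assume "n \<ge> 1"
  then have "real n powr real k = real n ^ k" by (intro powr_realpow) simp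
  then show "\<bar>(c * real n) ^ k\<bar> \<le> \<bar>c\<bar> ^ k * real n powr real k"
    by (simp only: power_abs abs_mult power_mult_distrib abs_of_nat order_refl)
qed

text \<open>The remainder has order x^(d - 2). Multiplying by (1 + x)^2 avoids a truncated or
  negative exponent, so that the induction can start at d = 0; 1 + x instead of x keeps the bound
  meaningful near x = 0.\<close>

lemma falling_factorial_approx:
  "\<exists>B\<ge>0. \<forall>x\<ge>0. \<bar>falling_factorial x d - (x ^ d - real d * (real d - 1) / 2 * x ^ (d - 1))\<bar> * (1 + x)\<^sup>2 \<le> B * (1 + x) ^ d"
proof (induction d)
  case 0
  then show ?case by (intro exI[of _ 0]) (simp add: falling_factorial_def)
next
  case (Suc d)
  then obtain B where B: "B \<ge> 0" "\<And>x. x \<ge> 0 \<Longrightarrow>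
      \<bar>falling_factorial x d - (x ^ d - real d * (real d - 1) / 2 * x ^ (d - 1))\<bar> * (1 + x)\<^sup>2 \<le> B * (1 + x) ^ d"
    by blast
  define q where "q = real d * (real d * (real d - 1) / 2)"
  have q: "q \<ge> 0" by (cases d) (auto simp: q_def)
  show ?case
  proof (intro exI[of _ "q + B * (1 + real d)"] conjI allI impI)
    show "q + B * (1 + real d) \<ge> 0" using q B(1) by simp
    fix x :: real assume x: "x \<ge> 0"
    define R where "R = falling_factorial x d - (x ^ d - real d * (real d - 1) / 2 * x ^ (d - 1))"
    have ff: "falling_factorial x (Suc d) = falling_factorial x d * (x - real d)"
      by (simp add: falling_factorial_def)
    define k where "k = real d * (real d - 1) / 2"
    define y where "y = x ^ (d - 1)"
    have pw: "k * (y * x) = k * x ^ d"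
      by (cases d) (auto simp: k_def y_def)
    have eq: "falling_factorial x (Suc d) - (x ^ Suc d - real (Suc d) * (real (Suc d) - 1) / 2 * x ^ (Suc d - 1)) = q * x ^ (d - 1) + R * (x - real d)"
    proof -
      have "falling_factorial x (Suc d) = (x ^ d - k * y + R) * (x - real d)"
        by (simp add: ff R_def k_def y_def)
      also have "\<dots> = x ^ Suc d - real d * x ^ d - k * (y * x) + real d * k * y + R * (x - real d)"
        by (simp add: algebra_simps)
      also have "\<dots> = x ^ Suc d - (real d + k) * x ^ d + q * y + R * (x - real d)"
        unfolding pw by (simp add: q_def k_def distrib_right)
      also have "real d + k = real (Suc d) * (real (Suc d) - 1) / 2"
        by (simp add: k_def field_simps)
      finally show ?thesis by (simp add: y_def)
    qed
    have 1: "q * x ^ (d - 1) * (1 + x)\<^sup>2 \<le> q * (1 + x) ^ Suc d"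
    proof (cases d)
      case 0
      then show ?thesis by (simp add: q_def)
    next
      case (Suc e)
      have "x ^ e * (1 + x)\<^sup>2 \<le> (1 + x) ^ e * (1 + x)\<^sup>2" using x by (intro mult_right_mono power_mono) auto
      also have "\<dots> = (1 + x) ^ Suc d" by (simp add: Suc power2_eq_square)
      finally show ?thesis using q by (simp add: Suc mult.assoc mult_left_mono)
    qed
    have 2: "\<bar>R * (x - real d)\<bar> * (1 + x)\<^sup>2 \<le> B * (1 + real d) * (1 + x) ^ Suc d"
    proof -
      have R: "\<bar>R\<bar> * (1 + x)\<^sup>2 \<le> B * (1 + x) ^ d" using B(2)[OF x] by (simp only: R_def)
      have "\<bar>x - real d\<bar> \<le> (1 + real d) * (1 + x)" using x by (simp add: abs_le_iff algebra_simps)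
      then have "(\<bar>R\<bar> * (1 + x)\<^sup>2) * \<bar>x - real d\<bar> \<le> (B * (1 + x) ^ d) * ((1 + real d) * (1 + x))"
        using B(1) x by (intro mult_mono[OF R]) auto
      then show ?thesis by (simp add: abs_mult mult_ac)
    qed
    have "\<bar>q * x ^ (d - 1) + R * (x - real d)\<bar> * (1 + x)\<^sup>2 \<le> (q * x ^ (d - 1) + \<bar>R * (x - real d)\<bar>) * (1 + x)\<^sup>2"
      using q x by (intro mult_right_mono order_trans[OF abs_triangle_ineq]) auto
    also have "\<dots> \<le> q * (1 + x) ^ Suc d + B * (1 + real d) * (1 + x) ^ Suc d"
      using add_mono[OF 1 2] by (simp only: distrib_right)
    also have "\<dots> = (q + B * (1 + real d)) * (1 + x) ^ Suc d" by (simp only: distrib_right)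
    finally show "\<bar>falling_factorial x (Suc d) - (x ^ Suc d - real (Suc d) * (real (Suc d) - 1) / 2 * x ^ (Suc d - 1))\<bar> * (1 + x)\<^sup>2
        \<le> (q + B * (1 + real d)) * (1 + x) ^ Suc d"
      unfolding eq .
  qed
qed

context quasi_power
begin

lemma moment_bigo: "(\<lambda>n. \<E> n (\<lambda>a. Y n a ^ j)) \<in> O(\<lambda>n. real n powr (real j / 2))"
proof -
  obtain B where B: "\<And>n. n \<ge> 1 \<Longrightarrow> \<E> n (\<lambda>a. \<bar>Y n a\<bar> ^ j) \<le> B * real n powr (real j / 2)"
    using abs_moment_le[of j] by blast
  show ?thesis
  proof (rule bigo_powrI)
    fix n :: nat assume n: "n \<ge> 1"
    have "\<bar>\<E> n (\<lambda>a. Y n a ^ j)\<bar> \<le> \<E> n (\<lambda>a. \<bar>Y n a\<bar> ^ j)"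
      using integral_norm_bound[of "measure_pmf (p n)" "\<lambda>a. Y n a ^ j"] by (simp add: power_abs)
    also have "\<dots> \<le> B * real n powr (real j / 2)" by (rule B[OF n])
    finally show "\<bar>\<E> n (\<lambda>a. Y n a ^ j)\<bar> \<le> B * real n powr (real j / 2)" .
  qed
qed

text \<open>Binomial expansion around \<mu> n. The term of index j has order n^(d - j) n^(j / 2) =
  n^(d - j / 2), so j >= 3 produces the error exponent d - 3/2.\<close>

lemma power_moment_expansion:
  "(\<lambda>n. \<E> n (\<lambda>a. X a ^ d) - ((\<mu> * real n) ^ d
      + real d * (\<mu> * real n) ^ (d - 1) * \<E> n (Y n)
      + real (d choose 2) * (\<mu> * real n) ^ (d - 2) * \<E> n (\<lambda>a. (Y n a)\<^sup>2)))
    \<in> O(\<lambda>n. real n powr (real d - 3 / 2))"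
proof -
  let ?c = "\<lambda>n j. real (d choose j) * (\<mu> * real n) ^ (d - j) * \<E> n (\<lambda>a. Y n a ^ j)"
  have tail: "(\<lambda>n. \<Sum>j\<in>{3..d + 2}. ?c n j) \<in> O(\<lambda>n. real n powr (real d - 3 / 2))"
  proof (rule big_sum_in_bigo)
    fix j assume j: "j \<in> {3..d + 2}"
    show "(\<lambda>n. ?c n j) \<in> O(\<lambda>n. real n powr (real d - 3 / 2))"
    proof (cases "j \<le> d")
      case True
      have "(\<lambda>n. (\<mu> * real n) ^ (d - j) * \<E> n (\<lambda>a. Y n a ^ j)) \<in> O(\<lambda>n. real n powr (real (d - j) + real j / 2))"
        by (intro bigo_powr_mult bigo_scaled_power moment_bigo)
      then have "(\<lambda>n. (\<mu> * real n) ^ (d - j) * \<E> n (\<lambda>a. Y n a ^ j)) \<in> O(\<lambda>n. real n powr (real d - 3 / 2))"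
        by (rule bigo_powr_mono) (use True j in \<open>simp add: of_nat_diff\<close>)
      then show ?thesis by (simp add: mult.assoc)
    qed (simp add: binomial_eq_0)
  qed
  let ?lead = "\<lambda>n. (\<mu> * real n) ^ d
      + real d * (\<mu> * real n) ^ (d - 1) * \<E> n (Y n)
      + real (d choose 2) * (\<mu> * real n) ^ (d - 2) * \<E> n (\<lambda>a. (Y n a)\<^sup>2)"
  have "eventually (\<lambda>n. (\<Sum>j\<in>{3..d + 2}. ?c n j) = \<E> n (\<lambda>a. X a ^ d) - ?lead n) at_top"
    using eventually_ge_at_top[of "1 :: nat"]
  proof eventually_elim
    case (elim n)
    have "\<E> n (\<lambda>a. X a ^ d) = \<E> n (\<lambda>a. (Y n a + \<mu> * real n) ^ d)"
      by (simp add: Y_def)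
    also have "\<dots> = \<E> n (\<lambda>a. \<Sum>j\<le>d. real (d choose j) * (\<mu> * real n) ^ (d - j) * Y n a ^ j)"
      unfolding binomial_ring by (intro Bochner_Integration.integral_cong sum.cong refl) (rule mult.assoc[THEN trans], subst mult.commute[of "Y n _ ^ _"], rule mult.assoc[symmetric])
    also have "\<dots> = (\<Sum>j\<le>d. ?c n j)"
      using elim by simp
    \<comment> \<open>Padding with vanishing binomial coefficients lets the indices 0, 1, 2 be split
      off even when d < 2.\<close>
    also have "\<dots> = (\<Sum>j\<le>d + 2. ?c n j)"
      by (intro sum.mono_neutral_left) (auto simp: binomial_eq_0)
    also have "{..d + 2} = {0, 1, 2} \<union> {3..d + 2}" by auto
    also have "(\<Sum>j\<in>\<dots>. ?c n j) = (\<Sum>j\<in>{0, 1, 2}. ?c n j) + (\<Sum>j\<in>{3..d + 2}. ?c n j)"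
      by (intro sum.union_disjoint) auto
    also have "(\<Sum>j\<in>{0, 1, 2}. ?c n j) = ?lead n" by simp
    finally show ?case by simp
  qed
  from landau_o.big.in_cong[OF this] show ?thesis using tail by (rule iffD1)
qed

text \<open>Meant for exponent d - 1 in the correction term of the falling factorial, where its
  error n^(d - 2) lies below n^(d - 3/2).\<close>

lemma power_moment_leading:
  assumes "d \<ge> 1"
  shows "(\<lambda>n. \<E> n (\<lambda>a. X a ^ d) - (\<mu> * real n) ^ d) \<in> O(\<lambda>n. real n powr (real d - 1))"
proof -
  have 1: "(\<lambda>n. real d * ((\<mu> * real n) ^ (d - 1) * \<E> n (Y n))) \<in> O(\<lambda>n. real n powr (real d - 1))"
  proof -
    have "(\<lambda>n. \<E> n (Y n)) \<in> O(\<lambda>n. real n powr 0)"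
      by (rule bigo_powrI[where B = "C / (\<delta> / 2)"]) (use expectation_Y_le(1) in simp)
    from bigo_powr_mult[OF bigo_scaled_power this, of \<mu> "d - 1"] assms
    have "(\<lambda>n. (\<mu> * real n) ^ (d - 1) * \<E> n (Y n)) \<in> O(\<lambda>n. real n powr (real d - 1))"
      by (simp add: of_nat_diff)
    then show ?thesis by simp
  qed
  have 2: "(\<lambda>n. real (d choose 2) * ((\<mu> * real n) ^ (d - 2) * \<E> n (\<lambda>a. (Y n a)\<^sup>2))) \<in> O(\<lambda>n. real n powr (real d - 1))"
  proof (cases "d \<ge> 2")
    case True
    from bigo_powr_mult[OF bigo_scaled_power moment_bigo, of \<mu> "d - 2" 2] True
    have "(\<lambda>n. (\<mu> * real n) ^ (d - 2) * \<E> n (\<lambda>a. (Y n a)\<^sup>2)) \<in> O(\<lambda>n. real n powr (real d - 1))"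
      by (simp add: of_nat_diff)
    then show ?thesis by simp
  qed (simp add: binomial_eq_0)
  have 3: "(\<lambda>n. \<E> n (\<lambda>a. X a ^ d) - ((\<mu> * real n) ^ d
      + real d * (\<mu> * real n) ^ (d - 1) * \<E> n (Y n)
      + real (d choose 2) * (\<mu> * real n) ^ (d - 2) * \<E> n (\<lambda>a. (Y n a)\<^sup>2)))
    \<in> O(\<lambda>n. real n powr (real d - 1))"
    by (rule bigo_powr_mono[OF power_moment_expansion]) simp
  from sum_in_bigo(1)[OF sum_in_bigo(1)[OF 3 1] 2] show ?thesis
    by (simp add: algebra_simps)
qed

end

subsection \<open>Application to path-cut trees\<close>

lemma path_cut_size_le: "path_cut_size r t \<le> num_nodes t"
proof (induction t rule: num_nodes.induct)
  case (1 ts)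
  then have "(\<Sum>t\<leftarrow>ts. path_cut_size r t) \<le> (\<Sum>t\<leftarrow>ts. num_nodes t)" by (intro sum_list_mono) auto
  then show ?case by (simp add: path_cut_size_Node)
qed

lemma set_random_plane_tree: "n \<ge> 1 \<Longrightarrow> set_pmf (random_plane_tree n) = plane_trees n"
  unfolding random_plane_tree_def using plane_trees_nonempty finite_plane_trees by (simp add: set_pmf_of_set)

lemma expectation_random_plane_tree:
  fixes f :: "plane_tree \<Rightarrow> 'b::{banach, second_countable_topology}"
  assumes "n \<ge> 1"
  shows "measure_pmf.expectation (random_plane_tree n) f = (1 / real (card (plane_trees n))) *\<^sub>R (\<Sum>t\<in>plane_trees n. f t)"
proof -
  have "measure_pmf.expectation (random_plane_tree n) f = (\<Sum>t\<in>plane_trees n. pmf (random_plane_tree n) t *\<^sub>R f t)"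
    using assms by (intro integral_measure_pmf finite_plane_trees) (simp add: set_random_plane_tree)
  also have "\<dots> = (\<Sum>t\<in>plane_trees n. (1 / real (card (plane_trees n))) *\<^sub>R f t)"
  proof (rule sum.cong)
    fix t assume "t \<in> plane_trees n"
    then have "pmf (random_plane_tree n) t = 1 / real (card (plane_trees n))"
      by (simp only: random_plane_tree_def pmf_of_set[OF plane_trees_nonempty[OF assms] finite_plane_trees] indicator_simps)
    then show "pmf (random_plane_tree n) t *\<^sub>R f t = (1 / real (card (plane_trees n))) *\<^sub>R f t" by (simp only:)
  qed (rule refl)
  finally show ?thesis by (simp only: scaleR_right.sum)
qed

lemma quasi_power_path_cut_size:
  fixes r :: nat
  defines "m \<equiv> 2 ^ (r + 1) - 1 :: real"
  obtains \<Lambda> \<delta> C where "quasi_power random_plane_tree (\<lambda>t. real (path_cut_size r t)) \<Lambda> \<delta> C (1 / m) ((m\<^sup>2 - 1) / (6 * m\<^sup>2))"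
proof -
  obtain \<delta> \<Lambda> C where *: "\<delta> > 0" "\<Lambda> holomorphic_on ball 0 \<delta>" "\<Lambda> 0 = 0"
    "deriv \<Lambda> 0 = of_real (1 / m)" "deriv (deriv \<Lambda>) 0 = of_real ((m\<^sup>2 - 1) / (6 * m\<^sup>2))"
    "\<And>n s. n \<ge> 1 \<Longrightarrow> norm s < \<delta> \<Longrightarrow> norm (size_mgf r n s * exp (- of_nat n * \<Lambda> s)) \<le> C"
    by (rule size_mgf_quasi_power[of r, folded m_def], rule that)
  have mgf: "measure_pmf.expectation (random_plane_tree n) (\<lambda>t. exp (s * of_real (real (path_cut_size r t)))) = size_mgf r n s"
    if "n \<ge> 1" for n s
    using that by (simp add: expectation_random_plane_tree size_mgf_def scaleR_conv_of_real)
  show ?thesis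
  proof (rule that[of \<Lambda> \<delta> C], unfold_locales)
    show "finite (set_pmf (random_plane_tree n))" if "n \<ge> 1" for n
      using that by (simp add: set_random_plane_tree finite_plane_trees)
    show "norm (measure_pmf.expectation (random_plane_tree n) (\<lambda>t. exp (s * of_real (real (path_cut_size r t)))) *
        exp (- of_nat n * \<Lambda> s)) \<le> C" if "n \<ge> 1" "norm s < \<delta>" for n s
      unfolding mgf[OF that(1)] by (rule *(6)[OF that])
  qed (use * in auto)
qed

text \<open>As the size is at most n >= 1, the pointwise remainder of order d - 2 is at most a
  constant times (2 n)^(d - 2).\<close>

lemma falling_factorial_moment_approx:
  assumes "d \<ge> 2"
  shows "(\<lambda>n. measure_pmf.expectation (random_plane_tree n) (\<lambda>t. falling_factorial (real (path_cut_size r t)) d)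
      - (measure_pmf.expectation (random_plane_tree n) (\<lambda>t. real (path_cut_size r t) ^ d)
        - real d * (real d - 1) / 2 * measure_pmf.expectation (random_plane_tree n) (\<lambda>t. real (path_cut_size r t) ^ (d - 1))))
    \<in> O(\<lambda>n. real n powr (real d - 3 / 2))"
proof -
  obtain e where e: "d = Suc (Suc e)" using that[of "d - 2"] assms by simp
  obtain B where B: "B \<ge> 0" "\<And>x. x \<ge> 0 \<Longrightarrow>
      \<bar>falling_factorial x d - (x ^ d - real d * (real d - 1) / 2 * x ^ (d - 1))\<bar> * (1 + x)\<^sup>2 \<le> B * (1 + x) ^ d"
    using falling_factorial_approx by blast
  let ?E = "\<lambda>n. measure_pmf.expectation (random_plane_tree n)"
  let ?x = "\<lambda>t. real (path_cut_size r t)"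
  let ?R = "\<lambda>x. falling_factorial x d - (x ^ d - real d * (real d - 1) / 2 * x ^ (d - 1))"
  have R_le: "\<bar>?R x\<bar> \<le> B * (1 + x) ^ e" if "x \<ge> 0" for x
  proof -
    have "\<bar>?R x\<bar> * (1 + x)\<^sup>2 \<le> B * (1 + x) ^ e * (1 + x)\<^sup>2"
      using B(2)[OF that] by (simp add: e power2_eq_square mult_ac)
    then show ?thesis using that by (simp only: mult_le_cancel_right_pos zero_less_power add_pos_nonneg zero_less_one)
  qed
  have "(\<lambda>n. ?E n (\<lambda>t. falling_factorial (?x t) d) - (?E n (\<lambda>t. ?x t ^ d) - real d * (real d - 1) / 2 * ?E n (\<lambda>t. ?x t ^ (d - 1))))
      \<in> O(\<lambda>n. real n powr real e)"
  proof (rule bigo_powrI[where B = "B * 2 ^ e"])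
    fix n :: nat assume n: "n \<ge> 1"
    have int: "integrable (measure_pmf (random_plane_tree n)) f" for f :: "plane_tree \<Rightarrow> real"
      using n by (intro integrable_measure_pmf_finite) (simp add: set_random_plane_tree finite_plane_trees)
    have eq: "?E n (\<lambda>t. falling_factorial (?x t) d) - (?E n (\<lambda>t. ?x t ^ d) - real d * (real d - 1) / 2 * ?E n (\<lambda>t. ?x t ^ (d - 1)))
        = ?E n (\<lambda>t. ?R (?x t))"
      by (simp add: int)
    have "\<bar>?E n (\<lambda>t. ?R (?x t))\<bar> \<le> ?E n (\<lambda>t. \<bar>?R (?x t)\<bar>)"
      using integral_norm_bound[of "measure_pmf (random_plane_tree n)" "\<lambda>t. ?R (?x t)"] by simp
    also have "\<dots> \<le> B * (2 * real n) ^ e"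
    proof (intro measure_pmf.integral_le_const int AE_pmfI)
      fix t assume "t \<in> set_pmf (random_plane_tree n)"
      then have "num_nodes t = n" unfolding set_random_plane_tree[OF n] plane_trees_def by (rule CollectD)
      then have "?x t \<le> real n" using path_cut_size_le[of r t] by simp
      then have "B * (1 + ?x t) ^ e \<le> B * (2 * real n) ^ e"
        using n B(1) by (intro mult_left_mono power_mono) auto
      then show "\<bar>?R (?x t)\<bar> \<le> B * (2 * real n) ^ e" using R_le[of "?x t"] by simp
    qed
    also have "\<dots> = B * 2 ^ e * real n powr real e"
      using n by (simp add: power_mult_distrib powr_realpow)
    finally show "\<bar>?E n (\<lambda>t. falling_factorial (?x t) d) - (?E n (\<lambda>t. ?x t ^ d) - real d * (real d - 1) / 2 * ?E n (\<lambda>t. ?x t ^ (d - 1)))\<bar>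
        \<le> B * 2 ^ e * real n powr real e" by (simp only: eq)
  qed
  then show ?thesis by (rule bigo_powr_mono) (simp add: e)
qed

text \<open>Replacing E Y by \<open>a\<close> costs n^(d - 1) n^(-1), and replacing E Y^2 by
  \<open>\<sigma>2 * n\<close> costs n^(d - 2): both lie below the error of the binomial
  expansion.\<close>

lemma (in quasi_power) power_moment_second_order:
  assumes d: "d \<ge> 2" and a: "(\<lambda>n. \<E> n (Y n) - a) \<in> O(\<lambda>n. real n powr (-1))"
  shows "(\<lambda>n. \<E> n (\<lambda>a. X a ^ d) - ((\<mu> * real n) ^ d
      + real d * (\<mu> * real n) ^ (d - 1) * a + real (d choose 2) * (\<mu> * real n) ^ (d - 2) * (\<sigma>2 * real n)))
    \<in> O(\<lambda>n. real n powr (real d - 3 / 2))"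
proof -
  let ?EY = "\<lambda>n. \<E> n (Y n)" and ?EY2 = "\<lambda>n. \<E> n (\<lambda>a. (Y n a)\<^sup>2)"
  have "(\<lambda>n. (\<mu> * real n) ^ (d - 1) * (?EY n - a)) \<in> O(\<lambda>n. real n powr (real d - 3 / 2))"
    by (rule bigo_powr_mono[OF bigo_powr_mult[OF bigo_scaled_power a]]) (use d in \<open>simp add: of_nat_diff\<close>)
  then have 1: "(\<lambda>n. real d * ((\<mu> * real n) ^ (d - 1) * (?EY n - a))) \<in> O(\<lambda>n. real n powr (real d - 3 / 2))" by simp
  have "(\<lambda>n. ?EY2 n - \<sigma>2 * real n) \<in> O(\<lambda>n. real n powr 0)"
    by (rule bigo_powrI[where B = "2 * C / (\<delta> / 2)\<^sup>2"]) (use expectation_Y_le(2) in simp)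
  from bigo_powr_mono[OF bigo_powr_mult[OF bigo_scaled_power this], of "d - 2" "real d - 3 / 2" \<mu>] d
  have "(\<lambda>n. (\<mu> * real n) ^ (d - 2) * (?EY2 n - \<sigma>2 * real n)) \<in> O(\<lambda>n. real n powr (real d - 3 / 2))"
    by (simp add: of_nat_diff)
  then have 2: "(\<lambda>n. real (d choose 2) * ((\<mu> * real n) ^ (d - 2) * (?EY2 n - \<sigma>2 * real n))) \<in> O(\<lambda>n. real n powr (real d - 3 / 2))" by simp
  from sum_in_bigo(1)[OF sum_in_bigo(1)[OF power_moment_expansion 1] 2] show ?thesis
    by (simp add: algebra_simps)
qed

text \<open>Here \<open>m = 2\<^sup>r\<^sup>+\<^sup>1 - 1\<close>, and \<open>a\<close> is the constant term of the expected size.\<close>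

lemma second_order_coefficient:
  fixes m a :: real and d n :: nat
  assumes m: "m > 0" and d: "d \<ge> 2"
  defines "a \<equiv> - ((m - 1) * (m - 2) / (6 * m))"
  shows "(1 / m * real n) ^ d + real d * (1 / m * real n) ^ (d - 1) * a
      + real (d choose 2) * (1 / m * real n) ^ (d - 2) * ((m\<^sup>2 - 1) / (6 * m\<^sup>2) * real n)
      - real d * (real d - 1) / 2 * (1 / m * real n) ^ (d - 1)
    = real n ^ d / m ^ d + real d / (12 * m ^ d)
        * ((m + 1)\<^sup>2 * real d - 8 * (m + 1) * real d - 3 * (m + 1)\<^sup>2 + 18 * (m + 1) + 6 * real d - 18) * real n ^ (d - 1)"
proof -
  obtain e where e: "d = Suc (Suc e)" using that[of "d - 2"] d by simp
  define b where "b = (m + 1)\<^sup>2 * real d - 8 * (m + 1) * real d - 3 * (m + 1)\<^sup>2 + 18 * (m + 1) + 6 * real d - 18"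
  define w where "w = 1 / m * real n"
  define h where "h = (m\<^sup>2 - 1) / (6 * m)"
  have ch: "real (d choose 2) = real d * (real d - 1) / 2"
    unfolding e choose_two by (simp add: real_of_nat_div field_simps)
  \<comment> \<open>The three contributions to the order n^(d - 1): the constant term of the mean,
    the variance, and the correction from powers to falling factorials.\<close>
  have br: "a + (real d - 1) / 2 * h - (real d - 1) / 2 = b / (12 * m)"
    using m by (simp add: a_def b_def h_def field_simps power2_eq_square)
  have s: "(m\<^sup>2 - 1) / (6 * m\<^sup>2) * real n = w * h"
    by (simp add: w_def h_def power2_eq_square mult_ac)
  have "(1 / m * real n) ^ d + real d * (1 / m * real n) ^ (d - 1) * a
      + real (d choose 2) * (1 / m * real n) ^ (d - 2) * ((m\<^sup>2 - 1) / (6 * m\<^sup>2) * real n)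
      - real d * (real d - 1) / 2 * (1 / m * real n) ^ (d - 1)
    = w ^ d + real d * w ^ (d - 1) * a + real (d choose 2) * w ^ (d - 2) * (w * h) - real d * (real d - 1) / 2 * w ^ (d - 1)"
    by (simp only: s w_def[symmetric])
  also have "\<dots> = w ^ d + real d * w ^ (d - 1) * (a + (real d - 1) / 2 * h - (real d - 1) / 2)"
  proof -
    have "D * (w * v) * a + D * (D - 1) / 2 * v * (w * h) - D * (D - 1) / 2 * (w * v)
        = D * (w * v) * (a + (D - 1) / 2 * h - (D - 1) / 2)" for D v :: real
      by (simp add: field_simps)
    from this[of "real d" "w ^ e"] show ?thesis by (simp only: ch) (simp add: e)
  qed
  also have "\<dots> = w ^ d + real d * w ^ (d - 1) * (b / (12 * m))" by (simp only: br)
  also have "w ^ d = real n ^ d / m ^ d" by (simp add: w_def power_divide)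
  also have "real d * w ^ (d - 1) * (b / (12 * m)) = real d / (12 * m ^ d) * b * real n ^ (d - 1)"
    by (simp add: w_def power_divide e mult_ac)
  finally show ?thesis unfolding b_def .
qed

theorem theorem3:
  fixes r :: nat
  shows
    "(\<lambda>n. measure_pmf.expectation (random_plane_tree n) (\<lambda>t. real (path_cut_size r t))
        - (real n / (2 ^ (r + 1) - 1)
           - (2 ^ r - 1) * (2 ^ (r + 1) - 3) / (3 * (2 ^ (r + 1) - 1))))
      \<in> O(\<lambda>n. real n powr (-1))
     \<and>
     (\<lambda>n. measure_pmf.variance (random_plane_tree n) (\<lambda>t. real (path_cut_size r t))
        - 2 ^ (r + 1) * (2 ^ r - 1) / (3 * (2 ^ (r + 1) - 1) ^ 2) * real n)
      \<in> O(\<lambda>n. 1)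
     \<and>
     (\<forall>d::nat. d \<ge> 1 \<longrightarrow>
       (\<lambda>n. measure_pmf.expectation (random_plane_tree n)
               (\<lambda>t. falling_factorial (real (path_cut_size r t)) d)
          - (real n ^ d / (2 ^ (r + 1) - 1) ^ d
             + real d / (12 * (2 ^ (r + 1) - 1) ^ d)
               * (4 ^ (r + 1) * real d - 2 ^ (r + 4) * real d - 3 * 4 ^ (r + 1)
                  + 9 * 2 ^ (r + 2) + 6 * real d - 18)
               * real n ^ (d - 1)))
        \<in> O(\<lambda>n. real n powr (real d - 3 / 2)))
     \<and>
     (r \<ge> 1 \<longrightarrow>
       (\<forall>\<mu> \<sigma>2 :: real.
          \<mu> = 1 / (2 ^ (r + 1) - 1) \<longrightarrow>
          \<sigma>2 = 2 ^ (r + 1) * (2 ^ r - 1) / (3 * (2 ^ (r + 1) - 1) ^ 2) \<longrightarrow>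
          (\<exists>C. \<forall>\<^sub>F n in sequentially. \<forall>x::real.
             \<bar>measure_pmf.prob (random_plane_tree n)
                 {t. (real (path_cut_size r t) - \<mu> * real n) / sqrt (\<sigma>2 * real n) \<le> x}
               - 1 / sqrt (2 * pi) * (LBINT t:{..x}. exp (- (t ^ 2) / 2))\<bar>
             \<le> C * real n powr (- 1 / 2))))"
proof -
  define m where "m = (2 ^ (r + 1) - 1 :: real)"
  have p2: "(2::real) ^ r = (m + 1) / 2" "(2::real) ^ (r + 1) = m + 1" "(2::real) ^ (r + 2) = 2 * (m + 1)"
    "(2::real) ^ (r + 4) = 8 * (m + 1)"
    by (simp_all add: m_def eval_nat_numeral)
  have p4: "(4::real) ^ (r + 1) = (m + 1)\<^sup>2"
    by (simp add: p2(2)[symmetric] power_mult_distrib[symmetric] power2_eq_square del: power_Suc power_add)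
  have m1: "m \<ge> 1" using one_le_power[of "2::real" r] by (simp add: m_def)
  have m_pos: "m > 0" using m1 by simp
  define s where "s = (m\<^sup>2 - 1) / (6 * m\<^sup>2)"
  have s_eq: "2 ^ (r + 1) * (2 ^ r - 1) / (3 * m ^ 2) = s"
    using m_pos unfolding p2 s_def by (simp add: field_simps power2_eq_square)
  define a where "a = - ((m - 1) * (m - 2) / (6 * m))"
  have a_eq: "(2 ^ r - 1) * (2 ^ (r + 1) - 3) / (3 * m) = - a"
    using m_pos unfolding p2 a_def by (simp add: field_simps)
  let ?X = "\<lambda>t. real (path_cut_size r t)" and ?E = "\<lambda>n. measure_pmf.expectation (random_plane_tree n)"
  obtain \<Lambda> \<delta> C where Q: "quasi_power random_plane_tree ?X \<Lambda> \<delta> C (1 / m) s"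
    using quasi_power_path_cut_size[of r, folded m_def, folded s_def] by blast
  interpret Q: quasi_power random_plane_tree ?X \<Lambda> \<delta> C "1 / m" s by (rule Q)

  have mean: "(\<lambda>n. ?E n ?X - (real n / m + a)) \<in> O(\<lambda>n. real n powr (-1))"
  proof -
    obtain K where K: "\<And>n. n \<ge> 1 \<Longrightarrow> \<bar>mean_size r n - (real n / m - (m - 1) * (m - 2) / (6 * m))\<bar> \<le> K / real n"
      by (rule mean_size_asymptotics[of r, folded m_def], rule that)
    show ?thesis
    proof (rule bigo_powrI[where B = K])
      fix n :: nat assume n: "n \<ge> 1"
      have "?E n ?X = mean_size r n"
        by (simp add: expectation_random_plane_tree[OF n] mean_size_def)
      then show "\<bar>?E n ?X - (real n / m + a)\<bar> \<le> K * real n powr (-1)"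
        using K[OF n] by (simp only: a_def add_uminus_conv_diff powr_minus powr_one[OF of_nat_0_le_iff] divide_inverse[of K])
    qed
  qed
  have var: "(\<lambda>n. measure_pmf.variance (random_plane_tree n) ?X - s * real n) \<in> O(\<lambda>n. 1)"
  proof (rule bigoI)
    show "eventually (\<lambda>n. norm (measure_pmf.variance (random_plane_tree n) ?X - s * real n)
        \<le> (2 * C / (\<delta> / 2)\<^sup>2 + (C / (\<delta> / 2))\<^sup>2) * norm (1 :: real)) at_top"
      using eventually_ge_at_top[of "1 :: nat"] by eventually_elim (use Q.variance_le in simp)
  qed
  have moments: "(\<lambda>n. ?E n (\<lambda>t. falling_factorial (?X t) d) - (real n ^ d / m ^ d + real d / (12 * m ^ d)
        * ((m + 1)\<^sup>2 * real d - 8 * (m + 1) * real d - 3 * (m + 1)\<^sup>2 + 18 * (m + 1) + 6 * real d - 18) * real n ^ (d - 1)))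
      \<in> O(\<lambda>n. real n powr (real d - 3 / 2))" if "d \<ge> 1" for d
  proof (cases "d = 1")
    \<comment> \<open>For d = 1 the claim is the expansion of the mean, whose error n^(-1) is below
      n^(-1/2).\<close>
    case True
    have "real n / m + a = real n ^ d / m ^ d + real d / (12 * m ^ d)
        * ((m + 1)\<^sup>2 * real d - 8 * (m + 1) * real d - 3 * (m + 1)\<^sup>2 + 18 * (m + 1) + 6 * real d - 18) * real n ^ (d - 1)" for n
      using m_pos by (simp add: True a_def field_simps power2_eq_square)
    moreover have "falling_factorial x d = x" for x by (simp add: True falling_factorial_def)
    moreover have "(\<lambda>n. ?E n ?X - (real n / m + a)) \<in> O(\<lambda>n. real n powr (real d - 3 / 2))"
      by (rule bigo_powr_mono[OF mean]) (simp add: True)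
    ultimately show ?thesis by (simp only:)
  next
    case False
    with that have d: "d \<ge> 2" by simp
    define k where "k = real d * (real d - 1) / 2"
    have "(\<lambda>n. ?E n (Q.Y n) - a) \<in> O(\<lambda>n. real n powr (-1))"
    proof -
      have "eventually (\<lambda>n. ?E n (Q.Y n) - a = ?E n ?X - (real n / m + a)) at_top"
        using eventually_ge_at_top[of "1 :: nat"]
        by eventually_elim (simp add: Q.Y_def[abs_def])
      from landau_o.big.in_cong[OF this] show ?thesis using mean by (rule iffD2)
    qed
    note B = Q.power_moment_second_order[OF d this]
    have "(\<lambda>n. ?E n (\<lambda>t. ?X t ^ (d - 1)) - (1 / m * real n) ^ (d - 1)) \<in> O(\<lambda>n. real n powr (real d - 3 / 2))"
      by (rule bigo_powr_mono[OF Q.power_moment_leading]) (use d in \<open>auto simp: of_nat_diff\<close>)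
    then have "(\<lambda>n. k * (?E n (\<lambda>t. ?X t ^ (d - 1)) - (1 / m * real n) ^ (d - 1))) \<in> O(\<lambda>n. real n powr (real d - 3 / 2))"
      by simp
    from sum_in_bigo(2)[OF sum_in_bigo(1)[OF falling_factorial_moment_approx[OF d, of r, folded k_def] B] this]
    have "(\<lambda>n. ?E n (\<lambda>t. falling_factorial (?X t) d) - ((1 / m * real n) ^ d + real d * (1 / m * real n) ^ (d - 1) * a
        + real (d choose 2) * (1 / m * real n) ^ (d - 2) * (s * real n) - k * (1 / m * real n) ^ (d - 1)))
        \<in> O(\<lambda>n. real n powr (real d - 3 / 2))"
      by (rule back_subst[of "\<lambda>f. f \<in> O(\<lambda>n. real n powr (real d - 3 / 2))"]) (simp add: fun_eq_iff right_diff_distrib)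
    then show ?thesis
      unfolding k_def a_def s_def second_order_coefficient[OF m_pos d] .
  qed
  have normal: "\<exists>B. \<forall>\<^sub>F n in sequentially. \<forall>x::real.
      \<bar>measure_pmf.prob (random_plane_tree n) {t. (?X t - 1 / m * real n) / sqrt (s * real n) \<le> x}
        - 1 / sqrt (2 * pi) * (LBINT t:{..x}. exp (- (t ^ 2) / 2))\<bar> \<le> B * real n powr (- 1 / 2)" if r: "r \<ge> 1"
  proof -
    \<comment> \<open>For r = 0 one has m = 1 and variance constant 0, since no node is deleted;
      normalization by the standard deviation is possible from r = 1 on.\<close>
    have "m > 1" using power_strict_increasing[of 1 "r + 1" "2::real"] r by (simp add: m_def)
    then have "m\<^sup>2 > 1" by (simp add: one_less_power)
    then have "s > 0" using m_pos by (simp add: s_def)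
    obtain B where B: "\<And>n x. n \<ge> 1 \<Longrightarrow>
        \<bar>measure_pmf.prob (random_plane_tree n) {t. Q.Y n t / sqrt (s * real n) \<le> x} - cdf std_normal_distribution x\<bar> \<le> B / sqrt (real n)"
      by (rule Q.berry_esseen[OF \<open>s > 0\<close>], rule that)
    show ?thesis
    proof (intro exI[of _ B] eventually_mono[OF eventually_ge_at_top[of "1 :: nat"]] allI)
      fix n :: nat and x :: real assume n: "n \<ge> 1"
      have "B / sqrt (real n) = B * real n powr (- 1 / 2)"
        by (simp only: minus_divide_left[symmetric] powr_minus powr_half_sqrt[OF of_nat_0_le_iff] divide_inverse[of B])
      with B[OF n, of x] show "\<bar>measure_pmf.prob (random_plane_tree n) {t. (?X t - 1 / m * real n) / sqrt (s * real n) \<le> x}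
          - 1 / sqrt (2 * pi) * (LBINT t:{..x}. exp (- (t ^ 2) / 2))\<bar> \<le> B * real n powr (- 1 / 2)"
        by (simp only: Q.Y_def cdf_std_normal_eq)
    qed
  qed
  have c18: "9 * 2 ^ (r + 2) = 18 * (m + 1)" using p2(3) by simp
  show ?thesis
    unfolding m_def[symmetric] s_eq a_eq p4 p2(4) c18
    using mean var moments normal by (simp only: diff_minus_eq_add) blast
qed

end
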